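(* Let $f:\mathbb{R}^d\to\mathbb{R}$ be differentiable and bounded from below, with $\nabla f$ Lipschitz continuous with parameter $\mathsf{L}>0$, and suppose that $f$ satisfies the Łojasiewicz inequality on $\mathrm{crit}(f)$ (see context). Let $\{\boldsymbol{x}^k\}_k$ be generated by the stochastic gradient method with momentum (SGDM, see context) with $\lambda\in[0,1)$ and $\nu\ge0$, where the stochastic errors satisfy $\mathbb{E}[\boldsymbol{e}^k\mid\mathcal{F}_k]=0$ and $\mathbb{E}[\|\boldsymbol{e}^k\|^2\mid\mathcal{F}_k]\le\sigma^2$ almost surely for all $k$ (for some constant $\sigma\ge0$). For a given function $g:(0,\infty)\to(0,\infty)$, let the step sizes $\{\alpha_k\}_k\subset(0,\infty)$ be non-increasing and satisfy $$\sum_{k=1}^\infty\alpha_k=\infty\quad\text{and}\quad\sum_{k=1}^\infty\alpha_k^2\,g(\Delta_k)^2<\infty,\quad\text{where }\Delta_k:=\sum_{i=1}^k\alpha_i.$$ Let $\mathcal{X}:=\{\omega\in\Omega:\liminf_{k\to\infty}\|\boldsymbol{x}^k(\omega)\|<\infty\}$. (a) Suppose $g(x)=x^r$ with $r>\frac12$. Then, almost surely on $\mathcal{X}$, $\{\boldsymbol{x}^k\}_k$ converges to a $\mathrm{crit}(f)$-valued limit $\boldsymbol{x}^*$. Moreover, there is an event $\mathcal{R}$ with $\mathbb{P}(\mathcal{R})=\mathbb{P}(\mathcal{X})$ such that for all $\omega\in\mathcal{R}$ the realizations $x^k=\boldsymbol{x}^k(\omega)$ and $x^*=\boldsymbol{x}^*(\omega)=\lim_k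 x^k\in\mathrm{crit}(f)$ satisfy, as $k\to\infty$, $$\|x^k-x^*\|=\mathcal{O}(\Delta_k^{-\phi(\theta)})\quad\text{and}\quad\max\{|f(x^k)-f(x^* )|,\|\nabla f(x^k)\|^2\}=\mathcal{O}(\Delta_k^{-\psi(\theta)}),$$ where $\theta\in[\frac12,1)$ is the Łojasiewicz exponent of $f$ at $x^*$, $\phi(\theta):=\min\{r-\frac12,\frac{1-\theta}{2\theta-1}\}$ and $\psi(\theta):=\min\{2r,\frac{1}{2\theta-1}\}$. (b) Suppose $g(x)=x^{-p}\exp(rx)$ with $r>0$ and $p\ge0$. Then, almost surely on $\mathcal{X}$, $\{\boldsymbol{x}^k\}_k$ converges to a $\mathrm{crit}(f)$-valued limit $\boldsymbol{x}^*$. Moreover, there is an event $\mathcal{R}$ with $\mathbb{P}(\mathcal{R})=\mathbb{P}(\mathcal{X})$ such that for all $\omega\in\mathcal{R}$ the realizations $x^k=\boldsymbol{x}^k(\omega)$ and $x^*=\boldsymbol{x}^*(\omega)=\lim_k x^k\in\mathrm{crit}(f)$ satisfy, as $k\to\infty$, $$\|x^k-x^*\|=\mathcal{O}(g(\Delta_k)^{-1})\quad\text{and}\quad\max\{|f(x^k)-f(x^* )|,\|\nabla f(x^k)\|^2\}=\mathcal{O}(g(\Delta_k)^{-2}),$$ whenever the Łojasiewicz exponent of $f$ at $x^*$ is $\theta=\frac12$ and $r<\mathsf{C}^2/400$, where $\mathsf{C}=\mathsf{C}(x^* )$ is the Łojasiewicz constant of the merit function $\mathcal{M}$ at $(x^*,x^*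 )$ (see context).
   Context: SGDM: on a probability space $(\Omega,\mathcal{F},\mathbb{P})$, with deterministic initial points $\boldsymbol{x}^1=\boldsymbol{x}^0=x^0\in\mathbb{R}^d$, deterministic step sizes $\alpha_k>0$ and parameters $\lambda\in[0,1)$, $\nu\ge0$, SGDM generates the stochastic process given for $k\ge1$ by $$\tilde{\boldsymbol{x}}^k=\boldsymbol{x}^k+\nu(\boldsymbol{x}^k-\boldsymbol{x}^{k-1}),\quad \boldsymbol{g}^k=\nabla f(\tilde{\boldsymbol{x}}^k)-\boldsymbol{e}^k,\quad \boldsymbol{x}^{k+1}=\boldsymbol{x}^k-\alpha_k\boldsymbol{g}^k+\lambda(\boldsymbol{x}^k-\boldsymbol{x}^{k-1}),$$ where $\boldsymbol{e}^k:\Omega\to\mathbb{R}^d$ are random vectors (stochastic errors). The filtration is $\mathcal{F}_k=\sigma(\boldsymbol{x}^0,\boldsymbol{x}^1,\dots,\boldsymbol{x}^k)$. $\mathrm{crit}(f)=\{x\in\mathbb{R}^d:\nabla f(x)=0\}$. The function $f$ satisfies the Łojasiewicz inequality on $\mathrm{crit}(f)$ if for every $x^*\in\mathrm{crit}(f)$ there are $\eta\in(0,\infty]$, a neighborhood $U(x^* )$ of $x^*$, a constant $\mathsf{C}_f=\mathsf{C}_f(x^* )>0$ and an exponent $\theta=\theta(x^* )\in[\frac12,1)$ (the Łojasiewicz exponent of $f$ at $x^*$) such that $\|\nabla f(x)\|\ge\mathsf{C}_f|f(x)-f(x^* )|^\theta$ for all $x\in U(x^* )$ with $0<|f(x)-f(x^*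 )|<\eta$. Merit function: $\mathcal{M}(x,z)=f(z)+\zeta\|z-x\|^2$ on $\mathbb{R}^d\times\mathbb{R}^d$ with $\zeta=\frac{3\mathsf{L}}{1-\lambda}$. If $f$ has Łojasiewicz exponent $\theta$ at $x^*$, then $\mathcal{M}$ satisfies the Łojasiewicz inequality at $(x^*,x^* )$ with the same exponent: there are $\eta\in(0,\infty]$, a neighborhood $U(x^* )$ of $x^*$ and a constant $\mathsf{C}=\mathsf{C}(x^* )>0$ such that $\|\nabla\mathcal{M}(x,z)\|\ge\mathsf{C}|\mathcal{M}(x,z)-f(x^* )|^\theta$ for all $x,z\in U(x^* )\cap\{y\in\mathbb{R}^d:|f(y)-f(x^* )|<\eta\}$. The constant $\mathsf{C}$ in part (b) is such a constant (with $\theta=\frac12$). Conventions: $\frac{1}{2\theta-1}$ and $\frac{1-\theta}{2\theta-1}$ are read as $+\infty$ when $\theta=\frac12$. The constants in the $\mathcal{O}$-terms may depend on $\omega$. *)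

theory Defs
  imports "HOL-Probability.Probability" "HOL-Library.Landau_Symbols"
begin

definition grad :: "('a::euclidean_space \<Rightarrow> real) \<Rightarrow> 'a \<Rightarrow> 'a" where
  "grad f x = (THE D. GDERIV f x :> D)"

lemma grad_eq:
  assumes "GDERIV f x :> D"
  shows "grad f x = D"
proof -
  have "D' = D" if "GDERIV f x :> D'" for D'
  proof -
    have "(\<lambda>h. inner h D') = (\<lambda>h. inner h D)"
      using that assms unfolding gderiv_def by (rule has_derivative_unique)
    then have "inner h D' = inner h D" for h
      by meson
    then show ?thesis
      using vector_eq_ldot by blast
  qed
  with assms show ?thesis
    unfolding grad_def by blast
qed

definition crit :: "('a::euclidean_space \<Rightarrow> real) \<Rightarrow> 'a set" where
  "crit f = {x. grad f x = 0}"

definition lojasiewicz_exponent :: "('a::euclidean_space \<Rightarrow> real) \<Rightarrow> 'a \<Rightarrow> real \<Rightarrow> bool" where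
  "lojasiewicz_exponent f y \<theta> \<longleftrightarrow>
     1/2 \<le> \<theta> \<and> \<theta> < 1 \<and>
     (\<exists>(\<eta>::ereal) U C. 0 < \<eta> \<and> y \<in> interior U \<and> 0 < C \<and>
        (\<forall>x\<in>U. 0 < \<bar>f x - f y\<bar> \<and> ereal \<bar>f x - f y\<bar> < \<eta> \<longrightarrow>
           norm (grad f x) \<ge> C * \<bar>f x - f y\<bar> powr \<theta>))"

definition lojasiewicz_on_crit :: "('a::euclidean_space \<Rightarrow> real) \<Rightarrow> bool" where
  "lojasiewicz_on_crit f \<longleftrightarrow> (\<forall>y\<in>crit f. \<exists>\<theta>. lojasiewicz_exponent f y \<theta>)"

definition merit :: "('a::euclidean_space \<Rightarrow> real) \<Rightarrow> real \<Rightarrow> real \<Rightarrow> 'a \<times> 'a \<Rightarrow> real" where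
  "merit f L lam = (\<lambda>(x, z). f z + (3 * L / (1 - lam)) * (norm (z - x))\<^sup>2)"

text \<open>The predicate says that \<open>C\<close> is a Lojasiewicz constant of the merit function at \<open>(y, y)\<close>
  for the exponent \<open>\<theta>\<close>. The product type carries the Euclidean inner product of
  \<open>'a \<times> 'a\<close>, so \<open>grad\<close> below is the full gradient in \<open>(x, z)\<close>.\<close>

definition merit_lojasiewicz_constant ::
  "('a::euclidean_space \<Rightarrow> real) \<Rightarrow> real \<Rightarrow> real \<Rightarrow> 'a \<Rightarrow> real \<Rightarrow> real \<Rightarrow> bool" where
  "merit_lojasiewicz_constant f L lam y \<theta> C \<longleftrightarrow>
     0 < C \<and>
     (\<exists>(\<eta>::ereal) U. 0 < \<eta> \<and> y \<in> interior U \<and>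
        (\<forall>x \<in> U \<inter> {u. ereal \<bar>f u - f y\<bar> < \<eta>}. \<forall>z \<in> U \<inter> {u. ereal \<bar>f u - f y\<bar> < \<eta>}.
           norm (grad (merit f L lam) (x, z)) \<ge> C * \<bar>merit f L lam (x, z) - f y\<bar> powr \<theta>))"

text \<open>The errors \<open>e k\<close> and step sizes \<open>\<alpha> k\<close> are only relevant for \<open>k \<ge> 1\<close>.\<close>

definition sgdm ::
  "'w measure \<Rightarrow> ('a::euclidean_space \<Rightarrow> real) \<Rightarrow> (nat \<Rightarrow> real) \<Rightarrow> real \<Rightarrow> real \<Rightarrow> 'a \<Rightarrow>
   (nat \<Rightarrow> 'w \<Rightarrow> 'a) \<Rightarrow> (nat \<Rightarrow> 'w \<Rightarrow> 'a) \<Rightarrow> bool" where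
  "sgdm M f \<alpha> lam \<nu> x0 e x \<longleftrightarrow>
     (\<forall>\<omega>\<in>space M. x 0 \<omega> = x0 \<and> x 1 \<omega> = x0 \<and>
       (\<forall>k\<ge>1.
          let xt = x k \<omega> + \<nu> *\<^sub>R (x k \<omega> - x (k - 1) \<omega>);
              g = grad f xt - e k \<omega>
          in x (k + 1) \<omega> = x k \<omega> - \<alpha> k *\<^sub>R g + lam *\<^sub>R (x k \<omega> - x (k - 1) \<omega>)))"

definition natural_filtration :: "'w measure \<Rightarrow> (nat \<Rightarrow> 'w \<Rightarrow> 'a::euclidean_space) \<Rightarrow> nat \<Rightarrow> 'w measure" where
  "natural_filtration M x k =
     sigma (space M) {x i -` A \<inter> space M | i A. i \<le> k \<and> A \<in> sets borel}"

definition vec_cond_exp ::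
  "'w measure \<Rightarrow> 'w measure \<Rightarrow> ('w \<Rightarrow> 'a::euclidean_space) \<Rightarrow> 'w \<Rightarrow> 'a" where
  "vec_cond_exp M F X \<omega> = (\<Sum>b\<in>Basis. real_cond_exp M F (\<lambda>\<omega>. X \<omega> \<bullet> b) \<omega> *\<^sub>R b)"

text \<open>The second moment is stated with the extended nonnegative conditional expectation. The
  bound therefore forces \<open>e k\<close> to be square integrable, so that the conditional mean in the
  first condition is a genuine one; no separate integrability assumption is needed.\<close>

definition stochastic_errors ::
  "'w measure \<Rightarrow> (nat \<Rightarrow> 'w \<Rightarrow> 'a::euclidean_space) \<Rightarrow> (nat \<Rightarrow> 'w \<Rightarrow> 'a) \<Rightarrow> real \<Rightarrow> bool" where
  "stochastic_errors M x e \<sigma> \<longleftrightarrow>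
     (\<forall>k\<ge>1.
        e k \<in> borel_measurable M \<and>
        (AE \<omega> in M. vec_cond_exp M (natural_filtration M x k) (e k) \<omega> = 0) \<and>
        (AE \<omega> in M. nn_cond_exp M (natural_filtration M x k) (\<lambda>\<omega>. ennreal ((norm (e k \<omega>))\<^sup>2)) \<omega>
                      \<le> ennreal (\<sigma>\<^sup>2)))"

definition step_sum :: "(nat \<Rightarrow> real) \<Rightarrow> nat \<Rightarrow> real" where
  "step_sum \<alpha> k = (\<Sum>i=1..k. \<alpha> i)"

text \<open>In the exponents, \<open>(1 - \<theta>) / (2 * \<theta> - 1)\<close> and \<open>1 / (2 * \<theta> - 1)\<close> are read as infinite
  when \<open>\<theta> = 1/2\<close> (whereas HOL division by zero would return zero).\<close>

definition rate_phi :: "real \<Rightarrow> real \<Rightarrow> real" where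
  "rate_phi r \<theta> = (if \<theta> = 1/2 then r - 1/2 else min (r - 1/2) ((1 - \<theta>) / (2 * \<theta> - 1)))"

definition rate_psi :: "real \<Rightarrow> real \<Rightarrow> real" where
  "rate_psi r \<theta> = (if \<theta> = 1/2 then 2 * r else min (2 * r) (1 / (2 * \<theta> - 1)))"

definition liminf_bounded :: "'w measure \<Rightarrow> (nat \<Rightarrow> 'w \<Rightarrow> 'a::euclidean_space) \<Rightarrow> 'w set" where
  "liminf_bounded M x = {\<omega> \<in> space M. liminf (\<lambda>k. ereal (norm (x k \<omega>))) < \<infinity>}"

end

theory Submission
  imports Defs "HOL-Real_Asymp.Real_Asymp"
begin

text \<open>
  The idea is to remove the noise from the iterates by a change of variables whose error is small
  enough for a deterministic argument along almost every realization. With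
  \<open>d k = x k - x (k - 1)\<close> and \<open>\<beta> k = \<alpha> k / (1 - lam)\<close>, the points \<open>x k + lam / (1 - lam) * d k\<close>
  perform a memoryless stochastic gradient step of size \<open>\<beta> k\<close>. Adding the filtered noise
  \<open>u (k + 1) = (1 - \<kappa> * \<beta> k) * u k - \<beta> k * e k\<close> gives points \<open>z k\<close> with
  \<open>z (k + 1) = z k - \<beta> k * (w k + \<kappa> * u k)\<close>, where \<open>w k\<close> is the gradient at the extrapolated
  point: the martingale increments cancel, and \<open>z\<close> follows the gradient of \<open>f\<close> up to an error
  of order \<open>norm (d k) + norm (u k)\<close>.

  The discounting in \<open>u\<close> is what makes the stated exponents reachable. It lets \<open>u k\<close> remember the
  noise of about one unit of the time \<open>step_sum \<alpha>\<close> only, so that with \<open>G k = g (step_sum \<alpha> k)\<close>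
  the weighted second moments of \<open>u\<close> satisfy a contractive recursion. They yield, almost surely,
  \<open>\<Sum>k. \<beta> k * (G k * norm (u k))^2 < \<infinity>\<close>, and a maximal inequality yields boundedness of
  \<open>G k * norm (u k)\<close> (\<open>weighted_filtered_noise\<close>). Correcting by the whole future noise instead
  would cancel the increments as well, but for polynomial \<open>g\<close> the weighted squares of such a
  correction need not be summable.

  Along such a realization, \<open>f (z k) + (norm (d k))^2\<close> decreases by a multiple of
  \<open>\<beta> k * (norm (grad f (z k)))^2 + (norm (d k))^2\<close>, up to errors \<open>s k\<close> with
  \<open>\<Sum>k. (G k)^2 * s k < \<infinity>\<close>. Adding the tail of these errors gives a decreasing Lyapunov function
  \<open>V\<close>, and the tail itself is at most \<open>1 / (G k)^2\<close>. The Lojasiewicz inequality bounds \<open>V k\<close> in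
  terms of its dissipation and this tail. Applied to \<open>V powr (1 - \<theta>)\<close> it bounds the path length and captures
  the path near an accumulation point (\<open>path_length_step\<close>, \<open>capture_near_accumulation_point\<close>);
  applied to \<open>V\<close> itself it is a discrete differential inequality, which gives the rate of \<open>V\<close>
  (\<open>decay_rate\<close>). As \<open>f\<close> need not have a local minimum at the limit, the rate of the gradient does
  not follow from smoothness and the rate of the values; it comes from the dissipation, since the
  gradient grows slowly while its weighted squares are summable at the rate of \<open>V\<close>
  (\<open>stationarity_rate\<close>).

  In the polynomial case a Lojasiewicz exponent may be raised near a critical point. Raising it to
  \<open>max \<theta> ((2 * r + 1) / (4 * r))\<close> balances the noise against the descent, and both minima in the
  exponents become the values that belong to this single exponent (\<open>rate_exponents\<close>). In the
  exponential case, a Lojasiewicz constant of the merit function is one of \<open>f\<close>, as is seen on the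
  diagonal, and \<open>r < C^2 / 400\<close> lets the descent outrun the growth of \<open>g\<close>.
\<close>

section \<open>Smooth functions and Lojasiewicz inequalities\<close>

locale smooth_function =
  fixes f :: "'a::euclidean_space \<Rightarrow> real" and L :: real
  assumes differentiable: "\<And>y. f differentiable (at y)"
    and L_pos: "0 < L"
    and grad_lipschitz: "L-lipschitz_on UNIV (grad f)"
begin

lemma GDERIV_grad: "GDERIV f y :> grad f y"
proof -
  obtain F where F: "(f has_derivative F) (at y)"
    using differentiable[of y] unfolding differentiable_def by blast
  then interpret F: bounded_linear F by (rule has_derivative_bounded_linear)
  define D where "D = (\<Sum>b\<in>Basis. F b *\<^sub>R b)"
  have "F h = inner h D" for h
  proof -
    have "F h = F (\<Sum>b\<in>Basis. (h \<bullet> b) *\<^sub>R b)" by (simp add: euclidean_representation)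
    also have "\<dots> = (\<Sum>b\<in>Basis. (h \<bullet> b) * F b)" by (simp add: F.sum F.scaleR)
    also have "\<dots> = inner h D" unfolding D_def
      by (simp add: inner_sum_right mult.commute)
    finally show ?thesis .
  qed
  then have "F = (\<lambda>h. inner h D)" by blast
  then have "GDERIV f y :> D" using F unfolding gderiv_def by simp
  then show ?thesis using grad_eq by metis
qed

lemma grad_diff_le: "norm (grad f y - grad f w) \<le> L * norm (y - w)"
  using lipschitz_onD[OF grad_lipschitz, of y w] by (simp add: dist_norm)

lemma continuous_grad: "continuous_on UNIV (grad f)"
  using grad_lipschitz lipschitz_on_continuous_on by blast

lemma continuous_f: "continuous_on UNIV f"
  using differentiable by (simp add: continuous_at_imp_continuous_on differentiable_imp_continuous_within)

text \<open>The mean value theorem along the segment costs a factor two against the sharp constant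
  \<open>L / 2\<close>; this only affects how small the steps have to be.\<close>
lemma first_order_expansion: "\<bar>f y - f w - grad f w \<bullet> (y - w)\<bar> \<le> L * (norm (y - w))\<^sup>2"
proof -
  define h where "h = y - w"
  have der: "((\<lambda>t. f (w + t *\<^sub>R h)) has_real_derivative (h \<bullet> grad f (w + t *\<^sub>R h))) (at t)" for t
  proof -
    have "(f has_derivative (\<lambda>h'. h' \<bullet> grad f (w + t *\<^sub>R h))) (at (w + t *\<^sub>R h))"
      using GDERIV_grad unfolding gderiv_def .
    moreover have "((\<lambda>t. w + t *\<^sub>R h) has_derivative (\<lambda>t. t *\<^sub>R h)) (at t)"
      by (auto intro!: derivative_eq_intros)
    ultimately have "((\<lambda>t. f (w + t *\<^sub>R h)) has_derivative (\<lambda>t'. (t' *\<^sub>R h) \<bullet> grad f (w + t *\<^sub>R h))) (at t)"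
      using has_derivative_compose[of "\<lambda>t. w + t *\<^sub>R h" "\<lambda>t. t *\<^sub>R h" t UNIV f] by blast
    moreover have "(\<lambda>t'. (t' *\<^sub>R h) \<bullet> grad f (w + t *\<^sub>R h)) = (*) (h \<bullet> grad f (w + t *\<^sub>R h))"
      by auto
    ultimately show ?thesis
      by (simp add: has_field_derivative_def)
  qed
  obtain \<xi> where \<xi>: "0 < \<xi>" "\<xi> < 1"
    and eq: "f (w + 1 *\<^sub>R h) - f (w + 0 *\<^sub>R h) = (1 - 0) * (h \<bullet> grad f (w + \<xi> *\<^sub>R h))"
    using MVT2[of 0 1 "\<lambda>t. f (w + t *\<^sub>R h)" "\<lambda>t. h \<bullet> grad f (w + t *\<^sub>R h)"] der
    by (metis zero_less_one)
  have "f y - f w - grad f w \<bullet> (y - w) = h \<bullet> (grad f (w + \<xi> *\<^sub>R h) - grad f w)"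
    using eq by (simp add: h_def inner_diff_right inner_commute)
  also have "\<bar>\<dots>\<bar> \<le> norm h * norm (grad f (w + \<xi> *\<^sub>R h) - grad f w)"
    by (rule Cauchy_Schwarz_ineq2)
  also have "\<dots> \<le> norm h * (L * norm h)"
  proof (rule mult_left_mono)
    have "norm (grad f (w + \<xi> *\<^sub>R h) - grad f w) \<le> L * norm (\<xi> *\<^sub>R h)"
      using grad_diff_le[of "w + \<xi> *\<^sub>R h" w] by simp
    also have "\<dots> \<le> L * norm h"
      using \<xi> L_pos by (simp add: mult_left_le_one_le)
    finally show "norm (grad f (w + \<xi> *\<^sub>R h) - grad f w) \<le> L * norm h" .
  qed simp
  finally show ?thesis by (simp add: h_def power2_eq_square algebra_simps)
qed

end

lemma ball_within_values:
  fixes f :: "'a::euclidean_space \<Rightarrow> real" and \<eta> :: ereal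
  assumes cont: "continuous_on UNIV f" and \<eta>: "0 < \<eta>" and U: "y \<in> interior U"
  shows "\<exists>\<rho>>0. \<forall>w\<in>ball y \<rho>. w \<in> U \<and> ereal \<bar>f w - f y\<bar> < \<eta>"
proof -
  obtain \<eta>' where \<eta>': "0 < \<eta>'" "ereal \<eta>' \<le> \<eta>"
    using \<eta> by (metis ereal_dense2 less_ereal.simps(1) order_less_imp_le zero_ereal_def)
  obtain \<rho>1 where \<rho>1: "0 < \<rho>1" "ball y \<rho>1 \<subseteq> U"
    using U by (meson interior_subset mem_interior subset_trans)
  have "isCont f y" using cont by (simp add: continuous_on_eq_continuous_at)
  then obtain \<rho>2 where \<rho>2: "0 < \<rho>2" "\<And>w. dist w y < \<rho>2 \<Longrightarrow> dist (f w) (f y) < \<eta>'"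
    using \<eta>'(1) unfolding continuous_at_eps_delta by blast
  show ?thesis
  proof (intro exI[of _ "min \<rho>1 \<rho>2"] conjI ballI)
    fix w assume w: "w \<in> ball y (min \<rho>1 \<rho>2)"
    have "\<bar>f w - f y\<bar> < \<eta>'" using \<rho>2(2)[of w] w by (simp add: dist_commute dist_real_def)
    then show "ereal \<bar>f w - f y\<bar> < \<eta>" using \<eta>'(2) by (meson less_ereal.simps(1) less_le_trans)
    show "w \<in> U" using w \<rho>1 by auto
  qed (use \<rho>1 \<rho>2 in auto)
qed

text \<open>Points with \<open>f w = f y\<close> satisfy the inequality trivially, since \<open>0 powr \<theta> = 0\<close>, and the restriction
  on the values of \<open>f\<close> is automatic near \<open>y\<close>.\<close>
lemma lojasiewicz_ball:
  fixes f :: "'a::euclidean_space \<Rightarrow> real"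
  assumes "lojasiewicz_exponent f y \<theta>" "continuous_on UNIV f"
  shows "\<exists>C>0. \<exists>\<rho>>0. \<forall>w\<in>ball y \<rho>. C * \<bar>f w - f y\<bar> powr \<theta> \<le> norm (grad f w)"
proof -
  obtain \<eta> :: ereal and U C where \<eta>: "0 < \<eta>" and U: "y \<in> interior U" and C: "0 < C"
    and *: "\<And>x. x \<in> U \<Longrightarrow> 0 < \<bar>f x - f y\<bar> \<Longrightarrow> ereal \<bar>f x - f y\<bar> < \<eta> \<Longrightarrow>
       C * \<bar>f x - f y\<bar> powr \<theta> \<le> norm (grad f x)"
    using assms(1) unfolding lojasiewicz_exponent_def by blast
  obtain \<rho> where \<rho>: "0 < \<rho>" "\<forall>w\<in>ball y \<rho>. w \<in> U \<and> ereal \<bar>f w - f y\<bar> < \<eta>"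
    using ball_within_values[OF assms(2) \<eta> U] by blast
  have "C * \<bar>f w - f y\<bar> powr \<theta> \<le> norm (grad f w)" if "w \<in> ball y \<rho>" for w
    using *[of w] \<rho>(2) that by (cases "f w = f y") auto
  then show ?thesis using \<rho>(1) C by blast
qed

text \<open>Near \<open>y\<close> the values differ by less than one, where larger powers are smaller.\<close>
lemma lojasiewicz_ball_exponent_mono:
  fixes f :: "'a::euclidean_space \<Rightarrow> real"
  assumes cont: "continuous_on UNIV f" and "0 < \<rho>" and "0 < C" and "\<theta> \<le> \<theta>'"
    and *: "\<forall>w\<in>ball y \<rho>. C * \<bar>f w - f y\<bar> powr \<theta> \<le> norm (grad f w)"
  shows "\<exists>\<rho>'>0. \<forall>w\<in>ball y \<rho>'. C * \<bar>f w - f y\<bar> powr \<theta>' \<le> norm (grad f w)"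
proof -
  have "isCont f y" using cont by (simp add: continuous_on_eq_continuous_at)
  then obtain \<rho>2 where \<rho>2: "0 < \<rho>2" "\<And>w. dist w y < \<rho>2 \<Longrightarrow> dist (f w) (f y) < 1"
    unfolding continuous_at_eps_delta using zero_less_one by blast
  show ?thesis
  proof (intro exI[of _ "min \<rho> \<rho>2"] conjI ballI)
    fix w assume w: "w \<in> ball y (min \<rho> \<rho>2)"
    have "\<bar>f w - f y\<bar> < 1" using \<rho>2(2)[of w] w by (simp add: dist_commute dist_real_def)
    then have "\<bar>f w - f y\<bar> powr \<theta>' \<le> \<bar>f w - f y\<bar> powr \<theta>"
      using \<open>\<theta> \<le> \<theta>'\<close> by (cases "f w = f y") (auto intro: powr_mono')
    then show "C * \<bar>f w - f y\<bar> powr \<theta>' \<le> norm (grad f w)"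
      using * w \<open>0 < C\<close> by (smt (verit) min.strict_boundedE mem_ball mult_le_cancel_left_pos)
  qed (use assms \<rho>2 in auto)
qed

text \<open>On the diagonal the merit function agrees with \<open>f\<close>, and its gradient is \<open>(0, grad f w)\<close> because the
  quadratic coupling has a vanishing derivative there. So every Lojasiewicz constant of the merit
  function is one of \<open>f\<close>.\<close>
lemma (in smooth_function) merit_constant_ball:
  assumes "merit_lojasiewicz_constant f L' lam y (1/2) C"
  shows "\<exists>\<rho>>0. \<forall>w\<in>ball y \<rho>. C * \<bar>f w - f y\<bar> powr (1/2) \<le> norm (grad f w)"
proof -
  obtain \<eta> :: ereal and U where \<eta>: "0 < \<eta>" and U: "y \<in> interior U" and C: "0 < C"
    and *: "\<And>w. w \<in> U \<Longrightarrow> ereal \<bar>f w - f y\<bar> < \<eta> \<Longrightarrow>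
       C * \<bar>merit f L' lam (w, w) - f y\<bar> powr (1/2) \<le> norm (grad (merit f L' lam) (w, w))"
    using assms unfolding merit_lojasiewicz_constant_def by blast
  obtain \<rho> where \<rho>: "0 < \<rho>" "\<forall>w\<in>ball y \<rho>. w \<in> U \<and> ereal \<bar>f w - f y\<bar> < \<eta>"
    using ball_within_values[OF continuous_f \<eta> U] by blast
  have gr: "grad (merit f L' lam) (w, w) = (0, grad f w)" for w
  proof (rule grad_eq)
    have f: "(f has_derivative (\<lambda>h. h \<bullet> grad f w)) (at (snd (w, w)))"
      using GDERIV_grad unfolding gderiv_def by simp
    have 1: "((\<lambda>p::'a\<times>'a. f (snd p)) has_derivative (\<lambda>h. snd h \<bullet> grad f w)) (at (w, w))"
      using has_derivative_compose[of snd snd "(w, w)" UNIV f "\<lambda>h. h \<bullet> grad f w"] f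
        has_derivative_snd[OF has_derivative_ident] by blast
    have 2: "((\<lambda>p::'a\<times>'a. (3 * L' / (1 - lam)) * ((snd p - fst p) \<bullet> (snd p - fst p)))
       has_derivative (\<lambda>h. 0)) (at (w, w))"
      by (rule derivative_eq_intros | simp)+
    have "merit f L' lam = (\<lambda>p. f (snd p) + (3 * L' / (1 - lam)) * ((snd p - fst p) \<bullet> (snd p - fst p)))"
      by (auto simp: merit_def power2_norm_eq_inner)
    then show "GDERIV (merit f L' lam) (w, w) :> (0, grad f w)"
      unfolding gderiv_def using has_derivative_add[OF 1 2] by (simp add: inner_prod_def)
  qed
  have "C * \<bar>f w - f y\<bar> powr (1/2) \<le> norm (grad f w)" if "w \<in> ball y \<rho>" for w
    using *[of w] \<rho>(2) that gr[of w] by (simp add: merit_def norm_Pair)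
  then show ?thesis using \<rho>(1) by blast
qed

section \<open>Tails, quasi-decreasing sequences and comparison of rates\<close>

definition tail :: "(nat \<Rightarrow> real) \<Rightarrow> nat \<Rightarrow> real" where
  "tail s k = (\<Sum>i. s (i + k))"

lemma tail_unfold: "summable s \<Longrightarrow> tail s k = s k + tail s (Suc k)"
  using suminf_split_head[of "\<lambda>i. s (i + k)"] summable_ignore_initial_segment[of s k]
  by (simp add: tail_def)

lemma tail_tendsto_0:
  assumes "summable s" shows "tail s \<longlonglongrightarrow> 0"
proof -
  have "tail s = (\<lambda>k. suminf s - sum s {..<k})"
    unfolding tail_def using suminf_split_initial_segment[OF assms] by (auto simp: fun_eq_iff algebra_simps)
  moreover have "(\<lambda>k. suminf s - sum s {..<k}) \<longlonglongrightarrow> suminf s - suminf s"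
    by (intro tendsto_intros summable_LIMSEQ assms)
  ultimately show ?thesis by simp
qed

lemma tail_nonneg:
  assumes "summable s" "\<And>k. n \<le> k \<Longrightarrow> 0 \<le> s k" shows "0 \<le> tail s n"
  unfolding tail_def by (rule suminf_nonneg) (use assms summable_ignore_initial_segment in auto)

lemma tail_mono:
  assumes "summable s" "summable t" "\<And>k. n \<le> k \<Longrightarrow> s k \<le> t k" shows "tail s n \<le> tail t n"
  unfolding tail_def by (rule suminf_le) (use assms summable_ignore_initial_segment in auto)

lemma tail_cmult: "summable s \<Longrightarrow> tail (\<lambda>k. c * s k) n = c * tail s n"
  unfolding tail_def by (rule suminf_mult) (simp add: summable_ignore_initial_segment)

lemma tail_add: "summable s \<Longrightarrow> summable t \<Longrightarrow> tail (\<lambda>k. s k + t k) n = tail s n + tail t n"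
  unfolding tail_def by (simp add: suminf_add summable_ignore_initial_segment)

text \<open>Summability and a bound on the tail are obtained at once from a comparison with the decrements of
  a nonnegative sequence. The boundary term is dropped, so no limit of \<open>T\<close> has to be identified.\<close>
lemma telescope_summable:
  fixes t T :: "nat \<Rightarrow> real"
  assumes "\<forall>\<^sub>F k in sequentially. 0 \<le> t k \<and> t k \<le> T k - T (Suc k) \<and> 0 \<le> T k"
  shows "summable t" and "\<forall>\<^sub>F k in sequentially. tail t k \<le> T k"
proof -
  obtain N where N: "\<And>k. N \<le> k \<Longrightarrow> 0 \<le> t k \<and> t k \<le> T k - T (Suc k) \<and> 0 \<le> T k"
    using assms unfolding eventually_sequentially by blast
  have bd: "(\<Sum>i<n. t (i + k)) \<le> T k - T (n + k)" if "N \<le> k" for n k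
  proof (induction n)
    case (Suc n)
    then show ?case using N[of "n + k"] that by simp
  qed simp
  have sm: "summable (\<lambda>i. t (i + k))" if "N \<le> k" for k
  proof (rule summableI_nonneg_bounded[of _ "T k"])
    fix n
    show "0 \<le> t (n + k)" using N[of "n + k"] that by simp
    have "0 \<le> T (n + k)" using N[of "n + k"] that by simp
    then show "(\<Sum>i<n. t (i + k)) \<le> T k" using bd[OF that, of n] by linarith
  qed
  show "summable t" using sm[of N] summable_iff_shift by blast
  have "tail t k \<le> T k" if "N \<le> k" for k
    unfolding tail_def
  proof (rule suminf_le_const[OF sm[OF that]])
    fix n
    have "0 \<le> T (n + k)" using N[of "n + k"] that by simp
    then show "(\<Sum>i<n. t (i + k)) \<le> T k" using bd[OF that, of n] by linarith
  qed
  then show "\<forall>\<^sub>F k in sequentially. tail t k \<le> T k" unfolding eventually_sequentially by blast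
qed

text \<open>Adding the tail of the perturbations turns \<open>v\<close> into a decreasing sequence.\<close>
lemma quasi_decreasing:
  fixes v p s :: "nat \<Rightarrow> real"
  assumes ev: "\<forall>\<^sub>F k in sequentially. 0 \<le> p k \<and> 0 \<le> s k \<and> v (Suc k) + p k \<le> v k + s k \<and> m \<le> v k"
    and s: "summable s"
  shows "convergent v" and "summable p"
proof -
  obtain N where N: "\<And>k. N \<le> k \<Longrightarrow> 0 \<le> p k \<and> 0 \<le> s k \<and> v (Suc k) + p k \<le> v k + s k \<and> m \<le> v k"
    using ev unfolding eventually_sequentially by blast
  define W where "W k = v k + tail s k - m" for k
  have W: "0 \<le> p k \<and> p k \<le> W k - W (Suc k) \<and> 0 \<le> W k" if "N \<le> k" for k
  proof -
    have "0 \<le> tail s k" by (rule tail_nonneg[OF s]) (use N that in auto)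
    then show ?thesis
      using N[OF that] tail_unfold[OF s, of k] by (auto simp: W_def)
  qed
  then show "summable p"
    by (intro telescope_summable[of p W]) (auto simp: eventually_sequentially)
  have "decseq (\<lambda>n. W (n + N))" 
  proof (rule decseq_SucI)
    show "W (Suc n + N) \<le> W (n + N)" for n using W[of "n + N"] by simp
  qed
  moreover have "\<forall>n. 0 \<le> W (n + N)" using W by simp
  ultimately obtain l where "(\<lambda>n. W (n + N)) \<longlonglongrightarrow> l"
    using decseq_convergent[of "\<lambda>n. W (n + N)" 0] by blast
  then have "W \<longlonglongrightarrow> l" by (rule LIMSEQ_offset)
  then have "(\<lambda>k. W k - tail s k + m) \<longlonglongrightarrow> l - 0 + m"
    by (intro tendsto_intros tail_tendsto_0[OF s])
  then show "convergent v" unfolding convergent_def W_def by auto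
qed

lemma nonsummable_liminf_zero:
  fixes \<beta> a :: "nat \<Rightarrow> real"
  assumes pos: "\<forall>\<^sub>F k in sequentially. 0 < \<beta> k" and ns: "\<not> summable \<beta>"
    and sm: "summable (\<lambda>k. \<beta> k * a k)" and lim: "a \<longlonglongrightarrow> l" and nn: "\<And>k. 0 \<le> a k"
  shows "l = 0"
proof (rule ccontr)
  assume "l \<noteq> 0"
  have "0 \<le> l" using lim nn LIMSEQ_le_const by blast
  with \<open>l \<noteq> 0\<close> have "\<forall>\<^sub>F k in sequentially. l / 2 < a k"
    using order_tendstoD(1)[OF lim, of "l/2"] by simp
  with pos have "\<forall>\<^sub>F k in sequentially. norm (\<beta> k) \<le> (2 / l) * (\<beta> k * a k)"
  proof eventually_elim
    case (elim k)
    then have "\<beta> k * (l / 2) \<le> \<beta> k * a k" by simp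
    then show ?case using elim \<open>0 \<le> l\<close> \<open>l \<noteq> 0\<close> by (simp add: field_simps)
  qed
  then have "summable \<beta>"
    by (rule summable_comparison_test_ev) (intro summable_mult sm)
  with ns show False ..
qed

text \<open>A path whose steps are paid for by the decrease of a potential \<open>T\<close>, as long as it stays near \<open>y\<close>, never
  leaves a neighbourhood of \<open>y\<close> once it is close to \<open>y\<close> and \<open>T\<close> is small: the quantity
  \<open>norm (z k - y) + T k\<close> cannot increase. The same quantity shows that \<open>y\<close> is the limit, and the
  remaining potential bounds the remaining distance.\<close>
lemma capture_near_accumulation_point:
  fixes z :: "nat \<Rightarrow> 'a::real_normed_vector" and T :: "nat \<Rightarrow> real"
  assumes step: "\<forall>\<^sub>F k in sequentially. z k \<in> ball y \<rho> \<longrightarrow> norm (z (Suc k) - z k) \<le> T k - T (Suc k)"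
    and nn: "\<forall>\<^sub>F k in sequentially. 0 \<le> T k" and T0: "T \<longlonglongrightarrow> 0" and "0 < \<rho>"
    and acc: "\<And>\<epsilon>. 0 < \<epsilon> \<Longrightarrow> \<exists>\<^sub>F k in sequentially. norm (z k - y) < \<epsilon>"
  shows "z \<longlonglongrightarrow> y" and "\<forall>\<^sub>F k in sequentially. norm (z k - y) \<le> T k"
proof -
  have "\<forall>\<^sub>F k in sequentially. (z k \<in> ball y \<rho> \<longrightarrow> norm (z (Suc k) - z k) \<le> T k - T (Suc k)) \<and> 0 \<le> T k"
    using step nn by eventually_elim auto
  then obtain N where N: "\<And>k. N \<le> k \<Longrightarrow> z k \<in> ball y \<rho> \<Longrightarrow> norm (z (Suc k) - z k) \<le> T k - T (Suc k)"
     "\<And>k. N \<le> k \<Longrightarrow> 0 \<le> T k"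
    unfolding eventually_sequentially by blast
  have start: "\<exists>j\<ge>N. norm (z j - y) + T j < \<epsilon>" if "0 < \<epsilon>" for \<epsilon>
  proof -
    have "\<forall>\<^sub>F k in sequentially. T k < \<epsilon> / 2 \<and> N \<le> k"
      using order_tendstoD(2)[OF T0, of "\<epsilon>/2"] that eventually_ge_at_top[of N] by (simp add: eventually_conj)
    moreover have "\<exists>\<^sub>F k in sequentially. norm (z k - y) < \<epsilon> / 2" using that by (intro acc) simp
    ultimately have "\<exists>\<^sub>F k in sequentially. (T k < \<epsilon> / 2 \<and> N \<le> k) \<and> norm (z k - y) < \<epsilon> / 2"
      by (intro frequently_eventually_conj)
    then obtain j where "norm (z j - y) < \<epsilon> / 2 \<and> T j < \<epsilon> / 2 \<and> N \<le> j"
      by (blast dest: frequently_ex)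
    then show ?thesis by (intro exI[of _ j]) auto
  qed
  have stay: "norm (z (n + j) - y) + T (n + j) \<le> norm (z j - y) + T j"
    if j: "N \<le> j" "norm (z j - y) + T j < \<rho>" for j n
  proof (induction n)
    case (Suc n)
    have "norm (z (n + j) - y) < \<rho>" using Suc j N(2)[of "n + j"] by simp
    then have "norm (z (Suc (n + j)) - z (n + j)) \<le> T (n + j) - T (Suc (n + j))"
      using N(1)[of "n + j"] j by (simp add: dist_norm norm_minus_commute)
    moreover have "norm (z (Suc (n + j)) - y) \<le> norm (z (Suc (n + j)) - z (n + j)) + norm (z (n + j) - y)"
      using norm_triangle_ineq[of "z (Suc (n + j)) - z (n + j)" "z (n + j) - y"] by simp
    ultimately show ?case using Suc by simp
  qed simp
  show lim: "z \<longlonglongrightarrow> y"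
  proof (rule LIMSEQ_I)
    fix \<epsilon> :: real assume "0 < \<epsilon>"
    then obtain j where j: "N \<le> j" "norm (z j - y) + T j < min \<epsilon> \<rho>"
      using start[of "min \<epsilon> \<rho>"] \<open>0 < \<rho>\<close> by auto
    have "norm (z k - y) < \<epsilon>" if "j \<le> k" for k
      using stay[of j "k - j"] j that N(2)[of k] by simp
    then show "\<exists>no. \<forall>n\<ge>no. norm (z n - y) < \<epsilon>" by blast
  qed
  obtain j where j: "N \<le> j" "norm (z j - y) + T j < \<rho>"
    using start[OF \<open>0 < \<rho>\<close>] by auto
  have diff: "norm (z (n + k) - z k) \<le> T k - T (n + k)" if "j \<le> k" for n k
  proof (induction n)
    case (Suc n)
    have "norm (z (n + k) - y) < \<rho>" using stay[OF j, of "n + k - j"] j that N(2)[of "n + k"] by simp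
    then have "norm (z (Suc (n + k)) - z (n + k)) \<le> T (n + k) - T (Suc (n + k))"
      using N(1)[of "n + k"] j that by (simp add: dist_norm norm_minus_commute)
    moreover have "norm (z (Suc (n + k)) - z k) \<le> norm (z (Suc (n + k)) - z (n + k)) + norm (z (n + k) - z k)"
      using norm_triangle_ineq[of "z (Suc (n + k)) - z (n + k)" "z (n + k) - z k"] by simp
    ultimately show ?case using Suc by simp
  qed simp
  have "norm (z k - y) \<le> T k" if "j \<le> k" for k
  proof -
    have "(\<lambda>n. norm (z (n + k) - z k)) \<longlonglongrightarrow> norm (y - z k)"
      by (intro tendsto_intros LIMSEQ_ignore_initial_segment lim)
    moreover have "norm (z (n + k) - z k) \<le> T k" for n
      using diff[OF that, of n] N(2)[of "n + k"] j that by simp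
    ultimately have "norm (y - z k) \<le> T k" by (intro LIMSEQ_le_const2) auto
    then show ?thesis by (simp add: norm_minus_commute)
  qed
  then show "\<forall>\<^sub>F k in sequentially. norm (z k - y) \<le> T k" unfolding eventually_sequentially by blast
qed

lemma powr_sum_le:
  fixes x y p :: real
  assumes "0 \<le> x" "0 \<le> y" "0 \<le> p"
  shows "(x + y) powr p \<le> 2 powr p * (x powr p + y powr p)"
proof -
  have "(x + y) powr p \<le> (2 * max x y) powr p" by (rule powr_mono2) (use assms in auto)
  also have "\<dots> = 2 powr p * max x y powr p" using assms by (simp add: powr_mult)
  also have "\<dots> \<le> 2 powr p * (x powr p + y powr p)"
    by (rule mult_left_mono) (auto simp: max_def)
  finally show ?thesis .
qed

text \<open>The concavity inequality of the desingularizing function \<open>t powr (1 - \<theta>)\<close>, multiplied by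
  \<open>x powr \<theta>\<close> so that it also holds at \<open>x = 0\<close>. It is a weighted inequality between arithmetic and
  geometric means.\<close>
lemma powr_increment_ge:
  fixes x y \<theta> :: real
  assumes "0 \<le> y" "y \<le> x" "0 < \<theta>" "\<theta> < 1"
  shows "(1 - \<theta>) * (x - y) \<le> x powr \<theta> * (x powr (1 - \<theta>) - y powr (1 - \<theta>))"
proof (cases "y = 0")
  case True
  then show ?thesis using assms by (cases "x = 0") (simp_all flip: powr_add)
next
  case False
  then have pos: "0 < y" "0 < x" using assms by auto
  have "x powr \<theta> * y powr (1 - \<theta>) \<le> \<theta> * x + (1 - \<theta>) * y"
    by (rule Youngs_inequality_0) (use assms pos in auto)
  moreover have "x powr \<theta> * x powr (1 - \<theta>) = x" using pos by (simp flip: powr_add)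
  ultimately show ?thesis by (simp add: algebra_simps)
qed

text \<open>
  \<open>V\<close> is dominated by \<open>M * b\<close> for large \<open>M\<close>. If \<open>V k\<close> is already below \<open>M * b (k + 1)\<close>, monotonicity
  suffices. Otherwise the perturbation \<open>\<tau> k\<close> is at most half of \<open>V k\<close>, so the dissipation is at least
  a quarter of that at the level \<open>M * b (k + 1)\<close>, which exceeds the decrease of the comparison sequence. The
  condition on \<open>b\<close> holds from an index that does not depend on \<open>M\<close>, so that \<open>M\<close> may be chosen
  large with respect to the initial value.
\<close>
lemma decay_rate:
  fixes V P \<tau> b \<beta> :: "nat \<Rightarrow> real" and \<theta> c M0 K :: real
  assumes c: "0 < c" and th: "1/2 \<le> \<theta>" "\<theta> < 1"
    and ev: "\<forall>\<^sub>F k in sequentially. 0 < \<beta> k \<and> V (Suc k) \<le> V k \<and> 0 \<le> V k \<and> V k \<le> P k + \<tau> k \<and>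
       V (Suc k) + c * \<beta> k * P k powr (2 * \<theta>) \<le> V k"
    and b: "\<forall>\<^sub>F k in sequentially. 0 < b k \<and> \<tau> k \<le> K * b (Suc k) \<and>
       (\<forall>M\<ge>M0. M * b k - M * b (Suc k) \<le> c / 4 * \<beta> k * (M * b (Suc k)) powr (2 * \<theta>))"
  shows "\<exists>M>0. \<forall>\<^sub>F k in sequentially. V k \<le> M * b k"
proof -
  obtain N1 where N1: "\<And>k. N1 \<le> k \<Longrightarrow> 0 < \<beta> k \<and> V (Suc k) \<le> V k \<and> 0 \<le> V k \<and> V k \<le> P k + \<tau> k \<and>
       V (Suc k) + c * \<beta> k * P k powr (2 * \<theta>) \<le> V k"
    using ev unfolding eventually_sequentially by blast
  obtain N2 where N2: "\<And>k. N2 \<le> k \<Longrightarrow> 0 < b k \<and> \<tau> k \<le> K * b (Suc k) \<and>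
       (\<forall>M\<ge>M0. M * b k - M * b (Suc k) \<le> c / 4 * \<beta> k * (M * b (Suc k)) powr (2 * \<theta>))"
    using b unfolding eventually_sequentially by blast
  define N where "N = max N1 N2"
  have N: "\<And>k. N \<le> k \<Longrightarrow> 0 < \<beta> k \<and> V (Suc k) \<le> V k \<and> 0 \<le> V k \<and> V k \<le> P k + \<tau> k \<and>
       V (Suc k) + c * \<beta> k * P k powr (2 * \<theta>) \<le> V k"
      "\<And>k. N \<le> k \<Longrightarrow> 0 < b k \<and> \<tau> k \<le> K * b (Suc k)"
      "\<And>k M. N \<le> k \<Longrightarrow> M0 \<le> M \<Longrightarrow> M * b k - M * b (Suc k) \<le> c / 4 * \<beta> k * (M * b (Suc k)) powr (2 * \<theta>)"
    using N1 N2 by (simp_all add: N_def)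
  define M where "M = max 1 (max M0 (max (2 * K) (V N / b N)))"
  have M: "1 \<le> M" "M0 \<le> M" "2 * K \<le> M" "V N / b N \<le> M" by (auto simp: M_def)
  have "V k \<le> M * b k" if "N \<le> k" for k
    using that
  proof (induction k rule: dec_induct)
    case base
    then show ?case using M(4) N(2)[of N] by (simp add: field_simps)
  next
    case (step k)
    have pb: "0 < b (Suc k)" using N(2)[of "Suc k"] step by simp
    show ?case
    proof (cases "V k \<le> M * b (Suc k)")
      case True
      then show ?thesis using N(1)[of k] step by linarith
    next
      case False
      \<comment> \<open>Since \<open>M\<close> is at least \<open>2 * K\<close>, the perturbation is less than half of \<open>V k\<close>.\<close>
      have "\<tau> k \<le> K * b (Suc k)" using N(2) step by simp
      also have "\<dots> \<le> M / 2 * b (Suc k)" using M pb by (intro mult_right_mono) auto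
      finally have P: "M * b (Suc k) / 2 \<le> P k" using False N(1)[of k] step by simp
      have pos: "0 < M * b (Suc k)" using M pb by simp
      have "(M * b (Suc k)) powr (2 * \<theta>) = 2 powr (2 * \<theta>) * (M * b (Suc k) / 2) powr (2 * \<theta>)"
        using pos by (simp flip: powr_mult)
      also have "\<dots> \<le> 2 powr 2 * P k powr (2 * \<theta>)"
        using P pos th by (intro mult_mono powr_mono2 powr_mono) auto
      finally have "(M * b (Suc k)) powr (2 * \<theta>) / 4 \<le> P k powr (2 * \<theta>)" by simp
      then have "c * \<beta> k * ((M * b (Suc k)) powr (2 * \<theta>) / 4) \<le> c * \<beta> k * P k powr (2 * \<theta>)"
        using c N(1)[of k] step by (intro mult_left_mono) auto
      then have "V (Suc k) + c / 4 * \<beta> k * (M * b (Suc k)) powr (2 * \<theta>) \<le> V k"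
        using N(1)[of k] step by (simp add: algebra_simps)
      then show ?thesis using N(3)[of k M] M step by linarith
    qed
  qed
  then show ?thesis using M(1) by (intro exI[of _ M]) (auto simp: eventually_sequentially)
qed

text \<open>A forcing at rate \<open>b\<close> is followed at rate \<open>b\<close>, provided that \<open>b\<close> decays at most half as fast as
  the discounted recursion forgets its past.\<close>
lemma discounted_rate:
  fixes Y b \<beta> :: "nat \<Rightarrow> real"
  assumes n: "0 < n" and \<beta>: "\<beta> \<longlonglongrightarrow> 0"
    and ev: "\<forall>\<^sub>F k in sequentially. 0 < \<beta> k \<and> 0 < b k \<and>
       Y (Suc k) \<le> (1 - n * \<beta> k) * Y k + C * \<beta> k * b k \<and> b k \<le> (1 + n / 2 * \<beta> k) * b (Suc k)"
  shows "\<exists>M>0. \<forall>\<^sub>F k in sequentially. Y k \<le> M * b k"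
proof -
  have "\<forall>\<^sub>F k in sequentially. \<beta> k < 1 / n"
    using order_tendstoD(2)[OF \<beta>, of "1/n"] n by simp
  then have "\<forall>\<^sub>F k in sequentially. n * \<beta> k < 1"
    by eventually_elim (use n in \<open>simp add: field_simps\<close>)
  with ev have "\<forall>\<^sub>F k in sequentially. 0 < \<beta> k \<and> 0 < b k \<and> n * \<beta> k < 1 \<and>
       Y (Suc k) \<le> (1 - n * \<beta> k) * Y k + C * \<beta> k * b k \<and> b k \<le> (1 + n / 2 * \<beta> k) * b (Suc k)"
    by eventually_elim simp
  then obtain N where N: "\<And>k. N \<le> k \<Longrightarrow> 0 < \<beta> k \<and> 0 < b k \<and> n * \<beta> k < 1 \<and>
       Y (Suc k) \<le> (1 - n * \<beta> k) * Y k + C * \<beta> k * b k \<and> b k \<le> (1 + n / 2 * \<beta> k) * b (Suc k)"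
    unfolding eventually_sequentially by blast
  define M where "M = max 1 (max (2 * C / n) (Y N / b N))"
  have M: "1 \<le> M" "2 * C / n \<le> M" "Y N / b N \<le> M" by (auto simp: M_def)
  have "Y k \<le> M * b k" if "N \<le> k" for k
    using that
  proof (induction k rule: dec_induct)
    case base
    then show ?case using M N[of N] by (simp add: field_simps)
  next
    case (step k)
    note k = N[OF \<open>N \<le> k\<close>]
    have C: "C \<le> n / 2 * M" using M n by (simp add: field_simps)
    have "Y (Suc k) \<le> (1 - n * \<beta> k) * Y k + C * \<beta> k * b k" using k by simp
    also have "\<dots> \<le> (1 - n * \<beta> k) * (M * b k) + n / 2 * M * \<beta> k * b k"
      using k step C by (intro add_mono mult_left_mono mult_right_mono) auto
    also have "\<dots> = M * ((1 - n / 2 * \<beta> k) * b k)" by (simp add: algebra_simps)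
    also have "\<dots> \<le> M * ((1 - n / 2 * \<beta> k) * ((1 + n / 2 * \<beta> k) * b (Suc k)))"
      using k M by (intro mult_left_mono) auto
    also have "\<dots> = M * b (Suc k) * (1 - (n / 2 * \<beta> k)\<^sup>2)"
      by (simp add: field_simps power2_eq_square)
    also have "\<dots> \<le> M * b (Suc k) * 1"
      using N[of "Suc k"] step M by (intro mult_left_mono) auto
    finally show ?case by simp
  qed
  then show ?thesis using M(1) by (intro exI[of _ M]) (auto simp: eventually_sequentially)
qed

section \<open>Dissipative descent under a Lojasiewicz inequality\<close>

lemma null_of_square_null:
  fixes v :: "nat \<Rightarrow> real"
  assumes "(\<lambda>k. (v k)\<^sup>2) \<longlonglongrightarrow> 0" shows "v \<longlonglongrightarrow> 0"
  using tendsto_real_sqrt[OF assms] by (simp add: tendsto_rabs_zero_iff)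

lemma powr_squared: "(q powr \<theta>)\<^sup>2 = q powr (2 * \<theta>)" for q \<theta> :: real
  by (simp add: power2_eq_square flip: powr_add)

text \<open>
  Sequences with the energy dissipation of perturbed gradient descent. Here \<open>d\<close> stands for the size of
  the momentum and \<open>u\<close> for the size of the remaining noise. The constant of \<open>(d k)\<^sup>2\<close> in the dissipation
  is not multiplied by \<open>\<beta> k\<close>: the momentum is damped at every iteration by a fixed factor, so its
  contribution beats any multiple of \<open>\<beta> k * (d k)\<^sup>2\<close> as \<open>\<beta> k\<close> tends to zero. Therefore the constant
  \<open>1 / 4\<close> of the gradient term determines the exponential rates.
\<close>
locale dissipative_path = smooth_function f L
  for f :: "'a::euclidean_space \<Rightarrow> real" and L :: real +
  fixes z :: "nat \<Rightarrow> 'a" and d u s \<beta> :: "nat \<Rightarrow> real" and c C :: real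
  assumes bdd: "bdd_below (range f)"
    and c_pos: "0 < c" and C_pos: "0 < C"
    and \<beta>_pos: "\<forall>\<^sub>F k in sequentially. 0 < \<beta> k" and \<beta>_null: "\<beta> \<longlonglongrightarrow> 0" and \<beta>_sum: "\<not> summable \<beta>"
    and d_nn: "\<And>k. 0 \<le> d k" and u_nn: "\<And>k. 0 \<le> u k" and s_nn: "\<forall>\<^sub>F k in sequentially. 0 \<le> s k"
    and energy: "\<forall>\<^sub>F k in sequentially. f (z (Suc k)) + (d (Suc k))\<^sup>2 + \<beta> k / 4 * (norm (grad f (z k)))\<^sup>2 + c * (d k)\<^sup>2
        \<le> f (z k) + (d k)\<^sup>2 + s k"
    and grad_growth: "\<forall>\<^sub>F k in sequentially. (norm (grad f (z (Suc k))))\<^sup>2 \<le> (norm (grad f (z k)))\<^sup>2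
        + C * \<beta> k * ((norm (grad f (z k)))\<^sup>2 + (d k)\<^sup>2 + (u k)\<^sup>2)"
    and step: "\<forall>\<^sub>F k in sequentially. norm (z (Suc k) - z k) \<le> C * \<beta> k * (norm (grad f (z k)) + d k + u k)"
    and s_sum: "summable s" and u_sum: "summable (\<lambda>k. \<beta> k * (u k)\<^sup>2)"
begin

abbreviation a :: "nat \<Rightarrow> real" where "a k \<equiv> norm (grad f (z k))"

lemma \<beta>_small: "0 < \<epsilon> \<Longrightarrow> \<forall>\<^sub>F k in sequentially. 0 < \<beta> k \<and> \<beta> k < \<epsilon>"
  using \<beta>_pos order_tendstoD(2)[OF \<beta>_null] by (simp add: eventually_conj)

lemma energy_convergent:
  shows "convergent (\<lambda>k. f (z k) + (d k)\<^sup>2)" and "summable (\<lambda>k. \<beta> k * (a k)\<^sup>2)"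
    and "summable (\<lambda>k. (d k)\<^sup>2)"
proof -
  obtain m where m: "\<And>y. m \<le> f y" using bdd by (auto simp: bdd_below_def)
  have ev: "\<forall>\<^sub>F k in sequentially. 0 \<le> \<beta> k / 4 * (a k)\<^sup>2 + c * (d k)\<^sup>2 \<and> 0 \<le> s k \<and>
    (f (z (Suc k)) + (d (Suc k))\<^sup>2) + (\<beta> k / 4 * (a k)\<^sup>2 + c * (d k)\<^sup>2) \<le> (f (z k) + (d k)\<^sup>2) + s k
    \<and> m \<le> f (z k) + (d k)\<^sup>2"
    using energy \<beta>_pos s_nn
  proof eventually_elim
    case (elim k)
    then show ?case using m[of "z k"] c_pos by (auto simp: add.assoc add_increasing2)
  qed
  show "convergent (\<lambda>k. f (z k) + (d k)\<^sup>2)" by (rule quasi_decreasing(1)[OF ev s_sum])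
  have sm: "summable (\<lambda>k. \<beta> k / 4 * (a k)\<^sup>2 + c * (d k)\<^sup>2)" by (rule quasi_decreasing(2)[OF ev s_sum])
  have "\<forall>\<^sub>F k in sequentially. norm (\<beta> k * (a k)\<^sup>2) \<le> 4 * (\<beta> k / 4 * (a k)\<^sup>2 + c * (d k)\<^sup>2)"
    using \<beta>_pos by eventually_elim (use c_pos in simp)
  then show "summable (\<lambda>k. \<beta> k * (a k)\<^sup>2)"
    by (rule summable_comparison_test_ev) (rule summable_mult[OF sm])
  have "\<forall>\<^sub>F k in sequentially. norm ((d k)\<^sup>2) \<le> 1 / c * (\<beta> k / 4 * (a k)\<^sup>2 + c * (d k)\<^sup>2)"
    using \<beta>_pos by eventually_elim (use c_pos in \<open>simp add: field_simps\<close>)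
  then show "summable (\<lambda>k. (d k)\<^sup>2)"
    by (rule summable_comparison_test_ev) (rule summable_mult[OF sm])
qed

lemma d_null: "d \<longlonglongrightarrow> 0"
  using summable_LIMSEQ_zero[OF energy_convergent(3)] by (rule null_of_square_null)

definition fstar :: real where "fstar = lim (\<lambda>k. f (z k))"

lemma f_tendsto: "(\<lambda>k. f (z k)) \<longlonglongrightarrow> fstar"
proof -
  obtain l where "(\<lambda>k. f (z k) + (d k)\<^sup>2) \<longlonglongrightarrow> l"
    using energy_convergent(1) unfolding convergent_def by blast
  from tendsto_diff[OF this tendsto_power[OF d_null, of 2]]
  have "(\<lambda>k. f (z k)) \<longlonglongrightarrow> l" by simp
  then show ?thesis unfolding fstar_def using limI by metis
qed

text \<open>The growth condition makes the squared gradients quasi-decreasing, so they converge; since the step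
  sizes are not summable, the dissipation forces the limit to be zero.\<close>
lemma a_null: "a \<longlonglongrightarrow> 0"
proof -
  have "\<forall>\<^sub>F k in sequentially. norm (\<beta> k * (d k)\<^sup>2) \<le> (d k)\<^sup>2"
    using \<beta>_small[of 1, simplified] by eventually_elim (simp add: mult_left_le_one_le)
  then have bd: "summable (\<lambda>k. \<beta> k * (d k)\<^sup>2)"
    by (rule summable_comparison_test_ev) (rule energy_convergent(3))
  have sm: "summable (\<lambda>k. C * (\<beta> k * (a k)\<^sup>2 + \<beta> k * (d k)\<^sup>2 + \<beta> k * (u k)\<^sup>2))"
    by (intro summable_mult summable_add energy_convergent(2) bd u_sum)
  have ev: "\<forall>\<^sub>F k in sequentially. 0 \<le> (0::real) \<and> 0 \<le> C * (\<beta> k * (a k)\<^sup>2 + \<beta> k * (d k)\<^sup>2 + \<beta> k * (u k)\<^sup>2) \<and>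
     (a (Suc k))\<^sup>2 + 0 \<le> (a k)\<^sup>2 + C * (\<beta> k * (a k)\<^sup>2 + \<beta> k * (d k)\<^sup>2 + \<beta> k * (u k)\<^sup>2) \<and> 0 \<le> (a k)\<^sup>2"
    using grad_growth \<beta>_pos
  proof eventually_elim
    case (elim k)
    then show ?case using C_pos by (auto simp: algebra_simps)
  qed
  obtain l where l: "(\<lambda>k. (a k)\<^sup>2) \<longlonglongrightarrow> l"
    using quasi_decreasing(1)[OF ev sm] unfolding convergent_def by blast
  have "l = 0"
    by (rule nonsummable_liminf_zero[OF \<beta>_pos \<beta>_sum energy_convergent(2) l]) simp
  with l show ?thesis by (simp add: null_of_square_null)
qed

abbreviation \<tau> :: "nat \<Rightarrow> real" where "\<tau> \<equiv> tail s"

text \<open>The Lyapunov function. The term \<open>\<tau> k\<close> pays for all future perturbations.\<close>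
definition V :: "nat \<Rightarrow> real" where "V k = f (z k) - fstar + (d k)\<^sup>2 + \<tau> k"

lemma V_null: "V \<longlonglongrightarrow> 0"
proof -
  have "(\<lambda>k. f (z k) - fstar + (d k)\<^sup>2 + \<tau> k) \<longlonglongrightarrow> fstar - fstar + 0\<^sup>2 + 0"
    using tendsto_add[OF tendsto_add[OF tendsto_diff[OF f_tendsto tendsto_const] tendsto_power[OF d_null]]
        tail_tendsto_0[OF s_sum]] .
  then have "(\<lambda>k. V k) \<longlonglongrightarrow> 0" unfolding V_def by simp
  then show ?thesis .
qed

lemma V_decrease: "\<forall>\<^sub>F k in sequentially. V (Suc k) + (\<beta> k / 4 * (a k)\<^sup>2 + c * (d k)\<^sup>2) \<le> V k"
  using energy
proof eventually_elim
  case (elim k)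
  then show ?case using tail_unfold[OF s_sum, of k] by (simp add: V_def)
qed

lemma \<tau>_nonneg: "\<forall>\<^sub>F k in sequentially. 0 \<le> \<tau> k"
proof -
  obtain N where "\<And>k. N \<le> k \<Longrightarrow> 0 \<le> s k" using s_nn unfolding eventually_sequentially by blast
  then show ?thesis unfolding eventually_sequentially
    by (intro exI[of _ N]) (auto intro: tail_nonneg s_sum)
qed

lemma V_mono: "\<forall>\<^sub>F k in sequentially. V (Suc k) \<le> V k \<and> 0 \<le> V k"
proof -
  have "\<forall>\<^sub>F k in sequentially. V (Suc k) \<le> V k"
    using V_decrease \<beta>_pos
  proof eventually_elim
    case (elim k)
    have "0 \<le> \<beta> k / 4 * (a k)\<^sup>2 + c * (d k)\<^sup>2" using elim c_pos by simp
    then show ?case using elim by linarith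
  qed
  then obtain N where N: "\<And>k. N \<le> k \<Longrightarrow> V (Suc k) \<le> V k" unfolding eventually_sequentially by blast
  have "0 \<le> V k" if "N \<le> k" for k
  proof (rule LIMSEQ_le_const2[OF V_null], intro exI allI impI)
    fix n assume "k \<le> n"
    then show "V n \<le> V k"
      using that by (induction n rule: dec_induct) (auto intro: order_trans N)
  qed
  then show ?thesis using N unfolding eventually_sequentially by blast
qed

text \<open>The part of \<open>V\<close> that is controlled by the dissipation through the Lojasiewicz inequality. The absolute
  value is needed since \<open>f (z k)\<close> may drop below its limit.\<close>
definition P :: "nat \<Rightarrow> real" where "P k = \<bar>f (z k) - fstar\<bar> + (d k)\<^sup>2"

lemma P_nonneg: "0 \<le> P k" by (simp add: P_def)

lemma V_le_P: "V k \<le> P k + \<tau> k" by (simp add: V_def P_def)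

text \<open>For \<open>d k < 1\<close> and \<open>2 * \<theta> \<ge> 1\<close> the power of \<open>(d k)\<^sup>2\<close> is bounded by \<open>(d k)\<^sup>2\<close> itself, and the factor
  \<open>4\<close> comes from splitting the power of the sum.\<close>
lemma P_le_slope:
  assumes K: "0 < K" and th: "1/2 \<le> \<theta>" "\<theta> < 1" and y: "f y = fstar"
    and loj: "\<forall>w\<in>ball y \<rho>. K * \<bar>f w - f y\<bar> powr \<theta> \<le> norm (grad f w)"
  shows "\<forall>\<^sub>F k in sequentially. z k \<in> ball y \<rho> \<longrightarrow> K\<^sup>2 * P k powr (2 * \<theta>) \<le> 4 * ((a k)\<^sup>2 + K\<^sup>2 * (d k)\<^sup>2)"
  using order_tendstoD(2)[OF d_null zero_less_one]
proof (eventually_elim, intro impI)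
  case (elim k)
  assume "z k \<in> ball y \<rho>"
  define q where "q = \<bar>f (z k) - fstar\<bar>"
  have "K * q powr \<theta> \<le> a k" using loj \<open>z k \<in> ball y \<rho>\<close> y by (simp add: q_def)
  then have "(K * q powr \<theta>)\<^sup>2 \<le> (a k)\<^sup>2" using K by (intro power_mono) auto
  then have q: "K\<^sup>2 * q powr (2 * \<theta>) \<le> (a k)\<^sup>2"
    by (simp add: power_mult_distrib powr_squared)
  have "((d k)\<^sup>2) powr (2 * \<theta>) \<le> ((d k)\<^sup>2) powr 1"
    using elim d_nn[of k] th by (intro powr_mono') (auto simp: power_le_one)
  then have d: "((d k)\<^sup>2) powr (2 * \<theta>) \<le> (d k)\<^sup>2" by simp
  have "P k powr (2 * \<theta>) \<le> 2 powr (2 * \<theta>) * (q powr (2 * \<theta>) + ((d k)\<^sup>2) powr (2 * \<theta>))"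
    unfolding P_def q_def by (rule powr_sum_le) (use th in auto)
  also have "\<dots> \<le> 2 powr 2 * (q powr (2 * \<theta>) + (d k)\<^sup>2)"
    using d th by (intro mult_mono powr_mono) auto
  finally have "K\<^sup>2 * P k powr (2 * \<theta>) \<le> K\<^sup>2 * (2 powr 2 * (q powr (2 * \<theta>) + (d k)\<^sup>2))"
    by (rule mult_left_mono) simp
  also have "\<dots> \<le> 4 * ((a k)\<^sup>2 + K\<^sup>2 * (d k)\<^sup>2)"
    using q by (simp add: algebra_simps)
  finally show "K\<^sup>2 * P k powr (2 * \<theta>) \<le> 4 * ((a k)\<^sup>2 + K\<^sup>2 * (d k)\<^sup>2)" .
qed

text \<open>By concavity, \<open>V powr \<theta>\<close> times the decrement of \<open>V powr (1 - \<theta>)\<close> dominates \<open>\<beta> k * q\<^sup>2\<close>, where \<open>q\<close> is the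
  sum of the gradient and the momentum. The Lojasiewicz inequality bounds \<open>V powr \<theta>\<close> by a multiple of
  \<open>q + \<tau> k powr \<theta>\<close>. Either the tail dominates \<open>q\<close>, or one factor \<open>q\<close> cancels.\<close>
lemma path_length_step:
  assumes K: "0 < K" and th: "1/2 \<le> \<theta>" "\<theta> < 1" and y: "f y = fstar"
    and loj: "\<forall>w\<in>ball y \<rho>. K * \<bar>f w - f y\<bar> powr \<theta> \<le> norm (grad f w)"
  shows "\<exists>B>0. \<forall>\<^sub>F k in sequentially. z k \<in> ball y \<rho> \<longrightarrow>
     norm (z (Suc k) - z k) \<le> B * (\<beta> k * \<tau> k powr \<theta> + \<beta> k * u k + (V k powr (1 - \<theta>) - V (Suc k) powr (1 - \<theta>)))"
proof -
  define A where "A = 2 powr \<theta> * (2 + 2 / K)"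
  define D where "D k = V k powr (1 - \<theta>) - V (Suc k) powr (1 - \<theta>)" for k
  define B where "B = C * (1 + 8 * (A + 2 powr \<theta>) / (1 - \<theta>))"
  have A: "0 < A" using K by (simp add: A_def add_pos_pos)
  have B: "C \<le> B" "8 * C * (A + 2 powr \<theta>) / (1 - \<theta>) \<le> B" "0 < B"
  proof -
    have "0 \<le> 8 * C * (A + 2 powr \<theta>) / (1 - \<theta>)" using C_pos A th by simp
    moreover have "B = C + 8 * C * (A + 2 powr \<theta>) / (1 - \<theta>)" by (simp add: B_def algebra_simps)
    ultimately show "C \<le> B" "8 * C * (A + 2 powr \<theta>) / (1 - \<theta>) \<le> B" "0 < B" using C_pos by auto
  qed
  have "\<forall>\<^sub>F k in sequentially. z k \<in> ball y \<rho> \<longrightarrow>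
     norm (z (Suc k) - z k) \<le> B * (\<beta> k * \<tau> k powr \<theta> + \<beta> k * u k + D k)"
    using P_le_slope[OF assms] V_mono V_decrease \<tau>_nonneg step eventually_all_ge_at_top[OF V_mono]
      \<beta>_small[of "4 * c", simplified, OF c_pos]
  proof (eventually_elim, intro impI)
    case (elim k)
    assume zk: "z k \<in> ball y \<rho>"
    have V1: "0 \<le> V (Suc k)" using elim by auto
    define q where "q = a k + d k"
    have q0: "0 \<le> q" using d_nn by (simp add: q_def)
    have "K\<^sup>2 * P k powr (2 * \<theta>) \<le> 4 * ((a k)\<^sup>2 + K\<^sup>2 * (d k)\<^sup>2)" using elim zk by blast
    also have "\<dots> \<le> (2 * (a k + K * d k))\<^sup>2"
      using K d_nn[of k] by (simp add: power2_eq_square algebra_simps)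
    finally have "(K * P k powr \<theta>)\<^sup>2 \<le> (2 * (a k + K * d k))\<^sup>2"
      by (simp add: power_mult_distrib powr_squared)
    then have "K * P k powr \<theta> \<le> 2 * (a k + K * d k)"
      by (rule power2_le_imp_le) (use K d_nn in simp)
    then have "P k powr \<theta> \<le> 2 * (a k + K * d k) / K" using K by (simp add: field_simps)
    also have "\<dots> \<le> (2 + 2 / K) * q"
      using K d_nn[of k] by (simp add: q_def field_simps)
    finally have P: "P k powr \<theta> \<le> (2 + 2 / K) * q" .
    have "V k powr \<theta> \<le> (P k + \<tau> k) powr \<theta>"
      using V_le_P elim th by (intro powr_mono2) auto
    also have "\<dots> \<le> 2 powr \<theta> * (P k powr \<theta> + \<tau> k powr \<theta>)"
      by (rule powr_sum_le) (use P_nonneg elim th in auto)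
    also have "\<dots> \<le> 2 powr \<theta> * ((2 + 2 / K) * q + \<tau> k powr \<theta>)" using P by simp
    also have "\<dots> = A * q + 2 powr \<theta> * \<tau> k powr \<theta>" by (simp add: A_def algebra_simps)
    finally have Vth: "V k powr \<theta> \<le> A * q + 2 powr \<theta> * \<tau> k powr \<theta>" .
    have "\<beta> k / 8 * q\<^sup>2 \<le> \<beta> k / 4 * (a k)\<^sup>2 + \<beta> k / 4 * (d k)\<^sup>2"
    proof -
      have "q\<^sup>2 \<le> 2 * ((a k)\<^sup>2 + (d k)\<^sup>2)"
        unfolding q_def using sum_squares_bound[of "a k" "d k"] by (simp add: power2_eq_square algebra_simps)
      then have "\<beta> k / 8 * q\<^sup>2 \<le> \<beta> k / 8 * (2 * ((a k)\<^sup>2 + (d k)\<^sup>2))" using elim by (intro mult_left_mono) auto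
      then show ?thesis by (simp add: algebra_simps)
    qed
    also have "\<dots> \<le> \<beta> k / 4 * (a k)\<^sup>2 + c * (d k)\<^sup>2"
      using elim by (intro add_left_mono mult_right_mono) auto
    also have "\<dots> \<le> V k - V (Suc k)" using elim by linarith
    finally have dec: "\<beta> k / 8 * q\<^sup>2 \<le> V k - V (Suc k)" .
    have D0: "0 \<le> D k" unfolding D_def using elim V1 th by (auto intro!: powr_mono2)
    have "(1 - \<theta>) * (\<beta> k / 8 * q\<^sup>2) \<le> (1 - \<theta>) * (V k - V (Suc k))"
      using dec th by (intro mult_left_mono) auto
    also have "\<dots> \<le> V k powr \<theta> * D k"
      unfolding D_def by (rule powr_increment_ge) (use elim V1 th in auto)
    also have "\<dots> \<le> (A * q + 2 powr \<theta> * \<tau> k powr \<theta>) * D k" using Vth D0 by (rule mult_right_mono)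
    finally have main: "(1 - \<theta>) * (\<beta> k / 8 * q\<^sup>2) \<le> (A * q + 2 powr \<theta> * \<tau> k powr \<theta>) * D k" .
    have "\<beta> k * q \<le> \<beta> k * \<tau> k powr \<theta> + 8 * (A + 2 powr \<theta>) / (1 - \<theta>) * D k"
    proof (cases "q \<le> \<tau> k powr \<theta>")
      case True
      then have "\<beta> k * q \<le> \<beta> k * \<tau> k powr \<theta>" using elim by (intro mult_left_mono) auto
      moreover have "0 \<le> 8 * (A + 2 powr \<theta>) / (1 - \<theta>) * D k" using A D0 th by simp
      ultimately show ?thesis by linarith
    next
      case False
      then have qpos: "0 < q" by (smt (verit) powr_ge_zero)
      have "(1 - \<theta>) * (\<beta> k / 8 * q\<^sup>2) \<le> (A * q + 2 powr \<theta> * q) * D k"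
        using main False D0 by (smt (verit) mult_left_mono mult_right_mono powr_ge_zero)
      then have "((1 - \<theta>) * \<beta> k * q) * q \<le> (8 * (A + 2 powr \<theta>) * D k) * q"
        by (simp add: power2_eq_square algebra_simps)
      then have "(1 - \<theta>) * \<beta> k * q \<le> 8 * (A + 2 powr \<theta>) * D k"
        using qpos by (rule mult_right_le_imp_le)
      then have "\<beta> k * q \<le> 8 * (A + 2 powr \<theta>) / (1 - \<theta>) * D k"
        using th by (simp add: field_simps)
      moreover have "0 \<le> \<beta> k * \<tau> k powr \<theta>" using elim by simp
      ultimately show ?thesis by linarith
    qed
    then have "C * (\<beta> k * q) \<le> C * (\<beta> k * \<tau> k powr \<theta> + 8 * (A + 2 powr \<theta>) / (1 - \<theta>) * D k)"
      using C_pos by simp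
    moreover have "norm (z (Suc k) - z k) \<le> C * (\<beta> k * q) + C * (\<beta> k * u k)"
      using elim by (simp add: q_def algebra_simps)
    ultimately have "norm (z (Suc k) - z k) \<le> C * (\<beta> k * \<tau> k powr \<theta> + \<beta> k * u k) + 8 * C * (A + 2 powr \<theta>) / (1 - \<theta>) * D k"
      by (simp add: algebra_simps)
    also have "\<dots> \<le> B * (\<beta> k * \<tau> k powr \<theta> + \<beta> k * u k) + B * D k"
      using B D0 elim u_nn[of k] by (intro add_mono mult_right_mono) auto
    finally show "norm (z (Suc k) - z k) \<le> B * (\<beta> k * \<tau> k powr \<theta> + \<beta> k * u k + D k)"
      by (simp add: algebra_simps)
  qed
  then show ?thesis unfolding D_def using B(3) by blast
qed

text \<open>The potential for the capture argument collects the tails of both perturbations and the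
  desingularized Lyapunov function.\<close>
lemma convergence_to_accumulation_point:
  assumes K: "0 < K" and th: "1/2 \<le> \<theta>" "\<theta> < 1" and y: "f y = fstar" and rho: "0 < \<rho>"
    and loj: "\<forall>w\<in>ball y \<rho>. K * \<bar>f w - f y\<bar> powr \<theta> \<le> norm (grad f w)"
    and acc: "\<And>\<epsilon>. 0 < \<epsilon> \<Longrightarrow> \<exists>\<^sub>F k in sequentially. norm (z k - y) < \<epsilon>"
    and s1: "summable (\<lambda>k. \<beta> k * \<tau> k powr \<theta>)" and s2: "summable (\<lambda>k. \<beta> k * u k)"
  shows "z \<longlonglongrightarrow> y"
    and "\<exists>B>0. \<forall>\<^sub>F k in sequentially. norm (z k - y) \<le>
      B * (tail (\<lambda>k. \<beta> k * \<tau> k powr \<theta>) k + tail (\<lambda>k. \<beta> k * u k) k + V k powr (1 - \<theta>))"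
proof -
  define T where "T k = tail (\<lambda>k. \<beta> k * \<tau> k powr \<theta>) k + tail (\<lambda>k. \<beta> k * u k) k + V k powr (1 - \<theta>)" for k
  obtain B where B: "0 < B" and Bst: "\<forall>\<^sub>F k in sequentially. z k \<in> ball y \<rho> \<longrightarrow>
     norm (z (Suc k) - z k) \<le> B * (\<beta> k * \<tau> k powr \<theta> + \<beta> k * u k + (V k powr (1 - \<theta>) - V (Suc k) powr (1 - \<theta>)))"
    using path_length_step[OF K th y loj] by blast
  have st: "\<forall>\<^sub>F k in sequentially. z k \<in> ball y \<rho> \<longrightarrow> norm (z (Suc k) - z k) \<le> B * T k - B * T (Suc k)"
    using Bst
  proof eventually_elim
    case (elim k)
    then show ?case
      using tail_unfold[OF s1, of k] tail_unfold[OF s2, of k] by (simp add: T_def algebra_simps)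
  qed
  have nn: "\<forall>\<^sub>F k in sequentially. 0 \<le> B * T k"
  proof -
    obtain N where N: "\<And>k. N \<le> k \<Longrightarrow> 0 < \<beta> k" using \<beta>_pos unfolding eventually_sequentially by blast
    have "0 \<le> B * T k" if "N \<le> k" for k
      unfolding T_def using B that u_nn N s1 s2
      by (intro mult_nonneg_nonneg add_nonneg_nonneg tail_nonneg) (auto simp: less_imp_le)
    then show ?thesis unfolding eventually_sequentially by blast
  qed
  have "\<forall>\<^sub>F k in sequentially. 0 \<le> V k" using V_mono by eventually_elim simp
  then have "(\<lambda>k. V k powr (1 - \<theta>)) \<longlonglongrightarrow> 0"
    using tendsto_powr'[OF V_null tendsto_const, of "1 - \<theta>"] th by auto
  then have "(\<lambda>k. B * T k) \<longlonglongrightarrow> B * (0 + 0 + 0)"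
    unfolding T_def by (intro tendsto_mult tendsto_const tendsto_add tail_tendsto_0 s1 s2)
  then have T0: "(\<lambda>k. B * T k) \<longlonglongrightarrow> 0" by simp
  show "z \<longlonglongrightarrow> y" by (rule capture_near_accumulation_point[OF st nn T0 rho acc])
  have "\<forall>\<^sub>F k in sequentially. norm (z k - y) \<le> B * T k"
    by (rule capture_near_accumulation_point[OF st nn T0 rho acc])
  then show "\<exists>B>0. \<forall>\<^sub>F k in sequentially. norm (z k - y) \<le>
      B * (tail (\<lambda>k. \<beta> k * \<tau> k powr \<theta>) k + tail (\<lambda>k. \<beta> k * u k) k + V k powr (1 - \<theta>))"
    unfolding T_def using B by blast
qed

text \<open>The constant \<open>K\<^sup>2 / 64\<close> is \<open>K\<^sup>2 / 16\<close>, from the dissipation \<open>\<beta> k / 4\<close> and the factor \<open>4\<close> of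
  \<open>P_le_slope\<close>, divided by the \<open>4\<close> lost in the comparison argument.\<close>
lemma value_rate:
  assumes K: "0 < K" and th: "1/2 \<le> \<theta>" "\<theta> < 1" and lim: "z \<longlonglongrightarrow> y" and rho: "0 < \<rho>"
    and loj: "\<forall>w\<in>ball y \<rho>. K * \<bar>f w - f y\<bar> powr \<theta> \<le> norm (grad f w)" and y: "f y = fstar"
    and b: "\<forall>\<^sub>F k in sequentially. 0 < b k \<and> \<tau> k \<le> Q * b (Suc k) \<and>
       (\<forall>M\<ge>M0. M * b k - M * b (Suc k) \<le> K\<^sup>2 / 64 * \<beta> k * (M * b (Suc k)) powr (2 * \<theta>))"
  shows "\<exists>M>0. \<forall>\<^sub>F k in sequentially. V k \<le> M * b k"
proof -
  have "\<forall>\<^sub>F k in sequentially. dist (z k) y < \<rho>" using tendstoD[OF lim rho] .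
  moreover have "\<forall>\<^sub>F k in sequentially. 0 < \<beta> k \<and> \<beta> k < 4 * c / K\<^sup>2"
    by (rule \<beta>_small) (use c_pos K in simp)
  ultimately have "\<forall>\<^sub>F k in sequentially. 0 < \<beta> k \<and> V (Suc k) \<le> V k \<and> 0 \<le> V k \<and> V k \<le> P k + \<tau> k \<and>
       V (Suc k) + K\<^sup>2 / 16 * \<beta> k * P k powr (2 * \<theta>) \<le> V k"
    using P_le_slope[OF K th y loj] V_mono V_decrease
  proof eventually_elim
    case (elim k)
    then have "K\<^sup>2 * P k powr (2 * \<theta>) \<le> 4 * ((a k)\<^sup>2 + K\<^sup>2 * (d k)\<^sup>2)" by (simp add: dist_commute)
    then have "\<beta> k / 16 * (K\<^sup>2 * P k powr (2 * \<theta>)) \<le> \<beta> k / 16 * (4 * ((a k)\<^sup>2 + K\<^sup>2 * (d k)\<^sup>2))"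
      using elim by (intro mult_left_mono) auto
    also have "\<dots> = \<beta> k / 4 * (a k)\<^sup>2 + (\<beta> k * K\<^sup>2 / 4) * (d k)\<^sup>2" by (simp add: algebra_simps)
    also have "\<dots> \<le> \<beta> k / 4 * (a k)\<^sup>2 + c * (d k)\<^sup>2"
      using elim K by (intro add_left_mono mult_right_mono) (auto simp: field_simps)
    finally have "K\<^sup>2 / 16 * \<beta> k * P k powr (2 * \<theta>) \<le> \<beta> k / 4 * (a k)\<^sup>2 + c * (d k)\<^sup>2"
      by (simp add: algebra_simps)
    then show ?case using elim V_le_P[of k] by linarith
  qed
  from decay_rate[OF _ th this, of b Q M0] b K show ?thesis by simp
qed

text \<open>The limit may be a saddle point, so a small gradient does not follow from small differences of
  values. Instead \<open>(a k)\<^sup>2 + A * V k\<close> is considered: for large \<open>A\<close>, the dissipation in \<open>V\<close> absorbs the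
  growth of the squared gradient and even discounts it at any prescribed speed \<open>2 * n'\<close>, whereas
  everything else is of order \<open>\<beta> k * b k\<close>.\<close>
lemma stationarity_rate:
  assumes V: "\<forall>\<^sub>F k in sequentially. V k \<le> M * b k"
    and b: "\<forall>\<^sub>F k in sequentially. 0 < b k \<and> b k \<le> (1 + n * \<beta> k) * b (Suc k)"
    and \<tau>: "\<forall>\<^sub>F k in sequentially. \<tau> k \<le> Q * b k"
    and u: "\<forall>\<^sub>F k in sequentially. (u k)\<^sup>2 \<le> Q * b k" and M: "0 < M"
  shows "\<exists>B>0. \<forall>\<^sub>F k in sequentially. \<bar>f (z k) - fstar\<bar> \<le> B * b k \<and> (a k)\<^sup>2 \<le> B * b k \<and> (d k)\<^sup>2 \<le> B * b k"
proof -
  \<comment> \<open>The discount has to be positive even if \<open>b\<close> does not decay.\<close>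
  define n' where "n' = max 1 n"
  have d: "\<forall>\<^sub>F k in sequentially. (d k)\<^sup>2 \<le> M / c * b k"
    using V V_decrease eventually_all_ge_at_top[OF V_mono] \<beta>_pos
  proof eventually_elim
    case (elim k)
    have "0 \<le> V (Suc k)" "0 \<le> \<beta> k / 4 * (a k)\<^sup>2" using elim by auto
    then have "c * (d k)\<^sup>2 \<le> M * b k" using elim by linarith
    then show ?case using c_pos by (simp add: field_simps)
  qed
  define A where "A = 4 * (C + 2 * n')"
  have A: "0 < A" using C_pos by (simp add: A_def n'_def)
  define E where "E = C * (M / c + Q) + 2 * n' * A * M"
  have "\<exists>B>0. \<forall>\<^sub>F k in sequentially. (a k)\<^sup>2 + A * V k \<le> B * b k"
  proof (rule discounted_rate[OF _ \<beta>_null, of "2 * n'"])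
    show "\<forall>\<^sub>F k in sequentially. 0 < \<beta> k \<and> 0 < b k \<and>
       (a (Suc k))\<^sup>2 + A * V (Suc k) \<le> (1 - 2 * n' * \<beta> k) * ((a k)\<^sup>2 + A * V k) + E * \<beta> k * b k \<and>
       b k \<le> (1 + 2 * n' / 2 * \<beta> k) * b (Suc k)"
      using V b eventually_all_ge_at_top[OF b] u d grad_growth V_decrease \<beta>_pos
    proof eventually_elim
      case (elim k)
      have b1: "0 < b (Suc k)" using elim by auto
      have "A * (V (Suc k) + (\<beta> k / 4 * (a k)\<^sup>2 + c * (d k)\<^sup>2)) \<le> A * V k"
        using elim A by (intro mult_left_mono) auto
      moreover have "0 \<le> A * (c * (d k)\<^sup>2)" using A c_pos by simp
      ultimately have 1: "A * V (Suc k) + (C + 2 * n') * \<beta> k * (a k)\<^sup>2 \<le> A * V k"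
        by (simp add: A_def field_simps)
      have "C * \<beta> k * ((d k)\<^sup>2 + (u k)\<^sup>2) \<le> C * \<beta> k * (M / c * b k + Q * b k)"
        using elim C_pos by (intro mult_left_mono add_mono) auto
      then have 2: "C * \<beta> k * ((d k)\<^sup>2 + (u k)\<^sup>2) \<le> C * (M / c + Q) * \<beta> k * b k"
        by (simp add: algebra_simps)
      have "(2 * n' * \<beta> k * A) * V k \<le> (2 * n' * \<beta> k * A) * (M * b k)"
        using elim A by (intro mult_left_mono) (auto simp: n'_def)
      then have 3: "0 \<le> 2 * n' * A * M * \<beta> k * b k - 2 * n' * \<beta> k * (A * V k)"
        by (simp add: algebra_simps)
      have "(a (Suc k))\<^sup>2 \<le> (a k)\<^sup>2 + C * \<beta> k * ((a k)\<^sup>2 + (d k)\<^sup>2 + (u k)\<^sup>2)" using elim by simp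
      then have "(a (Suc k))\<^sup>2 + A * V (Suc k) \<le> (1 - 2 * n' * \<beta> k) * ((a k)\<^sup>2 + A * V k) + E * \<beta> k * b k"
        using 1 2 3 by (simp add: E_def algebra_simps)
      moreover have "(1 + n * \<beta> k) * b (Suc k) \<le> (1 + 2 * n' / 2 * \<beta> k) * b (Suc k)"
        using \<open>0 < \<beta> k\<close> b1 by (intro mult_right_mono add_left_mono) (auto simp: n'_def)
      then have "b k \<le> (1 + 2 * n' / 2 * \<beta> k) * b (Suc k)" using elim by linarith
      ultimately show ?case using elim by blast
    qed
  qed (simp add: n'_def)
  then obtain B where B: "0 < B" "\<forall>\<^sub>F k in sequentially. (a k)\<^sup>2 + A * V k \<le> B * b k" by blast
  define B' where "B' = max B (max (M / c) (M + (M / c + max Q 0)))"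
  have B': "B \<le> B'" "M / c \<le> B'" "M \<le> B'" "M / c + Q \<le> B'"
    using M c_pos by (auto simp: B'_def le_max_iff_disj)
  have "\<forall>\<^sub>F k in sequentially. \<bar>f (z k) - fstar\<bar> \<le> B' * b k \<and> (a k)\<^sup>2 \<le> B' * b k \<and> (d k)\<^sup>2 \<le> B' * b k"
    using B(2) V V_mono b \<tau> \<tau>_nonneg d
  proof eventually_elim
    case (elim k)
    have sc: "t * b k \<le> B' * b k" if "t \<le> B'" for t using that elim by (intro mult_right_mono) auto
    have "0 \<le> A * V k" using A elim by simp
    then have "(a k)\<^sup>2 \<le> B' * b k" using elim sc[OF B'(1)] by linarith
    moreover have "(d k)\<^sup>2 \<le> B' * b k" using elim sc[OF B'(2)] by linarith
    moreover have "f (z k) - fstar \<le> B' * b k"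
    proof -
      have "f (z k) - fstar \<le> V k" using elim by (simp add: V_def)
      then show ?thesis using elim sc[OF B'(3)] by linarith
    qed
    moreover have "- (f (z k) - fstar) \<le> (M / c + Q) * b k"
      using elim by (simp add: V_def algebra_simps) 
    ultimately show ?case using sc[OF B'(4)] by linarith
  qed
  moreover have "0 < B'" using B B' by linarith
  ultimately show ?thesis by blast
qed

end

section \<open>Gradient motion coupled to a damped momentum\<close>

lemma square_sum_le3:
  fixes p q t :: real
  shows "(p + q + t)\<^sup>2 \<le> 3 * (p\<^sup>2 + q\<^sup>2 + t\<^sup>2)"
  using sum_squares_bound[of p q] sum_squares_bound[of p t] sum_squares_bound[of q t]
  by (simp add: power2_eq_square algebra_simps)

lemma square_sum_le2:
  fixes p q :: real
  shows "(p + q)\<^sup>2 \<le> 2 * (p\<^sup>2 + q\<^sup>2)"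
  using sum_squares_bound[of p q] by (simp add: power2_eq_square algebra_simps)

lemma norm_convex_square:
  fixes v w :: "'a::real_normed_vector"
  assumes "0 \<le> lam" "lam < 1"
  shows "(norm (lam *\<^sub>R v + (1 - lam) *\<^sub>R w))\<^sup>2 \<le> lam * (norm v)\<^sup>2 + (1 - lam) * (norm w)\<^sup>2"
proof -
  have "norm (lam *\<^sub>R v + (1 - lam) *\<^sub>R w) \<le> lam * norm v + (1 - lam) * norm w"
    using norm_triangle_ineq[of "lam *\<^sub>R v" "(1 - lam) *\<^sub>R w"] assms by simp
  then have "(norm (lam *\<^sub>R v + (1 - lam) *\<^sub>R w))\<^sup>2 \<le> (lam * norm v + (1 - lam) * norm w)\<^sup>2"
    by (rule power_mono) simp
  also have "\<dots> \<le> lam * (norm v)\<^sup>2 + (1 - lam) * (norm w)\<^sup>2"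
  proof -
    have "0 \<le> lam * (1 - lam) * (norm v - norm w)\<^sup>2" using assms by simp
    then show ?thesis by (simp add: power2_eq_square algebra_simps)
  qed
  finally show ?thesis .
qed

text \<open>
  The corrected iterates \<open>z\<close>. The gradient is evaluated at a point shifted by the filtered noise \<open>u\<close>
  and by a multiple \<open>\<gamma>\<close> of the momentum \<open>d\<close>, which covers both the extrapolation and the change of
  variables. The momentum equation is written as a convex combination, so that convexity of the
  squared norm gives its damping. The noise \<open>e\<close> acts on \<open>z\<close> only through \<open>u\<close>, and on \<open>d\<close> with the
  summable weight \<open>(\<beta> k)\<^sup>2\<close>.
\<close>
locale corrected_momentum = smooth_function f L
  for f :: "'a::euclidean_space \<Rightarrow> real" and L :: real +
  fixes z d u e :: "nat \<Rightarrow> 'a" and \<beta> :: "nat \<Rightarrow> real" and lam \<gamma> \<kappa> :: real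
  assumes bdd: "bdd_below (range f)" and lam: "0 \<le> lam" "lam < 1" and kap: "0 \<le> \<kappa>"
    and \<beta>_pos: "\<forall>\<^sub>F k in sequentially. 0 < \<beta> k" and \<beta>_null: "\<beta> \<longlonglongrightarrow> 0" and \<beta>_sum: "\<not> summable \<beta>"
    and z_step: "\<forall>\<^sub>F k in sequentially.
        z (Suc k) = z k - \<beta> k *\<^sub>R (grad f (z k - u k + \<gamma> *\<^sub>R d k) + \<kappa> *\<^sub>R u k)"
    and d_step: "\<forall>\<^sub>F k in sequentially.
        d (Suc k) = lam *\<^sub>R d k + (1 - lam) *\<^sub>R (\<beta> k *\<^sub>R (e k - grad f (z k - u k + \<gamma> *\<^sub>R d k)))"
    and u_sum: "summable (\<lambda>k. \<beta> k * (norm (u k))\<^sup>2)"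
    and e_sum: "summable (\<lambda>k. (\<beta> k)\<^sup>2 * (norm (e k))\<^sup>2)"
begin

definition drift_const :: real where "drift_const = L * \<bar>\<gamma>\<bar> + L + \<kappa> + 1"

lemma drift_const_pos: "1 \<le> drift_const" using L_pos kap by (simp add: drift_const_def)

definition w :: "nat \<Rightarrow> 'a" where "w k = grad f (z k - u k + \<gamma> *\<^sub>R d k)"

lemma drift_error: "norm (w k + \<kappa> *\<^sub>R u k - grad f (z k)) \<le> drift_const * (norm (d k) + norm (u k))"
  and w_le: "norm (w k) \<le> norm (grad f (z k)) + drift_const * norm (d k) + drift_const * norm (u k)"
proof -
  have "norm (w k - grad f (z k)) \<le> L * norm (\<gamma> *\<^sub>R d k - u k)"
    using grad_diff_le[of "z k - u k + \<gamma> *\<^sub>R d k" "z k"] by (simp add: w_def algebra_simps)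
  also have "\<dots> \<le> L * (\<bar>\<gamma>\<bar> * norm (d k) + norm (u k))"
    using L_pos norm_triangle_ineq4[of "\<gamma> *\<^sub>R d k" "u k"] by simp
  finally have 1: "norm (w k - grad f (z k)) \<le> L * \<bar>\<gamma>\<bar> * norm (d k) + L * norm (u k)"
    by (simp add: algebra_simps)
  have 2: "(L * \<bar>\<gamma>\<bar>) * norm (d k) \<le> drift_const * norm (d k)" "(L + \<kappa>) * norm (u k) \<le> drift_const * norm (u k)"
    "L * norm (u k) \<le> drift_const * norm (u k)"
    using L_pos kap by (auto simp: drift_const_def intro!: mult_right_mono)
  have "norm (w k + \<kappa> *\<^sub>R u k - grad f (z k)) \<le> norm (w k - grad f (z k)) + \<kappa> * norm (u k)"
    using norm_triangle_ineq[of "w k - grad f (z k)" "\<kappa> *\<^sub>R u k"] kap by (simp add: algebra_simps)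
  then show "norm (w k + \<kappa> *\<^sub>R u k - grad f (z k)) \<le> drift_const * (norm (d k) + norm (u k))"
    using 1 2(1,2) by (simp add: distrib_left distrib_right)
  show "norm (w k) \<le> norm (grad f (z k)) + drift_const * norm (d k) + drift_const * norm (u k)"
    using 1 2 norm_triangle_ineq[of "w k - grad f (z k)" "grad f (z k)"] by simp
qed

definition s :: "nat \<Rightarrow> real" where
  "s k = (2 * drift_const\<^sup>2 + 1) * (\<beta> k * (norm (u k))\<^sup>2) + 2 * ((\<beta> k)\<^sup>2 * (norm (e k))\<^sup>2)"

text \<open>Smoothness gives the descent of \<open>f\<close>, convexity the damping of the momentum; for small steps all cross
  terms are absorbed. The four entries of \<open>\<epsilon>\<close> serve, in this order, the second-order term of the
  expansion, the gradient in the momentum update, the feedback of \<open>u\<close> and \<open>d\<close> in that update, and the drift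
  of \<open>z\<close> caused by the momentum.\<close>
lemma energy:
  "\<forall>\<^sub>F k in sequentially. f (z (Suc k)) + (norm (d (Suc k)))\<^sup>2 + \<beta> k / 4 * (norm (grad f (z k)))\<^sup>2
      + (1 - lam) / 2 * (norm (d k))\<^sup>2 \<le> f (z k) + (norm (d k))\<^sup>2 + s k"
proof -
  define \<epsilon> where "\<epsilon> = min (1 / (16 * L)) (min (1 / 96) (min (1 / (6 * drift_const\<^sup>2)) ((1 - lam) / (2 * (2 * drift_const\<^sup>2 + 1)))))"
  have Cd0: "0 < drift_const" using drift_const_pos by simp
  have "0 < \<epsilon>" using L_pos lam Cd0 by (auto simp: \<epsilon>_def intro!: divide_pos_pos add_pos_pos)
  then have "\<forall>\<^sub>F k in sequentially. \<beta> k < \<epsilon>" using order_tendstoD(2)[OF \<beta>_null] by blast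
  then show ?thesis using \<beta>_pos z_step d_step
  proof eventually_elim
    case (elim k)
    define g where "g = grad f (z k)"
    define r where "r = w k + \<kappa> *\<^sub>R u k - g"
    define D where "D = (norm (d k))\<^sup>2"
    define U where "U = (norm (u k))\<^sup>2"
    define A where "A = (norm g)\<^sup>2"
    define B where "B = \<beta> k"
    have nn: "0 \<le> D" "0 \<le> U" "0 \<le> A" "0 < B" using elim by (auto simp: D_def U_def A_def B_def)
    have B: "B * (16 * L) \<le> 1" "B \<le> 1 / 96" "B * (6 * drift_const\<^sup>2) \<le> 1" "B * (2 * (2 * drift_const\<^sup>2 + 1)) \<le> 1 - lam"
    proof -
      have B1: "B \<le> 1 / (16 * L)" "B \<le> 1 / 96" "B \<le> 1 / (6 * drift_const\<^sup>2)" "B \<le> (1 - lam) / (2 * (2 * drift_const\<^sup>2 + 1))"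
        using elim by (auto simp: B_def \<epsilon>_def)
      have p: "0 < 6 * drift_const\<^sup>2" "0 < 2 * (2 * drift_const\<^sup>2 + 1)" using Cd0 by (auto intro!: add_pos_pos)
      show "B * (16 * L) \<le> 1" using B1(1) L_pos by (simp add: pos_le_divide_eq)
      show "B \<le> 1 / 96" by fact
      show "B * (6 * drift_const\<^sup>2) \<le> 1" using B1(3) p by (simp add: pos_le_divide_eq)
      show "B * (2 * (2 * drift_const\<^sup>2 + 1)) \<le> 1 - lam" using B1(4) p by (simp add: pos_le_divide_eq)
    qed
    have r2: "(norm r)\<^sup>2 \<le> 2 * drift_const\<^sup>2 * (D + U)"
    proof -
      have "(norm r)\<^sup>2 \<le> (drift_const * (norm (d k) + norm (u k)))\<^sup>2"
        using drift_error[of k] by (intro power_mono) (auto simp: r_def g_def)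
      also have "\<dots> \<le> drift_const\<^sup>2 * (2 * (D + U))"
        using square_sum_le2[of "norm (d k)" "norm (u k)"]
        by (simp add: power_mult_distrib D_def U_def mult_left_mono)
      finally show ?thesis by (simp add: algebra_simps)
    qed
    have zk: "z (Suc k) = z k - B *\<^sub>R (g + r)"
      using elim by (simp add: r_def w_def B_def)
    have "f (z (Suc k)) \<le> f (z k) + g \<bullet> (z (Suc k) - z k) + L * (norm (z (Suc k) - z k))\<^sup>2"
      using first_order_expansion[of "z (Suc k)" "z k"] by (simp add: g_def)
    also have "\<dots> = f (z k) - B * (A + g \<bullet> r) + L * (B\<^sup>2 * (norm (g + r))\<^sup>2)"
      using nn by (simp add: zk A_def power2_norm_eq_inner[of g] inner_add_right power_mult_distrib)
    also have "\<dots> \<le> f (z k) - B * (A / 2 - (norm r)\<^sup>2 / 2) + L * (B\<^sup>2 * (2 * (A + (norm r)\<^sup>2)))"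
    proof -
      have "- (g \<bullet> r) \<le> norm g * norm r" using Cauchy_Schwarz_ineq2[of g r] by linarith
      also have "\<dots> \<le> A / 2 + (norm r)\<^sup>2 / 2"
        using sum_squares_bound[of "norm g" "norm r"] by (simp add: A_def)
      finally have "B * (A / 2 - (norm r)\<^sup>2 / 2) \<le> B * (A + g \<bullet> r)"
        using nn by (intro mult_left_mono) auto
      moreover have "(norm (g + r))\<^sup>2 \<le> (norm g + norm r)\<^sup>2"
        by (intro power_mono norm_triangle_ineq) simp
      then have "(norm (g + r))\<^sup>2 \<le> 2 * (A + (norm r)\<^sup>2)"
        using square_sum_le2[of "norm g" "norm r"] unfolding A_def by linarith
      then have "L * (B\<^sup>2 * (norm (g + r))\<^sup>2) \<le> L * (B\<^sup>2 * (2 * (A + (norm r)\<^sup>2)))"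
        using L_pos by (intro mult_left_mono) auto
      ultimately show ?thesis by linarith
    qed
    also have "L * (B\<^sup>2 * (2 * (A + (norm r)\<^sup>2))) \<le> B / 8 * (A + (norm r)\<^sup>2)"
    proof -
      have "(B * (16 * L)) * (B / 8 * (A + (norm r)\<^sup>2)) \<le> 1 * (B / 8 * (A + (norm r)\<^sup>2))"
        using B nn by (intro mult_right_mono) auto
      then show ?thesis by (simp add: power2_eq_square algebra_simps)
    qed
    finally have f1: "f (z (Suc k)) \<le> f (z k) - 3 / 8 * (B * A) + 5 / 8 * (B * (norm r)\<^sup>2)"
      by (simp add: algebra_simps)
    have "B * (norm r)\<^sup>2 \<le> B * (2 * drift_const\<^sup>2 * (D + U))" using r2 nn by simp
    then have f2: "f (z (Suc k)) \<le> f (z k) - 3 / 8 * (B * A) + 5 / 4 * (drift_const\<^sup>2 * (B * D)) + 5 / 4 * (drift_const\<^sup>2 * (B * U))"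
      using f1 by (simp add: algebra_simps)
    have "(norm (d (Suc k)))\<^sup>2 \<le> lam * D + (1 - lam) * (norm (B *\<^sub>R (e k - w k)))\<^sup>2"
      using elim norm_convex_square[OF lam, of "d k" "B *\<^sub>R (e k - w k)"] by (simp add: D_def B_def w_def)
    also have "\<dots> \<le> lam * D + 1 * (norm (B *\<^sub>R (e k - w k)))\<^sup>2"
      using lam by (intro add_left_mono mult_right_mono) auto
    also have "\<dots> = lam * D + B\<^sup>2 * (norm (e k - w k))\<^sup>2"
      using nn by (simp add: power_mult_distrib)
    also have "\<dots> \<le> lam * D + B\<^sup>2 * (2 * ((norm (e k))\<^sup>2 + 3 * (A + drift_const\<^sup>2 * D + drift_const\<^sup>2 * U)))"
    proof -
      have "(norm (e k - w k))\<^sup>2 \<le> (norm (e k) + norm (w k))\<^sup>2"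
        by (intro power_mono norm_triangle_ineq4) simp
      also have "\<dots> \<le> 2 * ((norm (e k))\<^sup>2 + (norm (w k))\<^sup>2)" by (rule square_sum_le2)
      also have "(norm (w k))\<^sup>2 \<le> (norm g + drift_const * norm (d k) + drift_const * norm (u k))\<^sup>2"
        using w_le[of k] by (intro power_mono) (auto simp: g_def)
      also have "\<dots> \<le> 3 * (A + drift_const\<^sup>2 * D + drift_const\<^sup>2 * U)"
        using square_sum_le3[of "norm g" "drift_const * norm (d k)" "drift_const * norm (u k)"]
        by (simp add: A_def D_def U_def power_mult_distrib)
      finally show ?thesis by (intro add_left_mono mult_left_mono) auto
    qed
    finally have d1: "(norm (d (Suc k)))\<^sup>2 \<le> lam * D + 2 * (B\<^sup>2 * (norm (e k))\<^sup>2)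
        + 6 * (B * (B * A)) + (B * (6 * drift_const\<^sup>2)) * (B * D) + (B * (6 * drift_const\<^sup>2)) * (B * U)"
      by (simp add: power2_eq_square algebra_simps)
    have "B * (B * A) \<le> 1 / 96 * (B * A)" using B nn by (intro mult_right_mono) auto
    moreover have "(B * (6 * drift_const\<^sup>2)) * (B * D) \<le> 1 * (B * D)" "(B * (6 * drift_const\<^sup>2)) * (B * U) \<le> 1 * (B * U)"
      using B nn by (intro mult_right_mono; simp)+
    ultimately have d2: "(norm (d (Suc k)))\<^sup>2 \<le> lam * D + 2 * (B\<^sup>2 * (norm (e k))\<^sup>2) + 1 / 16 * (B * A) + B * D + B * U"
      using d1 by linarith
    have c: "drift_const\<^sup>2 * (B * D) * 5 / 4 \<le> 2 * (drift_const\<^sup>2 * (B * D))" "drift_const\<^sup>2 * (B * U) * 5 / 4 \<le> 2 * (drift_const\<^sup>2 * (B * U))"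
      "0 \<le> B * A"
      using nn by auto
    have "(B * (2 * (2 * drift_const\<^sup>2 + 1))) * D \<le> (1 - lam) * D" using B nn by (intro mult_right_mono) auto
    then have "2 * (drift_const\<^sup>2 * (B * D)) + B * D \<le> (1 - lam) / 2 * D" by (simp add: algebra_simps)
    moreover have "s k = 2 * (drift_const\<^sup>2 * (B * U)) + B * U + 2 * (B\<^sup>2 * (norm (e k))\<^sup>2)"
      by (simp add: s_def U_def B_def algebra_simps)
    moreover have "lam * D = D - (1 - lam) / 2 * D - (1 - lam) / 2 * D" by (simp add: field_simps)
    ultimately have "f (z (Suc k)) + (norm (d (Suc k)))\<^sup>2 + B * A / 4 + (1 - lam) / 2 * D \<le> f (z k) + D + s k"
      using f2 d2 c by linarith
    then show ?case by (simp add: A_def D_def B_def g_def)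
  qed
qed

lemma step_length:
  "\<forall>\<^sub>F k in sequentially. norm (z (Suc k) - z k) \<le> drift_const * \<beta> k * (norm (grad f (z k)) + norm (d k) + norm (u k))"
  using \<beta>_pos z_step
proof eventually_elim
  case (elim k)
  have "z (Suc k) - z k = - (\<beta> k *\<^sub>R (w k + \<kappa> *\<^sub>R u k))"
    using elim unfolding w_def by simp
  then have "norm (z (Suc k) - z k) = \<beta> k * norm (w k + \<kappa> *\<^sub>R u k)"
    using elim by simp
  also have "norm (w k + \<kappa> *\<^sub>R u k) \<le> norm (grad f (z k)) + drift_const * (norm (d k) + norm (u k))"
    using drift_error[of k] norm_triangle_ineq[of "w k + \<kappa> *\<^sub>R u k - grad f (z k)" "grad f (z k)"] by simp
  also have "\<dots> \<le> drift_const * norm (grad f (z k)) + drift_const * (norm (d k) + norm (u k))"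
    using drift_const_pos mult_right_mono[of 1 drift_const "norm (grad f (z k))"] by simp
  finally have "norm (z (Suc k) - z k) \<le> \<beta> k * (drift_const * norm (grad f (z k)) + drift_const * (norm (d k) + norm (u k)))"
    using \<open>0 < \<beta> k\<close> by simp
  then show ?case by (simp add: algebra_simps)
qed

definition growth_const :: real where "growth_const = 4 * (L * drift_const) + 3 * (L * drift_const)\<^sup>2"

lemma gradient_growth:
  "\<forall>\<^sub>F k in sequentially. (norm (grad f (z (Suc k))))\<^sup>2 \<le> (norm (grad f (z k)))\<^sup>2
     + growth_const * \<beta> k * ((norm (grad f (z k)))\<^sup>2 + (norm (d k))\<^sup>2 + (norm (u k))\<^sup>2)"
  using step_length \<beta>_pos order_tendstoD(2)[OF \<beta>_null zero_less_one]
proof eventually_elim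
  case (elim k)
  define a where "a = norm (grad f (z k))"
  define p where "p = a + norm (d k) + norm (u k)"
  define S where "S = a\<^sup>2 + (norm (d k))\<^sup>2 + (norm (u k))\<^sup>2"
  define l where "l = L * drift_const"
  have l: "0 < l" using L_pos drift_const_pos by (simp add: l_def)
  have a0: "0 \<le> a" "0 \<le> p" by (auto simp: a_def p_def)
  have "norm (grad f (z (Suc k))) \<le> a + norm (grad f (z (Suc k)) - grad f (z k))"
    using norm_triangle_ineq[of "grad f (z k)" "grad f (z (Suc k)) - grad f (z k)"] by (simp add: a_def)
  also have "norm (grad f (z (Suc k)) - grad f (z k)) \<le> L * (drift_const * \<beta> k * p)"
    using grad_diff_le[of "z (Suc k)" "z k"] elim mult_left_mono[of _ _ L] L_pos
    by (smt (verit) a_def p_def)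
  finally have "norm (grad f (z (Suc k))) \<le> a + l * \<beta> k * p" by (simp add: l_def algebra_simps)
  then have "(norm (grad f (z (Suc k))))\<^sup>2 \<le> (a + l * \<beta> k * p)\<^sup>2" by (rule power_mono) simp
  also have "\<dots> = a\<^sup>2 + l * \<beta> k * (2 * a * p) + l\<^sup>2 * \<beta> k * \<beta> k * p\<^sup>2"
    by (simp add: power2_eq_square algebra_simps)
  also have "\<dots> \<le> a\<^sup>2 + l * \<beta> k * (4 * S) + l\<^sup>2 * \<beta> k * 1 * (3 * S)"
  proof -
    have p3: "p\<^sup>2 \<le> 3 * S" unfolding p_def S_def by (rule square_sum_le3)
    have "2 * a * p = 2 * a\<^sup>2 + 2 * a * norm (d k) + 2 * a * norm (u k)"
      by (simp add: p_def power2_eq_square algebra_simps)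
    also have "\<dots> \<le> 4 * S"
    proof -
      have "0 \<le> (a - norm (d k))\<^sup>2 + (a - norm (u k))\<^sup>2 + 3 * (norm (d k))\<^sup>2 + 3 * (norm (u k))\<^sup>2" by simp
      then show ?thesis by (simp add: S_def power2_eq_square algebra_simps)
    qed
    finally have "2 * a * p \<le> 4 * S" .
    then have "l * \<beta> k * (2 * a * p) \<le> l * \<beta> k * (4 * S)"
      using elim l by (intro mult_left_mono) auto
    moreover have "l\<^sup>2 * \<beta> k * \<beta> k * p\<^sup>2 \<le> l\<^sup>2 * \<beta> k * 1 * (3 * S)"
      using elim p3 by (intro mult_mono mult_left_mono) auto
    ultimately show ?thesis by linarith
  qed
  also have "\<dots> = a\<^sup>2 + (4 * l + 3 * l\<^sup>2) * \<beta> k * S" by (simp add: algebra_simps)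
  finally show ?case by (simp add: a_def S_def l_def growth_const_def)
qed

lemma dissipative: "dissipative_path f L z (\<lambda>k. norm (d k)) (\<lambda>k. norm (u k)) s \<beta>
   ((1 - lam) / 2) (drift_const + growth_const)"
proof -
  have C2: "0 \<le> growth_const" using L_pos drift_const_pos by (simp add: growth_const_def)
  show ?thesis
  proof
    show "bdd_below (range f)" "\<forall>\<^sub>F k in sequentially. 0 < \<beta> k" "\<beta> \<longlonglongrightarrow> 0" "\<not> summable \<beta>"
      "summable (\<lambda>k. \<beta> k * (norm (u k))\<^sup>2)"
      by (fact bdd \<beta>_pos \<beta>_null \<beta>_sum u_sum)+
    show "0 < (1 - lam) / 2" "0 < drift_const + growth_const" using lam drift_const_pos C2 by auto
    show "\<forall>\<^sub>F k in sequentially. 0 \<le> s k"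
      using \<beta>_pos by eventually_elim (simp add: s_def)
    show "summable s" unfolding s_def[abs_def]
      by (intro summable_add summable_mult u_sum e_sum)
    show "\<forall>\<^sub>F k in sequentially. f (z (Suc k)) + (norm (d (Suc k)))\<^sup>2 + \<beta> k / 4 * (norm (grad f (z k)))\<^sup>2
      + (1 - lam) / 2 * (norm (d k))\<^sup>2 \<le> f (z k) + (norm (d k))\<^sup>2 + s k" by (rule energy)
    show "\<forall>\<^sub>F k in sequentially. (norm (grad f (z (Suc k))))\<^sup>2 \<le> (norm (grad f (z k)))\<^sup>2
     + (drift_const + growth_const) * \<beta> k * ((norm (grad f (z k)))\<^sup>2 + (norm (d k))\<^sup>2 + (norm (u k))\<^sup>2)"
      using gradient_growth \<beta>_pos
    proof eventually_elim
      case (elim k)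
      have "growth_const * (\<beta> k * ((norm (grad f (z k)))\<^sup>2 + (norm (d k))\<^sup>2 + (norm (u k))\<^sup>2))
        \<le> (drift_const + growth_const) * (\<beta> k * ((norm (grad f (z k)))\<^sup>2 + (norm (d k))\<^sup>2 + (norm (u k))\<^sup>2))"
        using drift_const_pos elim by (intro mult_right_mono) auto
      then show ?case using elim unfolding mult.assoc by linarith
    qed
    show "\<forall>\<^sub>F k in sequentially. norm (z (Suc k) - z k)
      \<le> (drift_const + growth_const) * \<beta> k * (norm (grad f (z k)) + norm (d k) + norm (u k))"
      using step_length \<beta>_pos
    proof eventually_elim
      case (elim k)
      have "drift_const * (\<beta> k * (norm (grad f (z k)) + norm (d k) + norm (u k)))
        \<le> (drift_const + growth_const) * (\<beta> k * (norm (grad f (z k)) + norm (d k) + norm (u k)))"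
        using C2 elim by (intro mult_right_mono) auto
      then show ?case using elim unfolding mult.assoc by linarith
    qed
  qed auto
qed

end

section \<open>Discounted martingale noise\<close>

text \<open>The sum of the series has a finite integral, hence it is finite almost everywhere.\<close>
lemma AE_summable_of_integrals:
  fixes Y :: "nat \<Rightarrow> 'w \<Rightarrow> real"
  assumes int: "\<And>k. integrable M (Y k)" and nn: "\<And>k \<omega>. 0 \<le> Y k \<omega>"
    and sm: "summable (\<lambda>k. \<integral>\<omega>. Y k \<omega> \<partial>M)"
  shows "AE \<omega> in M. summable (\<lambda>k. Y k \<omega>)"
proof -
  have [measurable]: "Y k \<in> borel_measurable M" for k using int by auto
  have "(\<integral>\<^sup>+\<omega>. (\<Sum>k. ennreal (Y k \<omega>)) \<partial>M) = (\<Sum>k. \<integral>\<^sup>+\<omega>. ennreal (Y k \<omega>) \<partial>M)"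
    by (rule nn_integral_suminf) simp
  also have "\<dots> = (\<Sum>k. ennreal (\<integral>\<omega>. Y k \<omega> \<partial>M))"
    using int nn by (simp add: nn_integral_eq_integral)
  also have "\<dots> = ennreal (\<Sum>k. \<integral>\<omega>. Y k \<omega> \<partial>M)"
    by (rule suminf_ennreal2) (use nn sm in auto)
  finally have "(\<integral>\<^sup>+\<omega>. (\<Sum>k. ennreal (Y k \<omega>)) \<partial>M) \<noteq> \<infinity>" by simp
  then have "AE \<omega> in M. (\<Sum>k. ennreal (Y k \<omega>)) \<noteq> \<infinity>"
    by (intro nn_integral_PInf_AE) auto
  then show ?thesis
    by (auto elim!: eventually_mono intro!: summable_suminf_not_top nn)
qed

text \<open>
  The maximal inequality behind boundedness. On the \<open>F n\<close>-measurable event \<open>A n\<close> that level \<open>t\<close> has not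
  been reached up to time \<open>n\<close>, the next step can be estimated; off this event, the value is frozen at
  \<open>t\<close>. The expectation \<open>Z n\<close> of the process so stopped grows only by \<open>s n\<close>, whence level \<open>t\<close> is reached
  with probability at most \<open>c / t\<close>. Testing the one-step inequality with indicators replaces
  conditional expectations of \<open>X\<close>.
\<close>
lemma (in prob_space) AE_bounded_almost_supermartingale:
  fixes X :: "nat \<Rightarrow> 'a \<Rightarrow> real" and F :: "nat \<Rightarrow> 'a measure"
  assumes sub: "\<And>k. subalgebra M (F k)" and mono: "\<And>k. subalgebra (F (Suc k)) (F k)"
    and meas: "\<And>k. X k \<in> borel_measurable (F k)"
    and int: "\<And>k. integrable M (X k)" and nn: "\<And>k \<omega>. 0 \<le> X k \<omega>"
    and step: "\<And>k A. A \<in> sets (F k) \<Longrightarrow>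
      (\<integral>\<omega>. indicator A \<omega> * X (Suc k) \<omega> \<partial>M) \<le> (\<integral>\<omega>. indicator A \<omega> * X k \<omega> \<partial>M) + s k"
    and s: "summable s" "\<And>k. 0 \<le> s k"
  shows "AE \<omega> in M. \<exists>B. \<forall>k. X k \<omega> \<le> B"
proof -
  define c where "c = (\<integral>\<omega>. X 0 \<omega> \<partial>M) + suminf s"
  have [measurable]: "X k \<in> borel_measurable M" for k using int by auto
  have bound: "prob {\<omega>\<in>space M. \<exists>k. t \<le> X k \<omega>} \<le> c / t" if t: "0 < t" for t
  proof -
    define A where "A n = {\<omega>\<in>space M. \<forall>k\<le>n. X k \<omega> < t}" for n
    have AF: "A n \<in> sets (F n)" for n
    proof (induction n)
      case 0
      have "A 0 = {\<omega>\<in>space (F 0). X 0 \<omega> < t}" using sub[of 0] by (auto simp: A_def subalgebra_def)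
      then show ?case using meas[of 0] by simp
    next
      case (Suc n)
      have "A (Suc n) = A n \<inter> {\<omega>\<in>space (F (Suc n)). X (Suc n) \<omega> < t}"
        using sub[of "Suc n"] by (auto simp: A_def subalgebra_def le_Suc_eq)
      moreover have "A n \<in> sets (F (Suc n))" using Suc mono[of n] by (auto simp: subalgebra_def)
      moreover have "{\<omega>\<in>space (F (Suc n)). X (Suc n) \<omega> < t} \<in> sets (F (Suc n))"
        using meas[of "Suc n"] by simp
      ultimately show ?case by simp
    qed
    have AM: "A n \<in> sets M" for n using AF[of n] sub[of n] by (auto simp: subalgebra_def)
    note AM[measurable]
    have intA: "integrable M (\<lambda>\<omega>. indicator (A n) \<omega> * X k \<omega>)" for n k
      using integrable_mult_indicator[OF AM int, of n k] by simp
    have intC: "integrable M (\<lambda>\<omega>. t * indicator (space M - A n) \<omega> :: real)" for n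
      by (intro integrable_mult_right integrable_real_indicator) (auto simp: emeasure_eq_measure)
    define Z where "Z n = (\<integral>\<omega>. indicator (A n) \<omega> * X n \<omega> \<partial>M) + t * prob (space M - A n)" for n
    have Z: "Z n = (\<integral>\<omega>. indicator (A n) \<omega> * X n \<omega> + t * indicator (space M - A n) \<omega> \<partial>M)" for n
      unfolding Z_def using intA intC by (subst Bochner_Integration.integral_add) auto
    have Zb: "Z n \<le> (\<integral>\<omega>. X 0 \<omega> \<partial>M) + sum s {..<n}" for n
    proof (induction n)
      case 0
      have "Z 0 \<le> (\<integral>\<omega>. X 0 \<omega> \<partial>M)"
        unfolding Z
      proof (rule integral_mono)
        fix \<omega> assume "\<omega> \<in> space M"
        then show "indicator (A 0) \<omega> * X 0 \<omega> + t * indicator (space M - A 0) \<omega> \<le> X 0 \<omega>"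
          by (auto simp: A_def indicator_def)
      qed (use intA intC int in auto)
      then show ?case by simp
    next
      case (Suc n)
      have "Z (Suc n) \<le> (\<integral>\<omega>. indicator (A n) \<omega> * X (Suc n) \<omega> + t * indicator (space M - A n) \<omega> \<partial>M)"
        unfolding Z
      proof (rule integral_mono)
        fix \<omega> assume "\<omega> \<in> space M"
        then show "indicator (A (Suc n)) \<omega> * X (Suc n) \<omega> + t * indicator (space M - A (Suc n)) \<omega>
          \<le> indicator (A n) \<omega> * X (Suc n) \<omega> + t * indicator (space M - A n) \<omega>"
          using nn[of "Suc n" \<omega>] by (auto simp: A_def indicator_def le_Suc_eq not_less)
      qed (use intA intC in auto)
      also have "\<dots> = (\<integral>\<omega>. indicator (A n) \<omega> * X (Suc n) \<omega> \<partial>M) + t * prob (space M - A n)"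
        using intA intC by (subst Bochner_Integration.integral_add) auto
      also have "\<dots> \<le> Z n + s n" using step[OF AF, of n] by (simp add: Z_def)
      finally show ?case using Suc by simp
    qed
    have "prob (space M - A n) \<le> c / t" for n
    proof -
      have "0 \<le> (\<integral>\<omega>. indicator (A n) \<omega> * X n \<omega> \<partial>M)" using nn by (intro integral_nonneg_AE) auto
      then have "t * prob (space M - A n) \<le> (\<integral>\<omega>. X 0 \<omega> \<partial>M) + sum s {..<n}"
        using Zb[of n] by (simp add: Z_def)
      also have "\<dots> \<le> c" unfolding c_def using sum_le_suminf[OF s(1), of "{..<n}"] s(2) by simp
      finally show ?thesis using t by (simp add: field_simps)
    qed
    moreover have "(\<lambda>n. prob (space M - A n)) \<longlonglongrightarrow> prob (\<Union>n. space M - A n)"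
    proof (rule finite_Lim_measure_incseq)
      show "range (\<lambda>n. space M - A n) \<subseteq> events" using AM by blast
      show "incseq (\<lambda>n. space M - A n)"
        unfolding incseq_def A_def by (auto intro: order_trans)
    qed
    moreover have "(\<Union>n. space M - A n) = {\<omega>\<in>space M. \<exists>k. t \<le> X k \<omega>}"
      by (auto simp: A_def not_less) (meson order_refl not_less)
    ultimately show ?thesis by (metis (no_types, lifting) LIMSEQ_le_const2)
  qed
  define U where "U = (\<Inter>m. {\<omega>\<in>space M. \<exists>k. real (Suc m) \<le> X k \<omega>})"
  have U: "U \<in> sets M" unfolding U_def by measurable
  have "prob U \<le> c / real (Suc m)" for m
  proof -
    have "prob U \<le> prob {\<omega>\<in>space M. \<exists>k. real (Suc m) \<le> X k \<omega>}"
      unfolding U_def by (intro finite_measure_mono) auto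
    also have "\<dots> \<le> c / real (Suc m)" by (rule bound) simp
    finally show ?thesis .
  qed
  moreover have "(\<lambda>m. c / real (Suc m)) \<longlonglongrightarrow> 0" by real_asymp
  ultimately have "prob U \<le> 0" by (intro LIMSEQ_le_const[of _ 0]) auto
  then have "U \<in> null_sets M" using U by (simp add: null_sets_def emeasure_eq_measure measure_le_0_iff)
  moreover have "{\<omega>\<in>space M. \<not> (\<exists>B. \<forall>k. X k \<omega> \<le> B)} \<subseteq> U"
  proof
    fix \<omega> assume *: "\<omega> \<in> {\<omega>\<in>space M. \<not> (\<exists>B. \<forall>k. X k \<omega> \<le> B)}"
    have "\<exists>k. real (Suc m) \<le> X k \<omega>" for m
    proof -
      have "\<not> (\<forall>k. X k \<omega> \<le> real (Suc m))" using * by blast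
      then show ?thesis by (auto simp: not_le intro: less_imp_le)
    qed
    then show "\<omega> \<in> U" using * by (auto simp: U_def)
  qed
  ultimately show ?thesis by (rule AE_I')
qed

locale martingale_noise = prob_space M for M :: "'w measure" +
  fixes F :: "nat \<Rightarrow> 'w measure" and e :: "nat \<Rightarrow> 'w \<Rightarrow> 'a::euclidean_space" and \<sigma> :: real
  assumes sub: "\<And>k. subalgebra M (F k)" and mono: "\<And>k. subalgebra (F (Suc k)) (F k)"
    and e_meas: "\<And>k. 1 \<le> k \<Longrightarrow> e k \<in> borel_measurable (F (Suc k))"
    and e_mean: "\<And>k. 1 \<le> k \<Longrightarrow> AE \<omega> in M. vec_cond_exp M (F k) (e k) \<omega> = 0"
    and e_var: "\<And>k. 1 \<le> k \<Longrightarrow>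
      AE \<omega> in M. nn_cond_exp M (F k) (\<lambda>\<omega>. ennreal ((norm (e k \<omega>))\<^sup>2)) \<omega> \<le> ennreal (\<sigma>\<^sup>2)"
begin

lemma F_cond: "sigma_finite_subalgebra M (F k)"
  by (rule finite_measure_subalgebra_is_sigma_finite)
    (unfold_locales, rule sub)

lemma meas_M: "X \<in> borel_measurable (F k) \<Longrightarrow> X \<in> borel_measurable M"
  by (rule measurable_from_subalg[OF sub])

lemma e_meas_M: "1 \<le> k \<Longrightarrow> e k \<in> borel_measurable M"
  using meas_M e_meas by blast

text \<open>The extended conditional expectation integrates to the full second moment, which is
  therefore finite.\<close>
lemma e_second_moment:
  assumes k: "1 \<le> k"
  shows "integrable M (\<lambda>\<omega>. (norm (e k \<omega>))\<^sup>2)" and "(\<integral>\<omega>. (norm (e k \<omega>))\<^sup>2 \<partial>M) \<le> \<sigma>\<^sup>2"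
proof -
  interpret c: sigma_finite_subalgebra M "F k" by (rule F_cond)
  note [measurable] = e_meas_M[OF k]
  have "(\<integral>\<^sup>+\<omega>. ennreal ((norm (e k \<omega>))\<^sup>2) \<partial>M)
    = (\<integral>\<^sup>+\<omega>. 1 * nn_cond_exp M (F k) (\<lambda>\<omega>. ennreal ((norm (e k \<omega>))\<^sup>2)) \<omega> \<partial>M)"
    using c.nn_cond_exp_intg[of "\<lambda>_. 1" "\<lambda>\<omega>. ennreal ((norm (e k \<omega>))\<^sup>2)"] by simp
  also have "\<dots> \<le> (\<integral>\<^sup>+\<omega>. ennreal (\<sigma>\<^sup>2) \<partial>M)"
    using e_var[OF k] by (intro nn_integral_mono_AE) auto
  also have "\<dots> = ennreal (\<sigma>\<^sup>2)" by (simp add: emeasure_space_1)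
  finally have *: "(\<integral>\<^sup>+\<omega>. ennreal ((norm (e k \<omega>))\<^sup>2) \<partial>M) \<le> ennreal (\<sigma>\<^sup>2)" .
  then show int: "integrable M (\<lambda>\<omega>. (norm (e k \<omega>))\<^sup>2)"
    by (intro integrableI_bounded) (auto intro: le_less_trans)
  show "(\<integral>\<omega>. (norm (e k \<omega>))\<^sup>2 \<partial>M) \<le> \<sigma>\<^sup>2"
    using * by (simp add: nn_integral_eq_integral[OF int])
qed

lemma AE_summable_weighted_noise:
  assumes "summable w" "\<And>k. 0 \<le> w k"
  shows "AE \<omega> in M. summable (\<lambda>k. w k * (norm (e k \<omega>))\<^sup>2)"
proof -
  have "AE \<omega> in M. summable (\<lambda>k. w (Suc k) * (norm (e (Suc k) \<omega>))\<^sup>2)"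
  proof (rule AE_summable_of_integrals)
    show "integrable M (\<lambda>\<omega>. w (Suc k) * (norm (e (Suc k) \<omega>))\<^sup>2)" for k
      by (intro integrable_mult_right e_second_moment) simp
    show "0 \<le> w (Suc k) * (norm (e (Suc k) \<omega>))\<^sup>2" for k \<omega> using assms by simp
    show "summable (\<lambda>k. \<integral>\<omega>. w (Suc k) * (norm (e (Suc k) \<omega>))\<^sup>2 \<partial>M)"
    proof (rule summable_comparison_test_ev)
      show "summable (\<lambda>k. w (Suc k) * \<sigma>\<^sup>2)"
        using assms(1) by (intro summable_mult2) (simp add: summable_Suc_iff)
      show "\<forall>\<^sub>F k in sequentially. norm (\<integral>\<omega>. w (Suc k) * (norm (e (Suc k) \<omega>))\<^sup>2 \<partial>M) \<le> w (Suc k) * \<sigma>\<^sup>2"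
        using e_second_moment(2) assms(2)
        by (intro always_eventually allI) (simp add: abs_mult mult_left_mono)
    qed
  qed
  then show ?thesis
  proof eventually_elim
    case (elim \<omega>)
    then show ?case using summable_Suc_iff[of "\<lambda>k. w k * (norm (e k \<omega>))\<^sup>2"] by simp
  qed
qed

text \<open>The components are treated separately, as the conditional mean is defined by them; square
  integrability of both factors makes every product integrable.\<close>
lemma e_orthogonal:
  fixes X :: "'w \<Rightarrow> 'a"
  assumes k: "1 \<le> k" and X: "X \<in> borel_measurable (F k)" and X2: "integrable M (\<lambda>\<omega>. (norm (X \<omega>))\<^sup>2)"
  shows "integrable M (\<lambda>\<omega>. X \<omega> \<bullet> e k \<omega>)" and "(\<integral>\<omega>. X \<omega> \<bullet> e k \<omega> \<partial>M) = 0"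
proof -
  interpret c: sigma_finite_subalgebra M "F k" by (rule F_cond)
  note [measurable] = e_meas_M[OF k] meas_M[OF X]
  note e2 = e_second_moment(1)[OF k]
  have prod: "integrable M (\<lambda>\<omega>. (X \<omega> \<bullet> b) * (e k \<omega> \<bullet> b))" if b: "b \<in> Basis" for b
  proof (rule Bochner_Integration.integrable_bound[OF Bochner_Integration.integrable_add[OF X2 e2]])
    show "AE \<omega> in M. norm ((X \<omega> \<bullet> b) * (e k \<omega> \<bullet> b)) \<le> norm ((norm (X \<omega>))\<^sup>2 + (norm (e k \<omega>))\<^sup>2)"
    proof (intro AE_I2)
      fix \<omega>
      have "\<bar>X \<omega> \<bullet> b\<bar> * \<bar>e k \<omega> \<bullet> b\<bar> \<le> norm (X \<omega>) * norm (e k \<omega>)"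
        using b by (intro mult_mono Basis_le_norm) auto
      also have "\<dots> \<le> (norm (X \<omega>))\<^sup>2 + (norm (e k \<omega>))\<^sup>2"
        using sum_squares_bound[of "norm (X \<omega>)" "norm (e k \<omega>)"]
          mult_nonneg_nonneg[of "norm (X \<omega>)" "norm (e k \<omega>)"] norm_ge_zero[of "X \<omega>"] norm_ge_zero[of "e k \<omega>"]
        by linarith
      finally show "norm ((X \<omega> \<bullet> b) * (e k \<omega> \<bullet> b)) \<le> norm ((norm (X \<omega>))\<^sup>2 + (norm (e k \<omega>))\<^sup>2)"
        by (simp add: abs_mult)
    qed
  qed measurable
  have exp: "X \<omega> \<bullet> e k \<omega> = (\<Sum>b\<in>Basis. (X \<omega> \<bullet> b) * (e k \<omega> \<bullet> b))" for \<omega>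
    by (rule euclidean_inner)
  show "integrable M (\<lambda>\<omega>. X \<omega> \<bullet> e k \<omega>)"
    unfolding exp using prod by (rule Bochner_Integration.integrable_sum)
  have zero: "(\<integral>\<omega>. (X \<omega> \<bullet> b) * (e k \<omega> \<bullet> b) \<partial>M) = 0" if b: "b \<in> Basis" for b
  proof -
    have "AE \<omega> in M. real_cond_exp M (F k) (\<lambda>\<omega>. e k \<omega> \<bullet> b) \<omega> = 0"
      using e_mean[OF k]
    proof eventually_elim
      case (elim \<omega>)
      have "vec_cond_exp M (F k) (e k) \<omega> \<bullet> b = real_cond_exp M (F k) (\<lambda>\<omega>. e k \<omega> \<bullet> b) \<omega>"
        unfolding vec_cond_exp_def using b
        by (simp add: inner_sum_left inner_Basis if_distrib sum.delta cong: if_cong)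
      then show ?case using elim by simp
    qed
    then have "(\<integral>\<omega>. (X \<omega> \<bullet> b) * real_cond_exp M (F k) (\<lambda>\<omega>. e k \<omega> \<bullet> b) \<omega> \<partial>M) = (\<integral>\<omega>. 0 \<partial>M)"
      by (intro integral_cong_AE) (auto intro: borel_measurable_cond_exp2)
    moreover have "(\<integral>\<omega>. (X \<omega> \<bullet> b) * real_cond_exp M (F k) (\<lambda>\<omega>. e k \<omega> \<bullet> b) \<omega> \<partial>M)
      = (\<integral>\<omega>. (X \<omega> \<bullet> b) * (e k \<omega> \<bullet> b) \<partial>M)"
      by (rule c.real_cond_exp_intg(2)[OF prod[OF b]]) (use X in measurable)
    ultimately show ?thesis by simp
  qed
  show "(\<integral>\<omega>. X \<omega> \<bullet> e k \<omega> \<partial>M) = 0"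
    unfolding exp using prod zero by (subst Bochner_Integration.integral_sum) auto
qed

end

text \<open>The filter is zero up to index \<open>N\<close>, so that only discount factors from \<open>N\<close> onwards matter; for large
  \<open>N\<close> these are contractive.\<close>
primrec filtered :: "nat \<Rightarrow> (nat \<Rightarrow> real) \<Rightarrow> (nat \<Rightarrow> real) \<Rightarrow> (nat \<Rightarrow> 'a::real_vector) \<Rightarrow> nat \<Rightarrow> 'a" where
  "filtered N \<rho> \<beta> v 0 = 0"
| "filtered N \<rho> \<beta> v (Suc k) = (if k < N then 0 else \<rho> k *\<^sub>R filtered N \<rho> \<beta> v k - \<beta> k *\<^sub>R v k)"

context martingale_noise
begin

context
  fixes N :: nat and \<rho> \<beta> :: "nat \<Rightarrow> real"
  assumes N: "1 \<le> N"
begin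

definition u :: "nat \<Rightarrow> 'w \<Rightarrow> 'a" where "u k \<omega> = filtered N \<rho> \<beta> (\<lambda>k. e k \<omega>) k"

lemma u_Suc: "u (Suc k) = (\<lambda>\<omega>. if k < N then 0 else \<rho> k *\<^sub>R u k \<omega> - \<beta> k *\<^sub>R e k \<omega>)"
  by (auto simp: u_def)

lemma u_meas: "u k \<in> borel_measurable (F k)"
proof (induction k)
  case 0
  have "u 0 = (\<lambda>_. 0)" by (auto simp: u_def)
  then show ?case by simp
next
  case (Suc k)
  show ?case
  proof (cases "k < N")
    case False
    have [measurable]: "u k \<in> borel_measurable (F (Suc k))" "e k \<in> borel_measurable (F (Suc k))"
      using measurable_from_subalg[OF mono Suc] e_meas[of k] False N by auto
    show ?thesis using False by (simp add: u_Suc)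
  qed (simp add: u_Suc)
qed

text \<open>The cross term vanishes in the mean, since \<open>u k\<close> times the indicator of \<open>A\<close> is known at time \<open>k\<close>.\<close>
lemma u_step:
  assumes A: "A \<in> sets (F k)" and k: "N \<le> k" and int: "integrable M (\<lambda>\<omega>. (norm (u k \<omega>))\<^sup>2)"
  shows "integrable M (\<lambda>\<omega>. (norm (u (Suc k) \<omega>))\<^sup>2)"
    and "(\<integral>\<omega>. indicator A \<omega> * (norm (u (Suc k) \<omega>))\<^sup>2 \<partial>M)
      \<le> (\<rho> k)\<^sup>2 * (\<integral>\<omega>. indicator A \<omega> * (norm (u k \<omega>))\<^sup>2 \<partial>M) + (\<beta> k)\<^sup>2 * \<sigma>\<^sup>2"
proof -
  have k1: "1 \<le> k" using k N by simp
  have AM: "A \<in> sets M" using A sub[of k] by (auto simp: subalgebra_def)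
  note [measurable] = AM u_meas[THEN meas_M] e_meas_M[OF k1]
  note e2 = e_second_moment[OF k1]
  have sq: "(norm (u (Suc k) \<omega>))\<^sup>2 = (\<rho> k)\<^sup>2 * (norm (u k \<omega>))\<^sup>2 + (\<beta> k)\<^sup>2 * (norm (e k \<omega>))\<^sup>2
      - 2 * \<rho> k * \<beta> k * (u k \<omega> \<bullet> e k \<omega>)" for \<omega>
  proof -
    have "(norm (u (Suc k) \<omega>))\<^sup>2 = (\<rho> k *\<^sub>R u k \<omega> - \<beta> k *\<^sub>R e k \<omega>) \<bullet> (\<rho> k *\<^sub>R u k \<omega> - \<beta> k *\<^sub>R e k \<omega>)"
      using k by (simp add: u_Suc power2_norm_eq_inner)
    also have "\<dots> = (\<rho> k)\<^sup>2 * (u k \<omega> \<bullet> u k \<omega>) + (\<beta> k)\<^sup>2 * (e k \<omega> \<bullet> e k \<omega>) - 2 * \<rho> k * \<beta> k * (u k \<omega> \<bullet> e k \<omega>)"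
      by (simp add: inner_diff inner_commute[of "e k \<omega>" "u k \<omega>"] power2_eq_square algebra_simps)
    finally show ?thesis by (simp only: power2_norm_eq_inner)
  qed
  show "integrable M (\<lambda>\<omega>. (norm (u (Suc k) \<omega>))\<^sup>2)"
    unfolding sq using int e2(1) e_orthogonal(1)[OF k1 u_meas int]
    by (intro Bochner_Integration.integrable_diff Bochner_Integration.integrable_add integrable_mult_right) auto
  define X where "X \<omega> = indicat_real A \<omega> *\<^sub>R u k \<omega>" for \<omega>
  have XF: "X \<in> borel_measurable (F k)" unfolding X_def using A u_meas[of k] by measurable
  have X2: "integrable M (\<lambda>\<omega>. (norm (X \<omega>))\<^sup>2)"
    by (rule Bochner_Integration.integrable_bound[OF int]) (auto simp: X_def indicator_def)
  note orth = e_orthogonal[OF k1 XF X2]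
  have iu: "integrable M (\<lambda>\<omega>. indicator A \<omega> * (norm (u k \<omega>))\<^sup>2)"
    using integrable_mult_indicator[OF AM int] by simp
  have ie: "integrable M (\<lambda>\<omega>. indicator A \<omega> * (norm (e k \<omega>))\<^sup>2)"
    using integrable_mult_indicator[OF AM e2(1)] by simp
  have eq: "indicator A \<omega> * (norm (u (Suc k) \<omega>))\<^sup>2 = (\<rho> k)\<^sup>2 * (indicator A \<omega> * (norm (u k \<omega>))\<^sup>2)
     + (\<beta> k)\<^sup>2 * (indicator A \<omega> * (norm (e k \<omega>))\<^sup>2) - 2 * \<rho> k * \<beta> k * (X \<omega> \<bullet> e k \<omega>)" for \<omega>
    unfolding sq X_def by (simp add: algebra_simps)
  have "(\<integral>\<omega>. indicator A \<omega> * (norm (u (Suc k) \<omega>))\<^sup>2 \<partial>M) = (\<rho> k)\<^sup>2 * (\<integral>\<omega>. indicator A \<omega> * (norm (u k \<omega>))\<^sup>2 \<partial>M)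
     + (\<beta> k)\<^sup>2 * (\<integral>\<omega>. indicator A \<omega> * (norm (e k \<omega>))\<^sup>2 \<partial>M)"
    unfolding eq using iu ie orth
    by (simp add: Bochner_Integration.integral_add Bochner_Integration.integral_diff)
  also have "\<dots> \<le> (\<rho> k)\<^sup>2 * (\<integral>\<omega>. indicator A \<omega> * (norm (u k \<omega>))\<^sup>2 \<partial>M) + (\<beta> k)\<^sup>2 * \<sigma>\<^sup>2"
  proof -
    have "(\<integral>\<omega>. indicator A \<omega> * (norm (e k \<omega>))\<^sup>2 \<partial>M) \<le> (\<integral>\<omega>. (norm (e k \<omega>))\<^sup>2 \<partial>M)"
      using ie e2(1) by (intro integral_mono) (auto simp: indicator_def)
    also have "\<dots> \<le> \<sigma>\<^sup>2" by (rule e2(2))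
    finally show ?thesis by (simp add: mult_left_mono)
  qed
  finally show "(\<integral>\<omega>. indicator A \<omega> * (norm (u (Suc k) \<omega>))\<^sup>2 \<partial>M)
      \<le> (\<rho> k)\<^sup>2 * (\<integral>\<omega>. indicator A \<omega> * (norm (u k \<omega>))\<^sup>2 \<partial>M) + (\<beta> k)\<^sup>2 * \<sigma>\<^sup>2" .
qed

lemma u_square_integrable: "integrable M (\<lambda>\<omega>. (norm (u k \<omega>))\<^sup>2)"
proof (induction k)
  case (Suc k)
  have "space M \<in> sets (F k)" using sub[of k] by (metis sets.top subalgebra_def)
  then show ?case
    by (cases "k < N") (use u_step(1)[of "space M" k] Suc in \<open>auto simp: u_Suc not_less\<close>)
qed (simp add: u_def)

text \<open>
  If the discount outweighs the growth of the weights by the factor \<open>1 - \<beta> k\<close>, then the weighted squares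
  form an almost supermartingale with an additional dissipation. The dissipation gives summability,
  the almost supermartingale property gives boundedness.
\<close>
lemma weighted_filtered_noise:
  assumes w: "\<And>k. N \<le> k \<Longrightarrow> 0 < w k \<and> w (Suc k) * (\<rho> k)\<^sup>2 \<le> (1 - \<beta> k) * w k \<and> 0 \<le> \<beta> k"
    and sm: "summable (\<lambda>k. w (Suc k) * (\<beta> k)\<^sup>2)"
  shows "AE \<omega> in M. summable (\<lambda>k. \<beta> k * (w k * (norm (u k \<omega>))\<^sup>2))"
    and "AE \<omega> in M. \<exists>B. \<forall>k\<ge>N. w k * (norm (u k \<omega>))\<^sup>2 \<le> B"
proof -
  define X where "X k \<omega> = (if N \<le> k then w k * (norm (u k \<omega>))\<^sup>2 else 0)" for k \<omega>
  define s where "s k = (if N \<le> k then w (Suc k) * (\<beta> k)\<^sup>2 * \<sigma>\<^sup>2 else 0)" for k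
  have Xint: "integrable M (X k)" for k
    unfolding X_def[abs_def] using u_square_integrable by (cases "N \<le> k") auto
  have Xnn: "0 \<le> X k \<omega>" for k \<omega> using w[of k] by (simp add: X_def less_imp_le)
  have Xmeas: "X k \<in> borel_measurable (F k)" for k
    unfolding X_def[abs_def] using u_meas[of k] by (cases "N \<le> k") auto
  have snn: "0 \<le> s k" for k using w[of "Suc k"] by (simp add: s_def less_imp_le)
  have ssm: "summable s"
  proof -
    have "summable (\<lambda>k. w (Suc k) * (\<beta> k)\<^sup>2 * \<sigma>\<^sup>2)" by (intro summable_mult2 sm)
    moreover have "\<forall>\<^sub>F k in sequentially. s k = w (Suc k) * (\<beta> k)\<^sup>2 * \<sigma>\<^sup>2"
      unfolding eventually_sequentially by (auto simp: s_def)
    ultimately show ?thesis using summable_cong[of s] by simp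
  qed
  have X0: "X (Suc k) \<omega> = 0" if "k < N" for k \<omega> using that by (simp add: X_def u_Suc)
  have step': "(\<integral>\<omega>. indicator A \<omega> * X (Suc k) \<omega> \<partial>M) \<le> (1 - \<beta> k) * (\<integral>\<omega>. indicator A \<omega> * X k \<omega> \<partial>M) + s k"
    if A: "A \<in> sets (F k)" and k: "N \<le> k" for A k
  proof -
    have "(\<integral>\<omega>. indicator A \<omega> * X (Suc k) \<omega> \<partial>M) = w (Suc k) * (\<integral>\<omega>. indicator A \<omega> * (norm (u (Suc k) \<omega>))\<^sup>2 \<partial>M)"
      using k by (simp add: X_def mult.left_commute[of _ "w (Suc k)"])
    also have "\<dots> \<le> w (Suc k) * ((\<rho> k)\<^sup>2 * (\<integral>\<omega>. indicator A \<omega> * (norm (u k \<omega>))\<^sup>2 \<partial>M) + (\<beta> k)\<^sup>2 * \<sigma>\<^sup>2)"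
      using w[of "Suc k"] k by (intro mult_left_mono u_step[OF A k u_square_integrable]) auto
    also have "\<dots> = (w (Suc k) * (\<rho> k)\<^sup>2) * (\<integral>\<omega>. indicator A \<omega> * (norm (u k \<omega>))\<^sup>2 \<partial>M) + s k"
      using k by (simp add: s_def algebra_simps)
    also have "\<dots> \<le> ((1 - \<beta> k) * w k) * (\<integral>\<omega>. indicator A \<omega> * (norm (u k \<omega>))\<^sup>2 \<partial>M) + s k"
      using w[OF k] by (intro add_right_mono mult_right_mono integral_nonneg_AE) auto
    also have "\<dots> = (1 - \<beta> k) * (\<integral>\<omega>. indicator A \<omega> * X k \<omega> \<partial>M) + s k"
      using k by (simp add: X_def mult.left_commute[of _ "w k"])
    finally show ?thesis .
  qed
  have "AE \<omega> in M. \<exists>B. \<forall>k. X k \<omega> \<le> B"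
  proof (rule AE_bounded_almost_supermartingale[where F = F and X = X and s = s,
        OF sub mono Xmeas Xint Xnn _ ssm snn])
    fix k A assume A: "A \<in> sets (F k)"
    have nn: "0 \<le> (\<integral>\<omega>. indicator A \<omega> * X k \<omega> \<partial>M)" using Xnn by (intro integral_nonneg_AE) auto
    show "(\<integral>\<omega>. indicator A \<omega> * X (Suc k) \<omega> \<partial>M) \<le> (\<integral>\<omega>. indicator A \<omega> * X k \<omega> \<partial>M) + s k"
    proof (cases "N \<le> k")
      case True
      have "0 \<le> \<beta> k * (\<integral>\<omega>. indicator A \<omega> * X k \<omega> \<partial>M)" using nn w[OF True] by simp
      then show ?thesis using step'[OF A True] by (simp add: algebra_simps)
    qed (use nn snn[of k] X0 in auto)
  qed
  then show "AE \<omega> in M. \<exists>B. \<forall>k\<ge>N. w k * (norm (u k \<omega>))\<^sup>2 \<le> B"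
  proof eventually_elim
    case (elim \<omega>)
    then obtain B where "\<And>k. X k \<omega> \<le> B" by blast
    then have "\<forall>k\<ge>N. w k * (norm (u k \<omega>))\<^sup>2 \<le> B" unfolding X_def by (metis (full_types))
    then show ?case by blast
  qed
  have EX: "(\<integral>\<omega>. X (Suc k) \<omega> \<partial>M) \<le> (1 - \<beta> k) * (\<integral>\<omega>. X k \<omega> \<partial>M) + s k" if "N \<le> k" for k
  proof -
    have S: "space M \<in> sets (F k)" using sub[of k] by (metis sets.top subalgebra_def)
    have "(\<integral>\<omega>. indicator (space M) \<omega> * X j \<omega> \<partial>M) = (\<integral>\<omega>. X j \<omega> \<partial>M)" for j
      by (rule Bochner_Integration.integral_cong) auto
    then show ?thesis using step'[OF S that] by simp
  qed
  have "summable (\<lambda>k. \<beta> k * (\<integral>\<omega>. X k \<omega> \<partial>M))"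
  proof (rule quasi_decreasing(2)[OF _ ssm, where v = "\<lambda>k. \<integral>\<omega>. X k \<omega> \<partial>M" and m = 0])
    have "0 \<le> (\<integral>\<omega>. X k \<omega> \<partial>M)" for k using Xnn by simp
    then show "\<forall>\<^sub>F k in sequentially. 0 \<le> \<beta> k * (\<integral>\<omega>. X k \<omega> \<partial>M) \<and> 0 \<le> s k \<and>
      (\<integral>\<omega>. X (Suc k) \<omega> \<partial>M) + \<beta> k * (\<integral>\<omega>. X k \<omega> \<partial>M) \<le> (\<integral>\<omega>. X k \<omega> \<partial>M) + s k \<and> 0 \<le> (\<integral>\<omega>. X k \<omega> \<partial>M)"
      using EX snn w unfolding eventually_sequentially
      by (intro exI[of _ N]) (auto simp: algebra_simps)
  qed
  then have sm2: "summable (\<lambda>k. \<integral>\<omega>. (if N \<le> k then \<beta> k * X k \<omega> else 0) \<partial>M)"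
  proof (rule summable_cong[THEN iffD1, rotated])
    show "\<forall>\<^sub>F k in sequentially. \<beta> k * (\<integral>\<omega>. X k \<omega> \<partial>M) = (\<integral>\<omega>. (if N \<le> k then \<beta> k * X k \<omega> else 0) \<partial>M)"
      unfolding eventually_sequentially by (intro exI[of _ N]) auto
  qed
  have "AE \<omega> in M. summable (\<lambda>k. if N \<le> k then \<beta> k * X k \<omega> else 0)"
  proof (rule AE_summable_of_integrals[OF _ _ sm2])
    show "integrable M (\<lambda>\<omega>. if N \<le> k then \<beta> k * X k \<omega> else 0)" for k
      using Xint by (cases "N \<le> k") auto
    show "0 \<le> (if N \<le> k then \<beta> k * X k \<omega> else 0)" for k \<omega> using Xnn w by simp
  qed
  then show "AE \<omega> in M. summable (\<lambda>k. \<beta> k * (w k * (norm (u k \<omega>))\<^sup>2))"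
  proof eventually_elim
    case (elim \<omega>)
    show ?case
      by (rule summable_cong[THEN iffD1, OF _ elim])
        (unfold eventually_sequentially, intro exI[of _ N], auto simp: X_def)
  qed
qed

end

end

section \<open>Weighted step sizes and convergence of one realization\<close>

text \<open>Convexity of \<open>\<lambda>t. t powr (- p)\<close> on the positive half line, in the form \<open>ln t \<le> t - 1\<close>.\<close>
lemma powr_neg_tangent:
  fixes x y p :: real
  assumes "0 < x" "0 < y" "0 \<le> p"
  shows "y powr (- p) - p * y powr (- p - 1) * (x - y) \<le> x powr (- p)"
proof -
  have "ln (x / y) \<le> x / y - 1" by (rule ln_le_minus_one) (use assms in simp)
  then have "1 - p * (x / y - 1) \<le> 1 + (- p) * ln (x / y)"
    using assms by (simp add: mult_left_mono)
  also have "\<dots> \<le> exp ((- p) * ln (x / y))" by (rule exp_ge_add_one_self)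
  also have "\<dots> = (x / y) powr (- p)" using assms by (simp add: powr_def)
  finally have "y powr (- p) * (1 - p * (x / y - 1)) \<le> y powr (- p) * (x / y) powr (- p)"
    by (rule mult_left_mono) simp
  also have "y powr (- p) * (x / y) powr (- p) = x powr (- p)"
    using assms by (simp flip: powr_mult)
  also have "y powr (- p) * (1 - p * (x / y - 1)) = y powr (- p) - p * (y powr (- p) / y) * (x - y)"
    using assms by (simp add: field_simps)
  also have "y powr (- p) / y = y powr (- p - 1)" using assms by (simp add: powr_diff)
  finally show ?thesis .
qed

locale step_sizes =
  fixes \<alpha> :: "nat \<Rightarrow> real"
  assumes \<alpha>_pos: "\<And>k. 1 \<le> k \<Longrightarrow> 0 < \<alpha> k" and \<alpha>_dec: "\<And>k. 1 \<le> k \<Longrightarrow> \<alpha> (Suc k) \<le> \<alpha> k"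
    and \<Delta>_top: "filterlim (step_sum \<alpha>) at_top sequentially"
begin

abbreviation \<Delta> :: "nat \<Rightarrow> real" where "\<Delta> \<equiv> step_sum \<alpha>"

lemma \<Delta>_Suc: "\<Delta> (Suc k) = \<Delta> k + \<alpha> (Suc k)"
  by (simp add: step_sum_def)

lemma \<alpha>_le_\<Delta>: "1 \<le> k \<Longrightarrow> \<alpha> k \<le> \<Delta> k"
  unfolding step_sum_def by (rule member_le_sum) (use \<alpha>_pos in \<open>auto intro: less_imp_le\<close>)

lemma \<Delta>_pos: "1 \<le> k \<Longrightarrow> 0 < \<Delta> k"
  using \<alpha>_le_\<Delta> \<alpha>_pos by fastforce

lemma \<Delta>_mono: "i \<le> j \<Longrightarrow> \<Delta> i \<le> \<Delta> j"
  unfolding step_sum_def by (rule sum_mono2) (use \<alpha>_pos in \<open>auto intro: less_imp_le\<close>)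

lemma \<Delta>_double: "1 \<le> k \<Longrightarrow> \<Delta> (Suc k) \<le> 2 * \<Delta> k"
  using \<alpha>_dec[of k] \<alpha>_le_\<Delta>[of k] by (simp add: \<Delta>_Suc)

lemma \<Delta>_ge: "\<forall>\<^sub>F k in sequentially. c \<le> \<Delta> k"
  using \<Delta>_top by (simp add: filterlim_at_top)

lemma not_summable_\<alpha>: "\<not> summable \<alpha>"
proof
  assume "summable \<alpha>"
  then have "(\<lambda>n. sum \<alpha> {..<n}) \<longlonglongrightarrow> suminf \<alpha>" by (rule summable_LIMSEQ)
  then have "(\<lambda>n. sum \<alpha> {..<Suc n} - \<alpha> 0) \<longlonglongrightarrow> suminf \<alpha> - \<alpha> 0"
    by (intro tendsto_diff tendsto_const) (rule LIMSEQ_Suc)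
  moreover have "sum \<alpha> {..<Suc n} - \<alpha> 0 = \<Delta> n" for n
    unfolding step_sum_def lessThan_Suc_atMost atMost_atLeast0
    by (simp add: sum.atLeast_Suc_atMost)
  ultimately have "\<Delta> \<longlonglongrightarrow> suminf \<alpha> - \<alpha> 0" by simp
  then show False
    using \<Delta>_top not_tendsto_and_filterlim_at_infinity[of sequentially \<Delta>]
      filterlim_at_top_imp_at_infinity by auto
qed

text \<open>The decrease of \<open>h\<close> between \<open>k\<close> and \<open>k + 1\<close> is compared with the term of index \<open>k + 1\<close>, because
  \<open>\<alpha> k\<close> is not bounded by a multiple of \<open>\<alpha> (k + 1)\<close>. The term of index \<open>k\<close> is added at the end.\<close>
lemma tail_le_of_decrease:
  assumes c: "0 < c"
    and ev: "\<forall>\<^sub>F k in sequentially. 0 \<le> h k \<and> 0 \<le> h' k \<and> c * (\<alpha> (Suc k) * h' (Suc k)) \<le> h k - h (Suc k) \<and> \<alpha> k * h' k \<le> Q * h k"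
  shows "summable (\<lambda>k. \<alpha> k * h' k)"
    and "\<exists>B>0. \<forall>\<^sub>F k in sequentially. tail (\<lambda>k. \<alpha> k * h' k) k \<le> B * h k"
proof -
  define t where "t k = \<alpha> k * h' k" for k
  have ev1: "\<forall>\<^sub>F k in sequentially. 0 \<le> t (Suc k) \<and> t (Suc k) \<le> h k / c - h (Suc k) / c \<and> 0 \<le> h k / c"
    using ev eventually_all_ge_at_top[OF ev]
  proof eventually_elim
    case (elim k)
    have "0 \<le> h' (Suc k)" using elim by auto
    then show ?case using elim c \<alpha>_pos[of "Suc k"] by (auto simp: t_def field_simps)
  qed
  have sm: "summable (\<lambda>k. t (Suc k))" by (rule telescope_summable(1)[OF ev1])
  then show S: "summable (\<lambda>k. \<alpha> k * h' k)" using summable_Suc_iff[of t] by (simp add: t_def[abs_def])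
  define B where "B = max Q 0 + 1 / c"
  have "\<forall>\<^sub>F k in sequentially. tail t k \<le> B * h k"
    using telescope_summable(2)[OF ev1] ev
  proof eventually_elim
    case (elim k)
    have "tail t k = t k + tail (\<lambda>k. t (Suc k)) k"
      using tail_unfold[of t k] S by (simp add: t_def[abs_def] tail_def)
    also have "\<dots> \<le> Q * h k + h k / c" using elim by (simp add: t_def)
    also have "\<dots> \<le> B * h k"
      using elim mult_right_mono[of Q "max Q 0" "h k"] by (simp add: B_def algebra_simps)
    finally show ?case .
  qed
  moreover have "0 < B" using c by (simp add: B_def add_nonneg_pos)
  ultimately show "\<exists>B>0. \<forall>\<^sub>F k in sequentially. tail (\<lambda>k. \<alpha> k * h' k) k \<le> B * h k"
    unfolding t_def[abs_def] by blast
qed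

lemma power_tail:
  assumes p: "1 < p"
  shows "summable (\<lambda>k. \<alpha> k * \<Delta> k powr (- p))"
    and "\<exists>B>0. \<forall>\<^sub>F k in sequentially. tail (\<lambda>k. \<alpha> k * \<Delta> k powr (- p)) k \<le> B * \<Delta> k powr (1 - p)"
proof -
  have ev: "\<forall>\<^sub>F k in sequentially. 0 \<le> \<Delta> k powr (1 - p) \<and> 0 \<le> \<Delta> k powr (- p) \<and>
     (p - 1) * (\<alpha> (Suc k) * \<Delta> (Suc k) powr (- p)) \<le> \<Delta> k powr (1 - p) - \<Delta> (Suc k) powr (1 - p) \<and>
     \<alpha> k * \<Delta> k powr (- p) \<le> 1 * \<Delta> k powr (1 - p)"
    using eventually_ge_at_top[of 1]
  proof eventually_elim
    case (elim k)
    have "\<alpha> k * \<Delta> k powr (- p) \<le> \<Delta> k * \<Delta> k powr (- p)"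
      using \<alpha>_le_\<Delta>[OF elim] by (intro mult_right_mono) auto
    also have "\<dots> = \<Delta> k powr (1 - p)" using \<Delta>_pos[OF elim] by (simp add: powr_mult_base)
    finally have 1: "\<alpha> k * \<Delta> k powr (- p) \<le> \<Delta> k powr (1 - p)" .
    have "\<Delta> (Suc k) powr (- (p - 1)) - (p - 1) * \<Delta> (Suc k) powr (- (p - 1) - 1) * (\<Delta> k - \<Delta> (Suc k))
        \<le> \<Delta> k powr (- (p - 1))"
      by (rule powr_neg_tangent) (use \<Delta>_pos elim p in auto)
    then show ?case using 1 by (simp add: \<Delta>_Suc algebra_simps)
  qed
  show "summable (\<lambda>k. \<alpha> k * \<Delta> k powr (- p))"
    by (rule tail_le_of_decrease(1)[OF _ ev]) (use p in simp)
  show "\<exists>B>0. \<forall>\<^sub>F k in sequentially. tail (\<lambda>k. \<alpha> k * \<Delta> k powr (- p)) k \<le> B * \<Delta> k powr (1 - p)"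
    by (rule tail_le_of_decrease(2)[OF _ ev]) (use p in simp)
qed

end

text \<open>The weights \<open>G\<close> measure the accuracy of the noise bounds. They grow at most exponentially in the time
  \<open>\<Delta>\<close>, with speed \<open>K\<close>, and at least like the power \<open>q > 1/2\<close>; the latter decides about convergence.\<close>
locale weighted_steps = step_sizes +
  fixes G :: "nat \<Rightarrow> real" and K q :: real
  assumes K_nn: "0 \<le> K" and q: "1/2 < q"
    and G_growth: "\<forall>\<^sub>F k in sequentially. 0 < G k \<and> G k \<le> G (Suc k) \<and> G (Suc k) \<le> exp (K * \<alpha> k) * G k"
    and G_ge: "\<forall>\<^sub>F k in sequentially. \<Delta> k powr q \<le> G k"
    and \<alpha>G_sum: "summable (\<lambda>k. (\<alpha> k)\<^sup>2 * (G k)\<^sup>2)"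
begin

lemma G_ge_1: "\<forall>\<^sub>F k in sequentially. 1 \<le> G k"
  using G_ge \<Delta>_ge[of 1]
proof eventually_elim
  case (elim k)
  then show ?case using ge_one_powr_ge_zero[of "\<Delta> k" q] q by linarith
qed

lemma \<alpha>_null: "\<alpha> \<longlonglongrightarrow> 0"
proof -
  have "\<forall>\<^sub>F k in sequentially. norm ((\<alpha> k)\<^sup>2) \<le> (\<alpha> k)\<^sup>2 * (G k)\<^sup>2"
    using G_ge_1
  proof eventually_elim
    case (elim k)
    then have "(\<alpha> k)\<^sup>2 * 1 \<le> (\<alpha> k)\<^sup>2 * (G k)\<^sup>2" by (intro mult_left_mono) auto
    then show ?case by simp
  qed
  then have "summable (\<lambda>k. (\<alpha> k)\<^sup>2)" by (rule summable_comparison_test_ev) (rule \<alpha>G_sum)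
  then show ?thesis using null_of_square_null summable_LIMSEQ_zero by blast
qed

lemma \<alpha>_small: "0 < \<epsilon> \<Longrightarrow> \<forall>\<^sub>F k in sequentially. 0 < \<alpha> k \<and> \<alpha> k < \<epsilon>"
proof -
  assume "0 < \<epsilon>"
  moreover have "\<forall>\<^sub>F k in sequentially. 0 < \<alpha> k"
    using eventually_ge_at_top[of 1] by eventually_elim (rule \<alpha>_pos)
  ultimately show ?thesis using order_tendstoD(2)[OF \<alpha>_null] by (simp add: eventually_conj)
qed

lemma G_mono: "\<forall>\<^sub>F k in sequentially. 0 < G k \<and> (\<forall>j\<ge>k. G k \<le> G j)"
proof -
  obtain N where N: "\<And>k. N \<le> k \<Longrightarrow> 0 < G k \<and> G k \<le> G (Suc k)"
    using G_growth unfolding eventually_sequentially by blast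
  have "G k \<le> G j" if "N \<le> k" "k \<le> j" for k j
    using that(2) by (induction j rule: dec_induct) (use N that(1) in \<open>auto intro: order_trans\<close>)
  then show ?thesis using N unfolding eventually_sequentially by blast
qed

text \<open>The weights increase, so the smallest one can be pulled out of the tail.\<close>
lemma weighted_tail:
  assumes s: "\<forall>\<^sub>F k in sequentially. 0 \<le> s k" and sm: "summable s" and Gs: "summable (\<lambda>k. (G k)\<^sup>2 * s k)"
  shows "\<forall>\<^sub>F k in sequentially. (G k)\<^sup>2 * tail s k \<le> 1"
proof -
  have "\<forall>\<^sub>F k in sequentially. tail (\<lambda>k. (G k)\<^sup>2 * s k) k < 1"
    by (rule order_tendstoD(2)[OF tail_tendsto_0[OF Gs] zero_less_one])
  then show ?thesis using G_mono eventually_all_ge_at_top[OF s]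
  proof eventually_elim
    case (elim k)
    have "(G k)\<^sup>2 * tail s k = tail (\<lambda>i. (G k)\<^sup>2 * s i) k" by (rule tail_cmult[OF sm, symmetric])
    also have "\<dots> \<le> tail (\<lambda>i. (G i)\<^sup>2 * s i) k"
      using elim by (intro tail_mono summable_mult sm Gs mult_right_mono power_mono) auto
    finally show ?case using elim by simp
  qed
qed

end

text \<open>
  One realization of the method, as far as the deterministic analysis needs it: \<open>x\<close> is recovered from the
  corrected iterates, and the noise satisfies the weighted bounds.
\<close>
locale sgdm_path = weighted_steps \<alpha> G K q + corrected_momentum f L z d u e "\<lambda>k. \<alpha> k / (1 - lam)" lam \<gamma> \<kappa>
  for \<alpha> G K q f L and z d u e :: "nat \<Rightarrow> 'a::euclidean_space" and lam \<gamma> \<kappa> +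
  fixes x :: "nat \<Rightarrow> 'a" and c0 :: real
  assumes x_eq: "\<forall>\<^sub>F k in sequentially. x k = z k - c0 *\<^sub>R d k - u k"
    and uG_sum: "summable (\<lambda>k. \<alpha> k / (1 - lam) * ((G k)\<^sup>2 * (norm (u k))\<^sup>2))"
    and eG_sum: "summable (\<lambda>k. (\<alpha> k / (1 - lam))\<^sup>2 * (G k)\<^sup>2 * (norm (e k))\<^sup>2)"
    and uG_bounded: "\<exists>B. \<forall>\<^sub>F k in sequentially. (G k)\<^sup>2 * (norm (u k))\<^sup>2 \<le> B"
begin

abbreviation \<beta> :: "nat \<Rightarrow> real" where "\<beta> k \<equiv> \<alpha> k / (1 - lam)"

sublocale D: dissipative_path f L z "\<lambda>k. norm (d k)" "\<lambda>k. norm (u k)" s \<beta> "(1 - lam) / 2" "drift_const + growth_const"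
  by (rule dissipative)

lemma \<alpha>_le_\<beta>: "1 \<le> k \<Longrightarrow> \<alpha> k \<le> \<beta> k"
  using \<alpha>_pos[of k] lam by (simp add: field_simps)

lemma \<beta>_summableI: "summable (\<lambda>k. \<alpha> k * h k) \<Longrightarrow> summable (\<lambda>k. \<beta> k * h k)"
  using summable_mult[of "\<lambda>k. \<alpha> k * h k" "1 / (1 - lam)"] by simp

lemma \<beta>_tail: "summable (\<lambda>k. \<alpha> k * h k) \<Longrightarrow> tail (\<lambda>k. \<beta> k * h k) n = 1 / (1 - lam) * tail (\<lambda>k. \<alpha> k * h k) n"
  using tail_cmult[of "\<lambda>k. \<alpha> k * h k" "1 / (1 - lam)" n] by simp

lemma \<tau>_le: "\<forall>\<^sub>F k in sequentially. 0 < G k \<and> D.\<tau> k \<le> 1 / (G k)\<^sup>2"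
proof -
  have "summable (\<lambda>k. (2 * drift_const\<^sup>2 + 1) * (\<beta> k * ((G k)\<^sup>2 * (norm (u k))\<^sup>2)) + 2 * ((\<beta> k)\<^sup>2 * (G k)\<^sup>2 * (norm (e k))\<^sup>2))"
    by (intro summable_add summable_mult uG_sum eG_sum)
  then have "summable (\<lambda>k. (G k)\<^sup>2 * s k)" by (simp add: s_def algebra_simps)
  from weighted_tail[OF D.s_nn D.s_sum this] G_mono show ?thesis
  proof eventually_elim
    case (elim k)
    then show ?case by (simp add: field_simps)
  qed
qed

lemma inverse_G_le: "\<forall>\<^sub>F k in sequentially. 0 < G k \<and> 0 < \<Delta> k \<and> 1 / G k \<le> \<Delta> k powr (- q) \<and> 1 / (G k)\<^sup>2 \<le> \<Delta> k powr (- (2 * q))"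
  using G_ge \<Delta>_ge[of 1] G_mono
proof eventually_elim
  case (elim k)
  have 1: "1 / G k \<le> 1 / \<Delta> k powr q" using elim by (intro divide_left_mono) auto
  have "1 / (G k)\<^sup>2 = (1 / G k)\<^sup>2" by (simp add: power_divide)
  also have "\<dots> \<le> (1 / \<Delta> k powr q)\<^sup>2" using 1 elim by (intro power_mono) auto
  also have "\<dots> = \<Delta> k powr (- (2 * q))" by (simp add: powr_squared powr_minus_divide power_divide)
  finally show ?case using 1 elim by (simp add: powr_minus_divide)
qed

lemma u_null: "(\<lambda>k. norm (u k)) \<longlonglongrightarrow> 0"
proof -
  obtain B where B: "\<forall>\<^sub>F k in sequentially. (G k)\<^sup>2 * (norm (u k))\<^sup>2 \<le> B" using uG_bounded by blast
  have ev: "\<forall>\<^sub>F k in sequentially. (norm (u k))\<^sup>2 \<le> max B 0 * \<Delta> k powr (- (2 * q))"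
    using B inverse_G_le
  proof eventually_elim
    case (elim k)
    have "(norm (u k))\<^sup>2 \<le> B * (1 / (G k)\<^sup>2)" using elim by (simp add: field_simps)
    also have "\<dots> \<le> max B 0 * \<Delta> k powr (- (2 * q))" using elim by (intro mult_mono) auto
    finally show ?case .
  qed
  have "(\<lambda>k. \<Delta> k powr (- (2 * q))) \<longlonglongrightarrow> 0"
    by (rule tendsto_neg_powr[OF _ \<Delta>_top]) (use q in simp)
  then have "(\<lambda>k. max B 0 * \<Delta> k powr (- (2 * q))) \<longlonglongrightarrow> max B 0 * 0" by (intro tendsto_intros)
  then have "(\<lambda>k. (norm (u k))\<^sup>2) \<longlonglongrightarrow> 0"
    using Lim_null_comparison[of "\<lambda>k. (norm (u k))\<^sup>2" "\<lambda>k. max B 0 * \<Delta> k powr (- (2 * q))" sequentially] ev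
    by simp
  then show ?thesis by (rule null_of_square_null)
qed

lemma x_minus_z: "(\<lambda>k. norm (x k - z k)) \<longlonglongrightarrow> 0"
proof -
  have "(\<lambda>k. \<bar>c0\<bar> * norm (d k) + norm (u k)) \<longlonglongrightarrow> \<bar>c0\<bar> * 0 + 0"
    by (intro tendsto_add tendsto_mult tendsto_const D.d_null u_null)
  moreover have "\<forall>\<^sub>F k in sequentially. norm (x k - z k) \<le> \<bar>c0\<bar> * norm (d k) + norm (u k)"
    using x_eq
  proof eventually_elim
    case (elim k)
    have "x k - z k = - (c0 *\<^sub>R d k) - u k" using elim by simp
    then show ?case using norm_triangle_ineq4[of "- (c0 *\<^sub>R d k)" "u k"] by simp
  qed
  ultimately show ?thesis
    using Lim_null_comparison[of "\<lambda>k. norm (x k - z k)" "\<lambda>k. \<bar>c0\<bar> * norm (d k) + norm (u k)" sequentially]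
    by simp
qed

lemma summable_\<beta>_tail_powr:
  assumes "1 < 2 * q * \<theta>" "0 \<le> \<theta>"
  shows "summable (\<lambda>k. \<beta> k * D.\<tau> k powr \<theta>)"
    and "\<forall>\<^sub>F k in sequentially. tail (\<lambda>k. \<beta> k * D.\<tau> k powr \<theta>) k
        \<le> 1 / (1 - lam) * tail (\<lambda>k. \<alpha> k * \<Delta> k powr (- (2 * q * \<theta>))) k"
proof -
  have ev: "\<forall>\<^sub>F k in sequentially. 0 < \<beta> k \<and> \<beta> k * D.\<tau> k powr \<theta> \<le> \<beta> k * \<Delta> k powr (- (2 * q * \<theta>))"
    using \<tau>_le inverse_G_le D.\<beta>_pos D.\<tau>_nonneg
  proof eventually_elim
    case (elim k)
    have "D.\<tau> k powr \<theta> \<le> (\<Delta> k powr (- (2 * q))) powr \<theta>"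
      using elim assms by (intro powr_mono2) auto
    then have "D.\<tau> k powr \<theta> \<le> \<Delta> k powr (- (2 * q * \<theta>))" by (simp add: powr_powr)
    with \<open>0 < \<beta> k\<close> show ?case by (intro conjI mult_left_mono) auto
  qed
  note pt = power_tail(1)[OF assms(1)]
  show S: "summable (\<lambda>k. \<beta> k * D.\<tau> k powr \<theta>)"
  proof (rule summable_comparison_test_ev[OF _ \<beta>_summableI[OF pt]])
    show "\<forall>\<^sub>F k in sequentially. norm (\<beta> k * D.\<tau> k powr \<theta>) \<le> \<beta> k * \<Delta> k powr (- (2 * q * \<theta>))"
      using ev
    proof eventually_elim
      case (elim k)
      then have "0 \<le> \<beta> k * D.\<tau> k powr \<theta>" by (intro mult_nonneg_nonneg) auto
      then show ?case using elim by (simp only: real_norm_def abs_of_nonneg)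
    qed
  qed
  show "\<forall>\<^sub>F k in sequentially. tail (\<lambda>k. \<beta> k * D.\<tau> k powr \<theta>) k
        \<le> 1 / (1 - lam) * tail (\<lambda>k. \<alpha> k * \<Delta> k powr (- (2 * q * \<theta>))) k"
    using eventually_all_ge_at_top[OF ev]
  proof eventually_elim
    case (elim k)
    have "tail (\<lambda>k. \<beta> k * D.\<tau> k powr \<theta>) k \<le> tail (\<lambda>k. \<beta> k * \<Delta> k powr (- (2 * q * \<theta>))) k"
      using elim by (intro tail_mono S \<beta>_summableI[OF pt]) auto
    then show ?case by (simp only: \<beta>_tail[OF pt])
  qed
qed

text \<open>
  Only the weighted squares of \<open>u\<close> are summable. The first power is recovered by the inequality between
  arithmetic and geometric means, with a weight that divides the available decay so that both
  resulting tails are of order \<open>\<Delta> k powr (- \<phi>)\<close>. This is where the exponent \<open>q - 1/2\<close> of the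
  distance originates.
\<close>
lemma summable_\<beta>_u:
  assumes "0 \<le> \<phi>" "2 * \<phi> + 1 \<le> 2 * q" "1 < 2 * q - \<phi>"
  shows "summable (\<lambda>k. \<beta> k * norm (u k))"
    and "\<exists>B>0. \<forall>\<^sub>F k in sequentially. tail (\<lambda>k. \<beta> k * norm (u k)) k \<le> B * \<Delta> k powr (- \<phi>)"
proof -
  define t where "t k = \<beta> k * ((G k)\<^sup>2 * (norm (u k))\<^sup>2)" for k
  define p where "p = 2 * q - \<phi>"
  note pt = power_tail[OF assms(3), folded p_def]
  have ev: "\<forall>\<^sub>F k in sequentially. 0 < \<beta> k \<and> 1 \<le> \<Delta> k \<and> 0 \<le> t k \<and>
      \<beta> k * norm (u k) \<le> \<Delta> k powr (- \<phi>) * t k + \<beta> k * \<Delta> k powr (- p)"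
    using G_ge \<Delta>_ge[of 1] D.\<beta>_pos G_mono
  proof eventually_elim
    case (elim k)
    define X where "X = \<Delta> k powr (q - \<phi> / 2) * norm (u k)"
    define Y where "Y = \<Delta> k powr (- (q - \<phi> / 2))"
    have "\<Delta> k powr (q - \<phi> / 2) * \<Delta> k powr (- (q - \<phi> / 2)) = 1"
      using elim by (simp flip: powr_add)
    then have "norm (u k) = X * Y" by (simp add: X_def Y_def)
    also have "\<dots> \<le> X\<^sup>2 + Y\<^sup>2"
    proof -
      have "0 \<le> X * Y" using elim by (simp add: X_def Y_def)
      then show ?thesis using sum_squares_bound[of X Y] by simp
    qed
    also have "X\<^sup>2 = \<Delta> k powr (- \<phi>) * ((\<Delta> k powr q)\<^sup>2 * (norm (u k))\<^sup>2)"
    proof -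
      have "\<Delta> k powr (- \<phi>) * (\<Delta> k powr q)\<^sup>2 = (\<Delta> k powr (q - \<phi> / 2))\<^sup>2"
      proof -
        have "2 * (q - \<phi> / 2) = - \<phi> + 2 * q" by simp
        then show ?thesis by (simp only: powr_squared powr_add)
      qed
      then show ?thesis by (simp add: X_def power_mult_distrib)
    qed
    also have "\<dots> \<le> \<Delta> k powr (- \<phi>) * ((G k)\<^sup>2 * (norm (u k))\<^sup>2)"
      using elim by (intro mult_left_mono mult_right_mono power_mono) auto
    also have "Y\<^sup>2 = \<Delta> k powr (- p)" by (simp add: Y_def powr_squared p_def)
    finally have "norm (u k) \<le> \<Delta> k powr (- \<phi>) * ((G k)\<^sup>2 * (norm (u k))\<^sup>2) + \<Delta> k powr (- p)" by simp
    then have "\<beta> k * norm (u k) \<le> \<beta> k * (\<Delta> k powr (- \<phi>) * ((G k)\<^sup>2 * (norm (u k))\<^sup>2) + \<Delta> k powr (- p))"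
      using elim by (intro mult_left_mono) auto
    also have "\<dots> = \<Delta> k powr (- \<phi>) * t k + \<beta> k * \<Delta> k powr (- p)"
      unfolding t_def by (simp add: algebra_simps add_divide_distrib)
    finally have "\<beta> k * norm (u k) \<le> \<Delta> k powr (- \<phi>) * t k + \<beta> k * \<Delta> k powr (- p)" .
    moreover have "0 \<le> t k" unfolding t_def using elim by (intro mult_nonneg_nonneg) auto
    ultimately show ?case using elim by blast
  qed
  have ts: "summable t" unfolding t_def[abs_def] by (rule uG_sum)
  have S2: "summable (\<lambda>k. \<beta> k * \<Delta> k powr (- p))" by (rule \<beta>_summableI[OF pt(1)])
  show S: "summable (\<lambda>k. \<beta> k * norm (u k))"
  proof (rule summable_comparison_test_ev[OF _ summable_add[OF ts S2]])
    show "\<forall>\<^sub>F k in sequentially. norm (\<beta> k * norm (u k)) \<le> t k + \<beta> k * \<Delta> k powr (- p)"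
      using ev
    proof eventually_elim
      case (elim k)
      have "\<Delta> k powr (- \<phi>) \<le> 1" using powr_mono[of "- \<phi>" 0 "\<Delta> k"] elim assms(1) by simp
      then have "\<Delta> k powr (- \<phi>) * t k \<le> 1 * t k" using elim by (intro mult_right_mono) auto
      moreover have "0 \<le> \<beta> k * norm (u k)" using elim by (intro mult_nonneg_nonneg) auto
      ultimately show ?case using elim unfolding real_norm_def by linarith
    qed
  qed
  obtain B where B: "0 < B" "\<forall>\<^sub>F k in sequentially. tail (\<lambda>k. \<alpha> k * \<Delta> k powr (- p)) k \<le> B * \<Delta> k powr (1 - p)"
    using pt(2) by blast
  have tt: "\<forall>\<^sub>F k in sequentially. tail t k < 1"
    by (rule order_tendstoD(2)[OF tail_tendsto_0[OF ts] zero_less_one])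
  have "\<forall>\<^sub>F k in sequentially. tail (\<lambda>k. \<beta> k * norm (u k)) k \<le> (1 + B / (1 - lam)) * \<Delta> k powr (- \<phi>)"
    using eventually_all_ge_at_top[OF ev] B(2) tt
  proof eventually_elim
    case (elim k)
    have D1: "1 \<le> \<Delta> k" using elim by auto
    have "\<beta> j * norm (u j) \<le> \<Delta> k powr (- \<phi>) * t j + \<beta> j * \<Delta> j powr (- p)" if "k \<le> j" for j
    proof -
      have "\<Delta> j powr (- \<phi>) \<le> \<Delta> k powr (- \<phi>)"
        using D1 \<Delta>_mono[OF that] assms(1) by (intro powr_mono2') auto
      then have "\<Delta> j powr (- \<phi>) * t j \<le> \<Delta> k powr (- \<phi>) * t j"
        using elim that by (intro mult_right_mono) auto
      then show ?thesis using elim that by (smt (verit))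
    qed
    then have "tail (\<lambda>k. \<beta> k * norm (u k)) k \<le> tail (\<lambda>j. \<Delta> k powr (- \<phi>) * t j + \<beta> j * \<Delta> j powr (- p)) k"
      by (intro tail_mono S summable_add summable_mult ts S2)
    also have "\<dots> = \<Delta> k powr (- \<phi>) * tail t k + tail (\<lambda>j. \<beta> j * \<Delta> j powr (- p)) k"
      by (simp only: tail_add[OF summable_mult[OF ts] S2] tail_cmult[OF ts])
    also have "\<dots> \<le> \<Delta> k powr (- \<phi>) * 1 + 1 / (1 - lam) * (B * \<Delta> k powr (1 - p))"
      unfolding \<beta>_tail[OF pt(1)] using elim lam by (intro add_mono mult_left_mono) auto
    also have "\<dots> \<le> \<Delta> k powr (- \<phi>) * 1 + 1 / (1 - lam) * (B * \<Delta> k powr (- \<phi>))"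
      using D1 assms B(1) lam by (intro add_left_mono mult_left_mono powr_mono) (auto simp: p_def)
    finally show ?case by (simp add: algebra_simps)
  qed
  moreover have "0 < 1 + B / (1 - lam)" using B(1) lam by (intro add_pos_nonneg) auto
  ultimately show "\<exists>B>0. \<forall>\<^sub>F k in sequentially. tail (\<lambda>k. \<beta> k * norm (u k)) k \<le> B * \<Delta> k powr (- \<phi>)" by blast
qed

text \<open>
  A bounded subsequence has an accumulation point \<open>y\<close>, which is critical as the gradients vanish along
  \<open>z\<close>. The Lojasiewicz exponent at \<open>y\<close> is raised until \<open>2 * q * \<theta> > 1\<close>, which makes the power \<open>\<theta>\<close> of the
  tails summable against \<open>\<beta>\<close>; this is possible below one since \<open>2 * q > 1\<close>.
\<close>
proposition convergence:
  assumes loj: "lojasiewicz_on_crit f" and bdd_sub: "\<exists>B. \<exists>\<^sub>F k in sequentially. norm (x k) \<le> B"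
  shows "\<exists>y\<in>crit f. x \<longlonglongrightarrow> y"
proof -
  obtain B where "\<exists>\<^sub>F k in sequentially. norm (x k) \<le> B" using bdd_sub by blast
  then have "infinite {k. norm (x k) \<le> B}"
    by (simp add: frequently_cofinite flip: cofinite_eq_sequentially)
  then obtain h :: "nat \<Rightarrow> nat" where h: "strict_mono h" "\<And>n. norm (x (h n)) \<le> B"
    using infinite_enumerate by blast
  then have "\<forall>n. (x \<circ> h) n \<in> cball 0 B" by simp
  then obtain y h' where h': "strict_mono h'" "(x \<circ> h \<circ> h') \<longlonglongrightarrow> y"
    using compact_cball[of "0::'a" B] unfolding compact_def by meson
  define g where "g = h \<circ> h'"
  have g: "strict_mono g" "(\<lambda>n. x (g n)) \<longlonglongrightarrow> y"
    using h h' by (auto simp: g_def strict_mono_def o_def)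
  have "(\<lambda>n. x (g n) - z (g n)) \<longlonglongrightarrow> 0"
    using LIMSEQ_subseq_LIMSEQ[OF tendsto_norm_zero_cancel[OF x_minus_z] g(1)] by (simp add: o_def)
  from tendsto_diff[OF g(2) this] have zg: "(\<lambda>n. z (g n)) \<longlonglongrightarrow> y" by simp
  have "(\<lambda>n. f (z (g n))) \<longlonglongrightarrow> f y"
    by (rule continuous_on_tendsto_compose[OF continuous_f zg]) auto
  moreover have "(\<lambda>n. f (z (g n))) \<longlonglongrightarrow> D.fstar"
    using LIMSEQ_subseq_LIMSEQ[OF D.f_tendsto g(1)] by (simp add: o_def)
  ultimately have y: "f y = D.fstar" using LIMSEQ_unique by blast
  have "(\<lambda>n. grad f (z (g n))) \<longlonglongrightarrow> grad f y"
    by (rule continuous_on_tendsto_compose[OF continuous_grad zg]) auto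
  moreover have "(\<lambda>n. grad f (z (g n))) \<longlonglongrightarrow> 0"
    using LIMSEQ_subseq_LIMSEQ[OF tendsto_norm_zero_cancel[OF D.a_null] g(1)] by (simp add: o_def)
  ultimately have crit: "y \<in> crit f" using LIMSEQ_unique by (auto simp: crit_def)
  then obtain \<theta>0 where th0: "lojasiewicz_exponent f y \<theta>0" using loj by (auto simp: lojasiewicz_on_crit_def)
  obtain C \<rho>0 where C: "0 < C" "0 < \<rho>0" "\<forall>w\<in>ball y \<rho>0. C * \<bar>f w - f y\<bar> powr \<theta>0 \<le> norm (grad f w)"
    using lojasiewicz_ball[OF th0 continuous_f] by blast
  define \<theta> where "\<theta> = max \<theta>0 ((1 + 2 * q) / (4 * q))"
  have th: "1/2 \<le> \<theta>" "\<theta> < 1" "\<theta>0 \<le> \<theta>"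
    using th0 q by (auto simp: \<theta>_def lojasiewicz_exponent_def field_simps)
  have "(1 + 2 * q) / (4 * q) \<le> \<theta>" by (simp add: \<theta>_def)
  then have q\<theta>: "1 < 2 * q * \<theta>" using q by (simp add: field_simps)
  obtain \<rho> where \<rho>: "0 < \<rho>" "\<forall>w\<in>ball y \<rho>. C * \<bar>f w - f y\<bar> powr \<theta> \<le> norm (grad f w)"
    using lojasiewicz_ball_exponent_mono[OF continuous_f C(2,1) th(3) C(3)] by blast
  have "z \<longlonglongrightarrow> y"
  proof (rule D.convergence_to_accumulation_point(1)[OF C(1) th(1,2) y \<rho>])
    fix \<epsilon> :: real assume "0 < \<epsilon>"
    then have "\<forall>\<^sub>F n in sequentially. norm (z (g n) - y) < \<epsilon>"
      using tendstoD[OF zg] by (simp add: dist_norm)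
    then obtain n0 where n0: "\<And>n. n0 \<le> n \<Longrightarrow> norm (z (g n) - y) < \<epsilon>" unfolding eventually_sequentially by blast
    show "\<exists>\<^sub>F k in sequentially. norm (z k - y) < \<epsilon>"
      unfolding frequently_sequentially
    proof
      fix N
      have "N \<le> g (max n0 N)" using seq_suble[OF g(1), of "max n0 N"] by simp
      then show "\<exists>n\<ge>N. norm (z n - y) < \<epsilon>" using n0[of "max n0 N"] by auto
    qed
  next
    show "summable (\<lambda>k. \<beta> k * D.\<tau> k powr \<theta>)" by (rule summable_\<beta>_tail_powr(1)) (use q\<theta> th in auto)
    show "summable (\<lambda>k. \<beta> k * norm (u k))" by (rule summable_\<beta>_u(1)[of 0]) (use q in auto)
  qed
  from tendsto_add[OF this tendsto_norm_zero_cancel[OF x_minus_z]] have "x \<longlonglongrightarrow> y" by simp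
  then show ?thesis using crit by blast
qed

end

section \<open>Rates along one realization\<close>

context sgdm_path
begin

text \<open>The difference of \<open>x\<close> and \<open>z\<close> is a combination of \<open>d\<close> and \<open>u\<close>, whose squares are of order \<open>b\<close>.
  Therefore a first-order expansion at \<open>z k\<close> preserves the rates of the values and of the squared
  gradients.\<close>
lemma transfer_value_rate:
  assumes y: "f y = D.fstar"
    and M: "0 < M" "\<forall>\<^sub>F k in sequentially. D.V k \<le> M * b k"
    and b: "\<forall>\<^sub>F k in sequentially. 0 < b k \<and> b k \<le> (1 + n * \<beta> k) * b (Suc k)"
    and G: "\<forall>\<^sub>F k in sequentially. 1 / (G k)\<^sup>2 \<le> b k"
  shows "\<exists>B>0. \<forall>\<^sub>F k in sequentially. (norm (d k))\<^sup>2 \<le> B * b k \<and> (norm (u k))\<^sup>2 \<le> B * b k \<and>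
     max \<bar>f (x k) - f y\<bar> ((norm (grad f (x k)))\<^sup>2) \<le> B * b k"
proof -
  obtain B0 where B0: "\<forall>\<^sub>F k in sequentially. (G k)\<^sup>2 * (norm (u k))\<^sup>2 \<le> B0" using uG_bounded by blast
  define Q where "Q = max 1 B0"
  have Q: "1 \<le> Q" "B0 \<le> Q" by (auto simp: Q_def)
  have u: "\<forall>\<^sub>F k in sequentially. (norm (u k))\<^sup>2 \<le> Q * b k"
    using B0 G \<tau>_le
  proof eventually_elim
    case (elim k)
    have "(norm (u k))\<^sup>2 \<le> B0 * (1 / (G k)\<^sup>2)" using elim by (simp add: field_simps)
    also have "\<dots> \<le> Q * b k" using elim Q by (intro mult_mono) auto
    finally show ?case .
  qed
  have \<tau>: "\<forall>\<^sub>F k in sequentially. D.\<tau> k \<le> Q * b k"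
    using \<tau>_le G b
  proof eventually_elim
    case (elim k)
    have "1 * b k \<le> Q * b k" using elim Q by (intro mult_right_mono) auto
    then show ?case using elim by linarith
  qed
  obtain B where B: "0 < B" "\<forall>\<^sub>F k in sequentially. \<bar>f (z k) - D.fstar\<bar> \<le> B * b k \<and> (D.a k)\<^sup>2 \<le> B * b k \<and> (norm (d k))\<^sup>2 \<le> B * b k"
    using D.stationarity_rate[OF M(2) b \<tau> u M(1)] by blast
  define E where "E = 2 * (c0\<^sup>2 * B + Q)"
  define R where "R = max (B + Q) (max (2 * B + (1 + L) * E) (2 * B + 2 * L\<^sup>2 * E))"
  have E: "0 \<le> E" using B Q by (simp add: E_def)
  have R: "B + Q \<le> R" "2 * B + (1 + L) * E \<le> R" "2 * B + 2 * L\<^sup>2 * E \<le> R" by (auto simp: R_def)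
  have "\<forall>\<^sub>F k in sequentially. (norm (d k))\<^sup>2 \<le> R * b k \<and> (norm (u k))\<^sup>2 \<le> R * b k \<and>
     max \<bar>f (x k) - f y\<bar> ((norm (grad f (x k)))\<^sup>2) \<le> R * b k"
    using B(2) u b x_eq
  proof eventually_elim
    case (elim k)
    have sc: "t \<le> R \<Longrightarrow> t * b k \<le> R * b k" for t using elim by (intro mult_right_mono) auto
    define h where "h = x k - z k"
    have "norm h \<le> \<bar>c0\<bar> * norm (d k) + norm (u k)"
      using elim norm_triangle_ineq4[of "- (c0 *\<^sub>R d k)" "u k"] by (simp add: h_def)
    then have "(norm h)\<^sup>2 \<le> (\<bar>c0\<bar> * norm (d k) + norm (u k))\<^sup>2" by (rule power_mono) simp
    also have "\<dots> \<le> 2 * (c0\<^sup>2 * (norm (d k))\<^sup>2 + (norm (u k))\<^sup>2)"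
      using square_sum_le2[of "\<bar>c0\<bar> * norm (d k)" "norm (u k)"] by (simp add: power_mult_distrib)
    also have "\<dots> \<le> 2 * (c0\<^sup>2 * (B * b k) + Q * b k)"
      using elim by (intro mult_left_mono add_mono) auto
    finally have h: "(norm h)\<^sup>2 \<le> E * b k" by (simp add: E_def algebra_simps)
    have "\<bar>grad f (z k) \<bullet> h\<bar> \<le> D.a k * norm h" by (rule Cauchy_Schwarz_ineq2)
    also have "\<dots> \<le> (D.a k)\<^sup>2 + (norm h)\<^sup>2"
    proof -
      have "0 \<le> D.a k * norm h" by simp
      then show ?thesis using sum_squares_bound[of "D.a k" "norm h"] unfolding mult.assoc by linarith
    qed
    finally have gh: "\<bar>grad f (z k) \<bullet> h\<bar> \<le> B * b k + E * b k" using elim h by linarith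
    have "\<bar>f (x k) - f (z k) - grad f (z k) \<bullet> h\<bar> \<le> L * (E * b k)"
      using first_order_expansion[of "x k" "z k"] mult_left_mono[OF h, of L] L_pos
      unfolding h_def by linarith
    then have "\<bar>f (x k) - f y\<bar> \<le> B * b k + (B * b k + E * b k) + L * (E * b k)"
      using gh elim y by linarith
    also have "\<dots> = (2 * B + (1 + L) * E) * b k" by (simp add: algebra_simps)
    finally have 1: "\<bar>f (x k) - f y\<bar> \<le> R * b k" using sc[OF R(2)] by linarith
    have "norm (grad f (x k)) \<le> D.a k + L * norm h"
      using grad_diff_le[of "x k" "z k"] norm_triangle_ineq[of "grad f (z k)" "grad f (x k) - grad f (z k)"]
      by (simp add: h_def)
    then have "(norm (grad f (x k)))\<^sup>2 \<le> (D.a k + L * norm h)\<^sup>2" by (rule power_mono) simp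
    also have "\<dots> \<le> 2 * ((D.a k)\<^sup>2 + L\<^sup>2 * (norm h)\<^sup>2)"
      using square_sum_le2[of "D.a k" "L * norm h"] by (simp add: power_mult_distrib)
    also have "\<dots> \<le> 2 * (B * b k + L\<^sup>2 * (E * b k))"
      using elim h by (intro mult_left_mono add_mono) auto
    also have "\<dots> = (2 * B + 2 * L\<^sup>2 * E) * b k" by (simp add: algebra_simps)
    finally have 2: "(norm (grad f (x k)))\<^sup>2 \<le> R * b k" using sc[OF R(3)] by linarith
    have "(norm (d k))\<^sup>2 \<le> R * b k" "(norm (u k))\<^sup>2 \<le> R * b k"
      using elim sc[of B] sc[of Q] R(1) B(1) Q by (smt (verit))+
    then show ?case using 1 2 by simp
  qed
  moreover have "0 < R" using R(1) B Q by linarith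
  ultimately show ?thesis by blast
qed

lemma transfer_distance_rate:
  assumes z: "\<exists>B. \<forall>\<^sub>F k in sequentially. norm (z k - y) \<le> B * h k"
    and du: "\<exists>B. \<forall>\<^sub>F k in sequentially. (norm (d k))\<^sup>2 \<le> B * (h k)\<^sup>2 \<and> (norm (u k))\<^sup>2 \<le> B * (h k)\<^sup>2"
    and h: "\<forall>\<^sub>F k in sequentially. 0 \<le> h k"
  shows "(\<lambda>k. norm (x k - y)) \<in> O(h)"
proof -
  obtain B1 where B1: "\<forall>\<^sub>F k in sequentially. norm (z k - y) \<le> B1 * h k" using z by blast
  obtain B2 where B2: "\<forall>\<^sub>F k in sequentially. (norm (d k))\<^sup>2 \<le> B2 * (h k)\<^sup>2 \<and> (norm (u k))\<^sup>2 \<le> B2 * (h k)\<^sup>2"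
    using du by blast
  define S where "S = sqrt \<bar>B2\<bar>"
  show ?thesis
  proof (rule bigoI[of _ "B1 + (\<bar>c0\<bar> + 1) * S"])
    show "\<forall>\<^sub>F k in sequentially. norm (norm (x k - y)) \<le> (B1 + (\<bar>c0\<bar> + 1) * S) * norm (h k)"
      using B1 B2 h x_eq
    proof eventually_elim
      case (elim k)
      have rt: "t \<le> S * h k" if "t\<^sup>2 \<le> B2 * (h k)\<^sup>2" for t
      proof (rule power2_le_imp_le)
        have "B2 * (h k)\<^sup>2 \<le> \<bar>B2\<bar> * (h k)\<^sup>2" by (intro mult_right_mono) auto
        then show "t\<^sup>2 \<le> (S * h k)\<^sup>2" using that by (simp add: S_def power_mult_distrib)
        show "0 \<le> S * h k" using elim by (simp add: S_def)
      qed
      have "x k - y = (z k - y) + (- (c0 *\<^sub>R d k) - u k)" using elim by simp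
      then have "norm (x k - y) \<le> norm (z k - y) + norm (- (c0 *\<^sub>R d k) - u k)"
        by (metis norm_triangle_ineq)
      also have "\<dots> \<le> norm (z k - y) + (\<bar>c0\<bar> * norm (d k) + norm (u k))"
        using norm_triangle_ineq4[of "- (c0 *\<^sub>R d k)" "u k"] by simp
      also have "\<dots> \<le> B1 * h k + (\<bar>c0\<bar> * (S * h k) + S * h k)"
        using elim rt by (intro add_mono mult_left_mono) auto
      also have "\<dots> = (B1 + (\<bar>c0\<bar> + 1) * S) * norm (h k)"
        using \<open>0 \<le> h k\<close> by (simp add: algebra_simps)
      finally show ?case by simp
    qed
  qed
qed

text \<open>
  For an exponent \<open>\<theta>\<close> above one half, \<open>\<psi> = 1 / (2 * \<theta> - 1)\<close> solves \<open>2 * \<theta> * \<psi> = \<psi> + 1\<close>, so that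
  \<open>\<Delta> powr (- \<psi>)\<close> decays like the solutions of \<open>V' = - V powr (2 * \<theta>)\<close>. The condition
  \<open>\<psi> \<le> 2 * q\<close> says that the noise is not slower. All three contributions to the distance are then of
  order \<open>\<Delta> powr (- \<phi>)\<close> with \<open>\<phi> = \<psi> * (1 - \<theta>) = (\<psi> - 1) / 2\<close>.
\<close>
proposition polynomial_rate:
  assumes lim: "x \<longlonglongrightarrow> y" and loj: "lojasiewicz_exponent f y \<theta>0"
    and th: "\<theta>0 \<le> \<theta>" "1/2 < \<theta>" "\<theta> < 1" and \<psi>: "\<psi> = 1 / (2 * \<theta> - 1)" "\<psi> \<le> 2 * q"
  shows "(\<lambda>k. norm (x k - y)) \<in> O(\<lambda>k. \<Delta> k powr (- ((\<psi> - 1) / 2)))"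
    and "(\<lambda>k. max \<bar>f (x k) - f y\<bar> ((norm (grad f (x k)))\<^sup>2)) \<in> O(\<lambda>k. \<Delta> k powr (- \<psi>))"
proof -
  define \<phi> where "\<phi> = (\<psi> - 1) / 2"
  have \<psi>1: "1 < \<psi>" using th by (simp add: \<psi> field_simps)
  have \<phi>: "0 < \<phi>" "2 * \<phi> + 1 = \<psi>" using \<psi>1 by (auto simp: \<phi>_def field_simps)
  have \<theta>\<psi>: "2 * \<theta> * \<psi> = \<psi> + 1" "\<psi> * (1 - \<theta>) = \<phi>" "\<psi> * \<theta> = \<phi> + 1" "2 * \<theta> - 1 = 1 / \<psi>"
    using th by (auto simp: \<phi>_def \<psi> field_simps)
  have q\<theta>: "\<phi> + 1 \<le> 2 * q * \<theta>" using \<theta>\<psi>(3) \<psi>(2) th mult_right_mono[of \<psi> "2 * q" \<theta>] by simp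
  obtain C \<rho>0 where C: "0 < C" "0 < \<rho>0" "\<forall>w\<in>ball y \<rho>0. C * \<bar>f w - f y\<bar> powr \<theta>0 \<le> norm (grad f w)"
    using lojasiewicz_ball[OF loj continuous_f] by blast
  obtain \<rho> where \<rho>: "0 < \<rho>" "\<forall>w\<in>ball y \<rho>. C * \<bar>f w - f y\<bar> powr \<theta> \<le> norm (grad f w)"
    using lojasiewicz_ball_exponent_mono[OF continuous_f C(2,1) th(1) C(3)] by blast
  from tendsto_diff[OF lim tendsto_norm_zero_cancel[OF x_minus_z]] have zlim: "z \<longlonglongrightarrow> y" by simp
  have y: "f y = D.fstar"
    using LIMSEQ_unique[OF continuous_on_tendsto_compose[OF continuous_f zlim] D.f_tendsto] by auto
  have th': "1/2 \<le> \<theta>" using th by simp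
  define b where "b k = \<Delta> k powr (- \<psi>)" for k
  have bdiff: "\<forall>\<^sub>F k in sequentially. 1 \<le> \<Delta> k \<and> 0 < b k \<and> 0 < \<beta> k \<and>
      b k - b (Suc k) \<le> \<psi> * \<beta> k * \<Delta> k powr (- \<psi> - 1) \<and> \<Delta> (Suc k) \<le> 2 * \<Delta> k"
    using \<Delta>_ge[of 1] eventually_ge_at_top[of 1] D.\<beta>_pos
  proof eventually_elim
    case (elim k)
    have "b k - \<psi> * \<Delta> k powr (- \<psi> - 1) * (\<Delta> (Suc k) - \<Delta> k) \<le> b (Suc k)"
      unfolding b_def by (rule powr_neg_tangent) (use \<Delta>_pos elim \<psi>1 in auto)
    moreover have "\<psi> * \<Delta> k powr (- \<psi> - 1) * (\<Delta> (Suc k) - \<Delta> k) \<le> \<psi> * \<Delta> k powr (- \<psi> - 1) * \<beta> k"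
      using \<alpha>_dec[of k] \<alpha>_le_\<beta>[of k] elim \<psi>1 by (intro mult_left_mono) (auto simp: \<Delta>_Suc)
    ultimately have "b k - b (Suc k) \<le> \<psi> * \<beta> k * \<Delta> k powr (- \<psi> - 1)"
      by (simp add: algebra_simps)
    then show ?case using elim \<Delta>_double[of k] by (simp add: b_def)
  qed
  have bSuc: "\<forall>\<^sub>F k in sequentially. b k \<le> 2 powr \<psi> * b (Suc k)"
    using bdiff
  proof eventually_elim
    case (elim k)
    have "(2 * \<Delta> k) powr (- \<psi>) \<le> \<Delta> (Suc k) powr (- \<psi>)"
      using elim \<Delta>_pos[of "Suc k"] \<psi>1 by (intro powr_mono2') auto
    then have "2 powr \<psi> * (2 powr (- \<psi>) * b k) \<le> 2 powr \<psi> * b (Suc k)"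
      using elim by (simp add: b_def powr_mult)
    moreover have "2 powr \<psi> * (2 powr (- \<psi>) * b k) = b k"
      by (simp add: powr_minus)
    ultimately show ?case by simp
  qed
  have Gb: "\<forall>\<^sub>F k in sequentially. 1 / (G k)\<^sup>2 \<le> b k"
    using inverse_G_le bdiff
  proof eventually_elim
    case (elim k)
    have "\<Delta> k powr (- (2 * q)) \<le> \<Delta> k powr (- \<psi>)" using elim \<psi> by (intro powr_mono) auto
    then show ?case using elim by (simp add: b_def)
  qed
  \<comment> \<open>As \<open>2 * \<theta> - 1 = 1 / \<psi>\<close> is positive, the superlinear dissipation of a large multiple \<open>M * b\<close>
    absorbs the constants lost between \<open>\<Delta> k\<close> and \<open>\<Delta> (Suc k)\<close>.\<close>
  define M0 where "M0 = max 1 ((64 * \<psi> * 2 powr (\<psi> + 1) / C\<^sup>2) powr \<psi>)"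
  have M0: "64 * \<psi> * 2 powr (\<psi> + 1) / C\<^sup>2 \<le> M powr (2 * \<theta> - 1)" "0 < M" if "M0 \<le> M" for M
  proof -
    define X where "X = 64 * \<psi> * 2 powr (\<psi> + 1) / C\<^sup>2"
    have X: "0 < X" using C \<psi>1 by (simp add: X_def)
    have M: "X powr \<psi> \<le> M" "1 \<le> M" using that by (auto simp: M0_def X_def)
    have "X = (X powr \<psi>) powr (2 * \<theta> - 1)" using X \<psi>1 by (simp add: powr_powr \<theta>\<psi>(4))
    also have "\<dots> \<le> M powr (2 * \<theta> - 1)" using M th by (intro powr_mono2) auto
    finally show "64 * \<psi> * 2 powr (\<psi> + 1) / C\<^sup>2 \<le> M powr (2 * \<theta> - 1)" by (simp add: X_def)
    show "0 < M" using M by simp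
  qed
  have "\<forall>\<^sub>F k in sequentially. 0 < b k \<and> D.\<tau> k \<le> 2 powr \<psi> * b (Suc k) \<and>
       (\<forall>M\<ge>M0. M * b k - M * b (Suc k) \<le> C\<^sup>2 / 64 * \<beta> k * (M * b (Suc k)) powr (2 * \<theta>))"
    using bdiff bSuc Gb \<tau>_le
  proof eventually_elim
    case (elim k)
    have "M * b k - M * b (Suc k) \<le> C\<^sup>2 / 64 * \<beta> k * (M * b (Suc k)) powr (2 * \<theta>)" if M: "M0 \<le> M" for M
    proof -
      have Mp: "0 < M" using M0[OF M] by simp
      define Y where "Y = \<Delta> (Suc k) powr (- (\<psi> + 1))"
      have "(2 * \<Delta> k) powr (- (\<psi> + 1)) \<le> Y"
        unfolding Y_def using elim \<Delta>_pos[of "Suc k"] \<psi>1 by (intro powr_mono2') auto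
      then have "2 powr (\<psi> + 1) * (2 powr (- (\<psi> + 1)) * \<Delta> k powr (- (\<psi> + 1))) \<le> 2 powr (\<psi> + 1) * Y"
        using elim by (simp add: powr_mult)
      moreover have "2 powr (\<psi> + 1) * (2 powr (- (\<psi> + 1)) * \<Delta> k powr (- (\<psi> + 1))) = \<Delta> k powr (- \<psi> - 1)"
      proof -
        have "(2::real) powr (\<psi> + 1) * 2 powr (- (\<psi> + 1)) = 1" by (simp flip: powr_add)
        then show ?thesis by (simp only: mult.assoc[symmetric]) simp
      qed
      ultimately have Y: "\<Delta> k powr (- \<psi> - 1) \<le> 2 powr (\<psi> + 1) * Y" by linarith
      have "M * b k - M * b (Suc k) \<le> M * (\<psi> * \<beta> k * \<Delta> k powr (- \<psi> - 1))"
      proof -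
        have "M * (b k - b (Suc k)) \<le> M * (\<psi> * \<beta> k * \<Delta> k powr (- \<psi> - 1))"
          using elim Mp by (intro mult_left_mono) auto
        then show ?thesis by (simp only: right_diff_distrib)
      qed
      also have "\<dots> \<le> M * (\<psi> * \<beta> k * (2 powr (\<psi> + 1) * Y))"
        using Y elim Mp \<psi>1 by (intro mult_left_mono mult_nonneg_nonneg) auto
      also have "\<dots> = M * Y * \<beta> k * (C\<^sup>2 / 64) * (64 * \<psi> * 2 powr (\<psi> + 1) / C\<^sup>2)"
      proof -
        have "C\<^sup>2 / 64 * (64 * \<psi> * 2 powr (\<psi> + 1) / C\<^sup>2) = \<psi> * 2 powr (\<psi> + 1)" using C by simp
        then show ?thesis by (simp only: mult.assoc) (simp only: mult_ac)
      qed
      also have "\<dots> \<le> M * Y * \<beta> k * (C\<^sup>2 / 64) * M powr (2 * \<theta> - 1)"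
        using M0[OF M] elim Mp by (intro mult_left_mono mult_nonneg_nonneg) (auto simp: Y_def)
      also have "\<dots> = C\<^sup>2 / 64 * \<beta> k * ((M * M powr (2 * \<theta> - 1)) * Y)" by (simp add: algebra_simps)
      also have "M * M powr (2 * \<theta> - 1) = M powr (2 * \<theta>)" using Mp by (simp add: powr_mult_base)
      also have "M powr (2 * \<theta>) * Y = (M * b (Suc k)) powr (2 * \<theta>)"
      proof -
        have "- (\<psi> * (2 * \<theta>)) = - (\<psi> + 1)" using \<theta>\<psi>(1) by (simp add: algebra_simps)
        then have "b (Suc k) powr (2 * \<theta>) = Y" by (simp add: b_def powr_powr Y_def)
        then show ?thesis using Mp by (simp add: powr_mult b_def)
      qed
      finally show ?thesis .
    qed
    then show ?case using elim by (auto intro: order_trans)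
  qed
  from D.value_rate[OF C(1) th' th(3) zlim \<rho>(1) \<rho>(2) y this]
  obtain M where M: "0 < M" "\<forall>\<^sub>F k in sequentially. D.V k \<le> M * b k" by blast
  have "\<forall>\<^sub>F k in sequentially. 0 < b k \<and> b k \<le> (1 + \<psi> * 2 powr \<psi> * \<beta> k) * b (Suc k)"
    using bdiff bSuc
  proof eventually_elim
    case (elim k)
    have "\<Delta> k powr (- \<psi> - 1) \<le> b k" unfolding b_def using elim by (intro powr_mono) auto
    then have "\<psi> * \<beta> k * \<Delta> k powr (- \<psi> - 1) \<le> \<psi> * \<beta> k * (2 powr \<psi> * b (Suc k))"
      using elim \<psi>1 by (intro mult_left_mono mult_nonneg_nonneg) auto
    then have "b k - b (Suc k) \<le> \<psi> * \<beta> k * (2 powr \<psi> * b (Suc k))" using elim by linarith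
    then show ?case using elim by (simp add: algebra_simps)
  qed
  from transfer_value_rate[OF y M this Gb]
  obtain B where B: "0 < B" and Bv: "\<forall>\<^sub>F k in sequentially. (norm (d k))\<^sup>2 \<le> B * b k \<and> (norm (u k))\<^sup>2 \<le> B * b k \<and>
     max \<bar>f (x k) - f y\<bar> ((norm (grad f (x k)))\<^sup>2) \<le> B * b k" by blast
  show "(\<lambda>k. max \<bar>f (x k) - f y\<bar> ((norm (grad f (x k)))\<^sup>2)) \<in> O(\<lambda>k. \<Delta> k powr (- \<psi>))"
  proof (rule bigoI[of _ B])
    show "\<forall>\<^sub>F k in sequentially. norm (max \<bar>f (x k) - f y\<bar> ((norm (grad f (x k)))\<^sup>2)) \<le> B * norm (\<Delta> k powr (- \<psi>))"
      using Bv by eventually_elim (simp add: b_def)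
  qed
  note st = summable_\<beta>_tail_powr[of \<theta>]
  have q1: "1 < 2 * q * \<theta>" using q\<theta> \<phi> by linarith
  note su = summable_\<beta>_u[of \<phi>]
  have q2: "0 \<le> \<phi>" "2 * \<phi> + 1 \<le> 2 * q" "1 < 2 * q - \<phi>" using \<phi> \<psi> by auto
  have acc: "\<exists>\<^sub>F k in sequentially. norm (z k - y) < \<epsilon>" if "0 < \<epsilon>" for \<epsilon>
    using eventually_frequently[OF _ tendstoD[OF zlim that]] by (simp add: dist_norm)
  obtain B1 where B1: "0 < B1" "\<forall>\<^sub>F k in sequentially. norm (z k - y) \<le>
      B1 * (tail (\<lambda>k. \<beta> k * D.\<tau> k powr \<theta>) k + tail (\<lambda>k. \<beta> k * norm (u k)) k + D.V k powr (1 - \<theta>))"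
    using D.convergence_to_accumulation_point(2)[OF C(1) th' th(3) y \<rho> acc] st(1) su(1) q1 q2 th by auto
  obtain B2 where B2: "0 < B2" "\<forall>\<^sub>F k in sequentially. tail (\<lambda>k. \<alpha> k * \<Delta> k powr (- (2 * q * \<theta>))) k \<le> B2 * \<Delta> k powr (1 - 2 * q * \<theta>)"
    using power_tail(2)[OF q1] by blast
  obtain B3 where B3: "0 < B3" "\<forall>\<^sub>F k in sequentially. tail (\<lambda>k. \<beta> k * norm (u k)) k \<le> B3 * \<Delta> k powr (- \<phi>)"
    using su(2)[OF q2] by blast
  have st2: "\<forall>\<^sub>F k in sequentially. tail (\<lambda>k. \<beta> k * D.\<tau> k powr \<theta>) k
        \<le> 1 / (1 - lam) * tail (\<lambda>k. \<alpha> k * \<Delta> k powr (- (2 * q * \<theta>))) k"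
    using st(2) q1 th by simp
  define B4 where "B4 = B1 * (B2 / (1 - lam) + B3 + M powr (1 - \<theta>))"
  have zr: "\<forall>\<^sub>F k in sequentially. norm (z k - y) \<le> B4 * \<Delta> k powr (- \<phi>)"
    using B1(2) B2(2) B3(2) st2 M(2) bdiff D.V_mono
  proof eventually_elim
    case (elim k)
    have "1 / (1 - lam) * tail (\<lambda>k. \<alpha> k * \<Delta> k powr (- (2 * q * \<theta>))) k \<le> 1 / (1 - lam) * (B2 * \<Delta> k powr (1 - 2 * q * \<theta>))"
      using elim lam by (intro mult_left_mono) auto
    moreover have "1 / (1 - lam) * (B2 * \<Delta> k powr (1 - 2 * q * \<theta>)) \<le> 1 / (1 - lam) * (B2 * \<Delta> k powr (- \<phi>))"
      using elim lam B2 q\<theta> by (intro mult_left_mono powr_mono) auto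
    ultimately have 1: "tail (\<lambda>k. \<beta> k * D.\<tau> k powr \<theta>) k \<le> B2 / (1 - lam) * \<Delta> k powr (- \<phi>)" using elim by simp
    have "D.V k powr (1 - \<theta>) \<le> (M * b k) powr (1 - \<theta>)" using elim th by (intro powr_mono2) auto
    also have "\<dots> = M powr (1 - \<theta>) * \<Delta> k powr (- \<phi>)"
      using M by (simp add: powr_mult b_def powr_powr \<theta>\<psi>(2))
    finally have 2: "D.V k powr (1 - \<theta>) \<le> M powr (1 - \<theta>) * \<Delta> k powr (- \<phi>)" .
    have "norm (z k - y) \<le> B1 * (B2 / (1 - lam) * \<Delta> k powr (- \<phi>) + B3 * \<Delta> k powr (- \<phi>) + M powr (1 - \<theta>) * \<Delta> k powr (- \<phi>))"
      using elim 1 2 B1(1) by (smt (verit) mult_left_mono)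
    then show ?case by (simp add: B4_def algebra_simps)
  qed
  have "(\<lambda>k. norm (x k - y)) \<in> O(\<lambda>k. \<Delta> k powr (- \<phi>))"
  proof (rule transfer_distance_rate)
    show "\<exists>B. \<forall>\<^sub>F k in sequentially. norm (z k - y) \<le> B * \<Delta> k powr (- \<phi>)" using zr by blast
    have "\<forall>\<^sub>F k in sequentially. (norm (d k))\<^sup>2 \<le> B * (\<Delta> k powr (- \<phi>))\<^sup>2 \<and> (norm (u k))\<^sup>2 \<le> B * (\<Delta> k powr (- \<phi>))\<^sup>2"
      using Bv bdiff
    proof eventually_elim
      case (elim k)
      have "b k \<le> (\<Delta> k powr (- \<phi>))\<^sup>2"
        unfolding b_def powr_squared using elim \<phi> by (intro powr_mono) auto
      then have "B * b k \<le> B * (\<Delta> k powr (- \<phi>))\<^sup>2" using B by simp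
      then show ?case using elim by linarith
    qed
    then show "\<exists>B. \<forall>\<^sub>F k in sequentially. (norm (d k))\<^sup>2 \<le> B * (\<Delta> k powr (- \<phi>))\<^sup>2 \<and> (norm (u k))\<^sup>2 \<le> B * (\<Delta> k powr (- \<phi>))\<^sup>2"
      by blast
  qed auto
  then show "(\<lambda>k. norm (x k - y)) \<in> O(\<lambda>k. \<Delta> k powr (- ((\<psi> - 1) / 2)))" by (simp add: \<phi>_def)
qed

text \<open>
  For the exponent one half, \<open>V\<close> contracts by the factor \<open>1 - C\<^sup>2 / 64 * \<beta> k\<close> while it dominates
  the tail, whereas \<open>1 / (G k)\<^sup>2\<close> decays at most like \<open>1 - 4 * K * \<beta> k\<close>. The lower bound on the growth of \<open>G\<close> makes the tails of
  \<open>\<alpha> / G\<close> comparable to \<open>1 / G\<close>.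
\<close>
proposition exponential_rate:
  assumes lim: "x \<longlonglongrightarrow> y" and C: "0 < C" and \<rho>: "0 < \<rho>" "\<forall>w\<in>ball y \<rho>. C * \<bar>f w - f y\<bar> powr (1/2) \<le> norm (grad f w)"
    and K: "K < C\<^sup>2 / 400"
    and c: "0 < c" and expand: "\<forall>\<^sub>F k in sequentially. (1 + c * \<alpha> (Suc k)) * G k \<le> G (Suc k)"
  shows "(\<lambda>k. norm (x k - y)) \<in> O(\<lambda>k. inverse (G k))"
    and "(\<lambda>k. max \<bar>f (x k) - f y\<bar> ((norm (grad f (x k)))\<^sup>2)) \<in> O(\<lambda>k. inverse ((G k)\<^sup>2))"
proof -
  from tendsto_diff[OF lim tendsto_norm_zero_cancel[OF x_minus_z]] have zlim: "z \<longlonglongrightarrow> y" by simp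
  have y: "f y = D.fstar"
    using LIMSEQ_unique[OF continuous_on_tendsto_compose[OF continuous_f zlim] D.f_tendsto] by auto
  define b where "b k = inverse ((G k)\<^sup>2)" for k
  have small: "\<forall>\<^sub>F k in sequentially. 0 < \<alpha> k \<and> \<alpha> k < 1 / (2 * K + 1)"
    by (rule \<alpha>_small) (use K_nn in simp)
  have b: "\<forall>\<^sub>F k in sequentially. 0 < b k \<and> 0 < b (Suc k) \<and> 0 < \<beta> k \<and> b k \<le> (1 + 4 * K * \<beta> k) * b (Suc k) \<and> 4 * K * \<beta> k \<le> C\<^sup>2 / 64 * \<beta> k \<and> b k \<le> 3 * b (Suc k)"
    using G_growth small D.\<beta>_pos eventually_ge_at_top[of 1]
  proof eventually_elim
    case (elim k)
    have Gp: "0 < G k" "0 < G (Suc k)" using elim by auto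
    define t where "t = 2 * K * \<alpha> k"
    have t: "0 \<le> t" "t \<le> 1"
    proof -
      show "0 \<le> t" using elim K_nn by (simp add: t_def)
      have "\<alpha> k * (2 * K + 1) < 1" using elim K_nn by (simp add: pos_less_divide_eq)
      then show "t \<le> 1" using elim by (simp add: t_def algebra_simps)
    qed
    have "(G (Suc k))\<^sup>2 \<le> (exp (K * \<alpha> k) * G k)\<^sup>2" using elim Gp by (intro power_mono) auto
    also have "\<dots> = exp t * (G k)\<^sup>2"
      by (simp add: t_def power_mult_distrib power2_eq_square flip: exp_add)
    finally have "b k \<le> exp t * b (Suc k)" using Gp by (simp add: b_def field_simps)
    also have "exp t \<le> 1 + t + t\<^sup>2" by (rule exp_bound[OF t])
    also have "t\<^sup>2 \<le> t" using t mult_left_mono[of t 1 t] by (simp add: power2_eq_square)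
    finally have 1: "b k \<le> (1 + 2 * t) * b (Suc k)" using Gp by (simp add: b_def algebra_simps mult_right_mono)
    have "2 * t \<le> 4 * K * \<beta> k"
      using \<alpha>_le_\<beta>[of k] elim K_nn mult_left_mono[of "\<alpha> k" "\<beta> k" "4 * K"] by (simp add: t_def)
    then have "(1 + 2 * t) * b (Suc k) \<le> (1 + 4 * K * \<beta> k) * b (Suc k)"
      using Gp by (intro mult_right_mono) (auto simp: b_def)
    moreover have "(1 + 2 * t) * b (Suc k) \<le> 3 * b (Suc k)"
      using Gp t by (intro mult_right_mono) (auto simp: b_def)
    moreover have "4 * K * \<beta> k \<le> C\<^sup>2 / 64 * \<beta> k"
    proof (rule mult_right_mono)
      have "0 \<le> C\<^sup>2" by simp
      then show "4 * K \<le> C\<^sup>2 / 64" using K by linarith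
    qed (use elim in auto)
    moreover have "0 < b k" "0 < b (Suc k)" using Gp by (auto simp: b_def)
    ultimately show ?case using 1 elim by linarith
  qed
  have Gb: "\<forall>\<^sub>F k in sequentially. 1 / (G k)\<^sup>2 \<le> b k" by (simp add: b_def inverse_eq_divide)
  have "\<forall>\<^sub>F k in sequentially. 0 < b k \<and> D.\<tau> k \<le> 3 * b (Suc k) \<and>
       (\<forall>M\<ge>0. M * b k - M * b (Suc k) \<le> C\<^sup>2 / 64 * \<beta> k * (M * b (Suc k)) powr (2 * (1/2)))"
    using b \<tau>_le
  proof eventually_elim
    case (elim k)
    have "M * b k - M * b (Suc k) \<le> C\<^sup>2 / 64 * \<beta> k * (M * b (Suc k))" if M: "0 \<le> M" for M
    proof -
      have "4 * K * \<beta> k * b (Suc k) \<le> C\<^sup>2 / 64 * \<beta> k * b (Suc k)"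
        using elim by (intro mult_right_mono[of "4 * K * \<beta> k"]) linarith+
      then have "b k - b (Suc k) \<le> C\<^sup>2 / 64 * \<beta> k * b (Suc k)" using elim unfolding distrib_right by linarith
      then have "M * (b k - b (Suc k)) \<le> M * (C\<^sup>2 / 64 * \<beta> k * b (Suc k))" using M by (rule mult_left_mono)
      then show ?thesis by (simp add: algebra_simps)
    qed
    then show ?case using elim by (auto simp: b_def inverse_eq_divide)
  qed
  from D.value_rate[OF C _ _ zlim \<rho> y this]
  obtain M where M: "0 < M" "\<forall>\<^sub>F k in sequentially. D.V k \<le> M * b k" by auto
  have b': "\<forall>\<^sub>F k in sequentially. 0 < b k \<and> b k \<le> (1 + 4 * K * \<beta> k) * b (Suc k)"
    using b by eventually_elim blast
  from transfer_value_rate[OF y M b' Gb]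
  obtain B where B: "0 < B" and Bv: "\<forall>\<^sub>F k in sequentially. (norm (d k))\<^sup>2 \<le> B * b k \<and> (norm (u k))\<^sup>2 \<le> B * b k \<and>
     max \<bar>f (x k) - f y\<bar> ((norm (grad f (x k)))\<^sup>2) \<le> B * b k" by blast
  show "(\<lambda>k. max \<bar>f (x k) - f y\<bar> ((norm (grad f (x k)))\<^sup>2)) \<in> O(\<lambda>k. inverse ((G k)\<^sup>2))"
  proof (rule bigoI[of _ B])
    show "\<forall>\<^sub>F k in sequentially. norm (max \<bar>f (x k) - f y\<bar> ((norm (grad f (x k)))\<^sup>2)) \<le> B * norm (inverse ((G k)\<^sup>2))"
      using Bv by eventually_elim (simp add: b_def)
  qed
  define h where "h k = inverse (G k)" for k
  have h2: "b k = (h k)\<^sup>2" for k by (simp add: b_def h_def power_inverse)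
  have ev: "\<forall>\<^sub>F k in sequentially. 0 \<le> h k \<and> 0 \<le> h k \<and> c * (\<alpha> (Suc k) * h (Suc k)) \<le> h k - h (Suc k) \<and> \<alpha> k * h k \<le> 1 * h k"
    using expand G_growth \<alpha>_small[OF zero_less_one]
  proof eventually_elim
    case (elim k)
    have Gp: "0 < G k" "0 < G (Suc k)" using elim by auto
    have "(1 + c * \<alpha> (Suc k)) * h (Suc k) \<le> h k"
      using elim Gp by (simp add: h_def field_simps)
    then show ?case using Gp elim by (simp add: h_def algebra_simps)
  qed
  note sm = tail_le_of_decrease(1)[OF c ev]
  obtain B2 where B2: "0 < B2" "\<forall>\<^sub>F k in sequentially. tail (\<lambda>k. \<alpha> k * h k) k \<le> B2 * h k"
    using tail_le_of_decrease(2)[OF c ev] by blast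
  define Q where "Q = max 1 (sqrt B)"
  have Q: "1 \<le> Q" "sqrt B \<le> Q" by (auto simp: Q_def)
  have ev2: "\<forall>\<^sub>F k in sequentially. 0 < \<beta> k \<and> 0 \<le> D.\<tau> k \<and> 0 \<le> h k \<and> \<beta> k * D.\<tau> k powr (1/2) \<le> \<beta> k * (Q * h k) \<and> \<beta> k * norm (u k) \<le> \<beta> k * (Q * h k)"
    using \<tau>_le D.\<tau>_nonneg Bv D.\<beta>_pos
  proof eventually_elim
    case (elim k)
    have hp: "0 < h k" using elim by (simp add: h_def)
    have "D.\<tau> k powr (1/2) = sqrt (D.\<tau> k)" using elim by (simp add: powr_half_sqrt)
    also have "\<dots> \<le> sqrt ((h k)\<^sup>2)"
      using elim by (intro real_sqrt_le_mono) (simp add: h_def power_inverse inverse_eq_divide power_divide)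
    also have "\<dots> = 1 * h k" using hp by simp
    also have "\<dots> \<le> Q * h k" using Q hp by (intro mult_right_mono) auto
    finally have 1: "D.\<tau> k powr (1/2) \<le> Q * h k" .
    have "norm (u k) = sqrt ((norm (u k))\<^sup>2)" by simp
    also have "\<dots> \<le> sqrt (B * (h k)\<^sup>2)" using elim h2 by (intro real_sqrt_le_mono) simp
    also have "\<dots> = sqrt B * h k" using hp by (simp add: real_sqrt_mult)
    also have "\<dots> \<le> Q * h k" using Q hp by (intro mult_right_mono) auto
    finally have 2: "norm (u k) \<le> Q * h k" .
    show ?case using 1 2 elim hp by (intro conjI mult_left_mono) auto
  qed
  have smQ: "summable (\<lambda>k. \<beta> k * (Q * h k))"
    using summable_mult[OF \<beta>_summableI[OF sm], of Q] by (simp add: mult.left_commute algebra_simps)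
  have s1: "summable (\<lambda>k. \<beta> k * D.\<tau> k powr (1/2))"
  proof (rule summable_comparison_test_ev[OF _ smQ])
    show "\<forall>\<^sub>F k in sequentially. norm (\<beta> k * D.\<tau> k powr (1/2)) \<le> \<beta> k * (Q * h k)"
      using ev2
    proof eventually_elim
      case (elim k)
      then have "0 \<le> \<beta> k * D.\<tau> k powr (1/2)" by (intro mult_nonneg_nonneg) auto
      then show ?case using elim by (simp only: real_norm_def abs_of_nonneg)
    qed
  qed
  have s2: "summable (\<lambda>k. \<beta> k * norm (u k))"
  proof (rule summable_comparison_test_ev[OF _ smQ])
    show "\<forall>\<^sub>F k in sequentially. norm (\<beta> k * norm (u k)) \<le> \<beta> k * (Q * h k)"
      using ev2
    proof eventually_elim
      case (elim k)
      then have "0 \<le> \<beta> k * norm (u k)" by (intro mult_nonneg_nonneg) auto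
      then show ?case using elim by (simp only: real_norm_def abs_of_nonneg)
    qed
  qed
  have acc: "\<exists>\<^sub>F k in sequentially. norm (z k - y) < \<epsilon>" if "0 < \<epsilon>" for \<epsilon>
    using eventually_frequently[OF _ tendstoD[OF zlim that]] by (simp add: dist_norm)
  obtain B1 where B1: "0 < B1" "\<forall>\<^sub>F k in sequentially. norm (z k - y) \<le>
      B1 * (tail (\<lambda>k. \<beta> k * D.\<tau> k powr (1/2)) k + tail (\<lambda>k. \<beta> k * norm (u k)) k + D.V k powr (1 - 1/2))"
    using D.convergence_to_accumulation_point(2)[OF C _ _ y \<rho> acc s1 s2] by auto
  define A where "A = Q / (1 - lam) * B2"
  have tQ: "tail (\<lambda>k. \<beta> k * (Q * h k)) k = Q / (1 - lam) * tail (\<lambda>k. \<alpha> k * h k) k" for k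
    using tail_cmult[OF sm, of "Q / (1 - lam)" k] by (simp add: mult.left_commute algebra_simps)
  have "\<forall>\<^sub>F k in sequentially. norm (z k - y) \<le> B1 * (2 * A + sqrt M) * h k"
    using B1(2) B2(2) eventually_all_ge_at_top[OF ev2] M(2) D.V_mono
  proof eventually_elim
    case (elim k)
    have hp: "0 \<le> h k" using elim by auto
    have "tail (\<lambda>k. \<beta> k * (Q * h k)) k \<le> Q / (1 - lam) * (B2 * h k)"
      unfolding tQ using elim Q lam by (intro mult_left_mono) auto
    then have A: "tail (\<lambda>k. \<beta> k * (Q * h k)) k \<le> A * h k" by (simp add: A_def)
    have 1: "tail (\<lambda>k. \<beta> k * D.\<tau> k powr (1/2)) k \<le> tail (\<lambda>k. \<beta> k * (Q * h k)) k"
      using elim by (intro tail_mono s1 smQ) auto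
    have 2: "tail (\<lambda>k. \<beta> k * norm (u k)) k \<le> tail (\<lambda>k. \<beta> k * (Q * h k)) k"
      using elim by (intro tail_mono s2 smQ) auto
    have "D.V k powr (1 - 1/2) = sqrt (D.V k)" using elim by (simp add: powr_half_sqrt)
    also have "\<dots> \<le> sqrt (M * (h k)\<^sup>2)" using elim h2 by (intro real_sqrt_le_mono) simp
    also have "\<dots> = sqrt M * h k" using hp by (simp add: real_sqrt_mult)
    finally have 3: "D.V k powr (1 - 1/2) \<le> sqrt M * h k" .
    have "norm (z k - y) \<le> B1 * (A * h k + A * h k + sqrt M * h k)"
      using elim A 1 2 3 B1(1) by (smt (verit) mult_left_mono)
    then show ?case by (simp add: algebra_simps)
  qed
  then have zr: "\<exists>B. \<forall>\<^sub>F k in sequentially. norm (z k - y) \<le> B * h k" by blast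
  have "(\<lambda>k. norm (x k - y)) \<in> O(h)"
  proof (rule transfer_distance_rate[OF zr])
    show "\<exists>B. \<forall>\<^sub>F k in sequentially. (norm (d k))\<^sup>2 \<le> B * (h k)\<^sup>2 \<and> (norm (u k))\<^sup>2 \<le> B * (h k)\<^sup>2"
      using Bv by (intro exI[of _ B]) (auto simp: h2 elim: eventually_mono)
    show "\<forall>\<^sub>F k in sequentially. 0 \<le> h k" using ev by eventually_elim simp
  qed
  then show "(\<lambda>k. norm (x k - y)) \<in> O(\<lambda>k. inverse (G k))" by (simp add: h_def[abs_def])
qed

end

section \<open>Realizations of the stochastic method\<close>

text \<open>The pointwise limit is a measurable selection of the limit points, and removing a null set from the event
  of a finite limit inferior gives the event on which all assertions hold without exception.\<close>
lemma limit_selection: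
  fixes x :: "nat \<Rightarrow> 'w \<Rightarrow> 'a::euclidean_space"
  assumes M: "prob_space M" and x: "\<And>k. x k \<in> borel_measurable M"
    and ae: "AE \<omega> in M. \<omega> \<in> liminf_bounded M x \<longrightarrow> (\<exists>y\<in>S. (\<lambda>k. x k \<omega>) \<longlonglongrightarrow> y \<and> Q \<omega> y)"
  shows "\<exists>xs \<in> borel_measurable M.
      (AE \<omega> in M. \<omega> \<in> liminf_bounded M x \<longrightarrow> xs \<omega> \<in> S \<and> (\<lambda>k. x k \<omega>) \<longlonglongrightarrow> xs \<omega>) \<and>
      (\<exists>R \<in> sets M. measure M R = measure M (liminf_bounded M x) \<and>
        (\<forall>\<omega>\<in>R. xs \<omega> \<in> S \<and> (\<lambda>k. x k \<omega>) \<longlonglongrightarrow> xs \<omega> \<and> Q \<omega> (xs \<omega>)))"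
proof -
  interpret prob_space M by (rule M)
  note [measurable] = x
  define X where "X = liminf_bounded M x"
  have X: "X \<in> sets M" unfolding X_def liminf_bounded_def by measurable
  define xs where "xs \<omega> = lim (\<lambda>k. x k \<omega>)" for \<omega>
  have good: "xs \<omega> \<in> S \<and> (\<lambda>k. x k \<omega>) \<longlonglongrightarrow> xs \<omega> \<and> Q \<omega> (xs \<omega>)"
    if "\<exists>y\<in>S. (\<lambda>k. x k \<omega>) \<longlonglongrightarrow> y \<and> Q \<omega> y" for \<omega>
    using that limI unfolding xs_def by metis
  obtain N where N: "N \<in> null_sets M"
    "{\<omega> \<in> space M. \<not> (\<omega> \<in> X \<longrightarrow> (\<exists>y\<in>S. (\<lambda>k. x k \<omega>) \<longlonglongrightarrow> y \<and> Q \<omega> y))} \<subseteq> N"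
    using ae unfolding X_def[symmetric] by (auto simp: eventually_ae_filter)
  define R where "R = X - N"
  have R: "R \<in> sets M" using X N(1) by (auto simp: R_def)
  have mR: "measure M R = measure M X" unfolding R_def using N(1) X by (simp add: measure_Diff_null_set)
  have RQ: "xs \<omega> \<in> S \<and> (\<lambda>k. x k \<omega>) \<longlonglongrightarrow> xs \<omega> \<and> Q \<omega> (xs \<omega>)" if "\<omega> \<in> R" for \<omega>
  proof (rule good)
    have "\<omega> \<in> space M" using that X sets.sets_into_space by (auto simp: R_def)
    then show "\<exists>y\<in>S. (\<lambda>k. x k \<omega>) \<longlonglongrightarrow> y \<and> Q \<omega> y" using that N(2) by (auto simp: R_def)
  qed
  have ae': "AE \<omega> in M. \<omega> \<in> X \<longrightarrow> xs \<omega> \<in> S \<and> (\<lambda>k. x k \<omega>) \<longlonglongrightarrow> xs \<omega>"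
    using ae unfolding X_def[symmetric] by eventually_elim (use good in blast)
  have "xs \<in> borel_measurable M" unfolding xs_def by measurable
  then show ?thesis
    using ae' R mR RQ unfolding X_def by blast
qed

lemma frequently_bounded_of_liminf:
  fixes x :: "nat \<Rightarrow> 'a::real_normed_vector"
  assumes "liminf (\<lambda>k. ereal (norm (x k))) < \<infinity>"
  shows "\<exists>B. \<exists>\<^sub>F k in sequentially. norm (x k) \<le> B"
proof (rule ccontr)
  assume "\<not> ?thesis"
  then have "\<forall>\<^sub>F k in sequentially. ereal B \<le> ereal (norm (x k))" for B
    by (auto simp: not_frequently not_le elim!: allE[of _ B] eventually_mono)
  then have "ereal B \<le> liminf (\<lambda>k. ereal (norm (x k)))" for B
    by (intro Liminf_bounded) 
  then have "liminf (\<lambda>k. ereal (norm (x k))) = \<infinity>" by (rule ereal_top)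
  then show False using assms by simp
qed

lemma discount_le:
  fixes \<beta> :: real
  assumes "0 \<le> \<beta>" "\<beta> \<le> 1/2" shows "exp (- (2 * \<beta>)) \<le> 1 - \<beta>"
proof -
  have "2 * (\<beta> * \<beta>) \<le> \<beta>" using assms mult_left_mono[of \<beta> "1/2" \<beta>] by simp
  then have "1 \<le> (1 - \<beta>) * (1 + 2 * \<beta>)" by (simp add: algebra_simps)
  also have "\<dots> \<le> (1 - \<beta>) * exp (2 * \<beta>)" using assms by (intro mult_left_mono) auto
  finally show ?thesis by (simp add: exp_minus field_simps)
qed

text \<open>Measurability of the iterates is a consequence of the recursion, as the initial points are constant.\<close>
lemma sgdm_process_measurable:
  fixes f :: "'a::euclidean_space \<Rightarrow> real"
  assumes "sgdm M f \<alpha> lam \<nu> x0 e x" and "smooth_function f L" and e: "\<And>k. 1 \<le> k \<Longrightarrow> e k \<in> borel_measurable M"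
  shows "x k \<in> borel_measurable M"
proof (induction k rule: less_induct)
  case (less k)
  interpret smooth_function f L by fact
  have [measurable]: "grad f \<in> borel_measurable borel"
    using continuous_grad by (rule borel_measurable_continuous_onI)
  consider "k = 0" | "k = 1" | j where "k = Suc j" "1 \<le> j"
    by (metis One_nat_def Suc_le_eq not0_implies_Suc not_gr_zero)
  then show ?case
  proof cases
    case 3
    have [measurable]: "x j \<in> borel_measurable M" "x (j - 1) \<in> borel_measurable M" "e j \<in> borel_measurable M"
      using less 3 e by auto
    have "x k \<omega> = x j \<omega> - \<alpha> j *\<^sub>R (grad f (x j \<omega> + \<nu> *\<^sub>R (x j \<omega> - x (j - 1) \<omega>)) - e j \<omega>) + lam *\<^sub>R (x j \<omega> - x (j - 1) \<omega>)"
      if "\<omega> \<in> space M" for \<omega>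
      using assms(1) that 3 by (auto simp: sgdm_def Let_def)
    moreover have "(\<lambda>\<omega>. x j \<omega> - \<alpha> j *\<^sub>R (grad f (x j \<omega> + \<nu> *\<^sub>R (x j \<omega> - x (j - 1) \<omega>)) - e j \<omega>)
        + lam *\<^sub>R (x j \<omega> - x (j - 1) \<omega>)) \<in> borel_measurable M"
      by measurable
    ultimately show ?thesis by (subst measurable_cong)
  qed (use assms(1) in \<open>auto simp: sgdm_def cong: measurable_cong\<close>)
qed

text \<open>
  The change of variables. The errors can be recovered from the iterates, hence they are adapted with
  a shift of one index, which is the martingale structure needed for the filter. The discount
  \<open>\<kappa> = K + 1\<close> beats the growth of \<open>G\<close> by one.
\<close>
proposition sgdm_realizations:
  fixes f :: "'a::euclidean_space \<Rightarrow> real" and x e :: "nat \<Rightarrow> 'w \<Rightarrow> 'a"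
  assumes M: "prob_space M" and f: "smooth_function f L" and bdd: "bdd_below (range f)"
    and lam: "0 \<le> lam" "lam < 1"
    and sgdm: "sgdm M f \<alpha> lam \<nu> x0 e x" and noise: "stochastic_errors M x e \<sigma>"
    and steps: "weighted_steps \<alpha> G K q"
  shows "AE \<omega> in M. \<exists>z d u e' \<gamma> \<kappa> c0. sgdm_path \<alpha> G K q f L z d u e' lam \<gamma> \<kappa> (\<lambda>k. x k \<omega>) c0"
proof -
  interpret prob_space M by (rule M)
  interpret f: smooth_function f L by (rule f)
  interpret W: weighted_steps \<alpha> G K q by (rule steps)
  have eM: "e k \<in> borel_measurable M" if "1 \<le> k" for k using noise that by (simp add: stochastic_errors_def)
  have xM: "x k \<in> borel_measurable M" for k by (rule sgdm_process_measurable[OF sgdm f eM])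
  define F where "F = natural_filtration M x"
  have gen: "{x i -` A \<inter> space M | i A. i \<le> k \<and> A \<in> sets borel} \<subseteq> Pow (space M)" for k by auto
  have spF: "space (F k) = space M" for k
    unfolding F_def natural_filtration_def by (rule space_measure_of[OF gen])
  have setsF: "sets (F k) = sigma_sets (space M) {x i -` A \<inter> space M | i A. i \<le> k \<and> A \<in> sets borel}" for k
    unfolding F_def natural_filtration_def by (rule sets_measure_of[OF gen])
  have sub: "subalgebra M (F k)" for k
    unfolding subalgebra_def spF setsF
    by (intro conjI refl sets.sigma_sets_subset) (use measurable_sets[OF xM] in auto)
  have mono: "subalgebra (F (Suc k)) (F k)" for k
    unfolding subalgebra_def spF setsF by (intro conjI refl sigma_sets_mono') (auto intro: le_SucI)
  have xF: "x i \<in> borel_measurable (F k)" if "i \<le> k" for i k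
    by (rule measurableI) (use that in \<open>auto simp: spF setsF intro!: sigma_sets.Basic\<close>)
  define \<beta> where "\<beta> k = \<alpha> k / (1 - lam)" for k
  define w where "w k \<omega> = grad f (x k \<omega> + \<nu> *\<^sub>R (x k \<omega> - x (k - 1) \<omega>))" for k \<omega>
  have step: "x (Suc k) \<omega> = x k \<omega> - \<alpha> k *\<^sub>R (w k \<omega> - e k \<omega>) + lam *\<^sub>R (x k \<omega> - x (k - 1) \<omega>)"
    if "1 \<le> k" "\<omega> \<in> space M" for k \<omega>
    using sgdm that by (auto simp: sgdm_def Let_def w_def)
  have [measurable]: "grad f \<in> borel_measurable borel"
    using f.continuous_grad by (rule borel_measurable_continuous_onI)
  have eF: "e k \<in> borel_measurable (F (Suc k))" if k: "1 \<le> k" for k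
  proof -
    have [measurable]: "x (Suc k) \<in> borel_measurable (F (Suc k))" "x k \<in> borel_measurable (F (Suc k))"
      "x (k - 1) \<in> borel_measurable (F (Suc k))" using xF by auto
    have "e k \<omega> = (1 / \<alpha> k) *\<^sub>R (x (Suc k) \<omega> - x k \<omega> - lam *\<^sub>R (x k \<omega> - x (k - 1) \<omega>)) + w k \<omega>"
      if "\<omega> \<in> space (F (Suc k))" for \<omega>
    proof -
      have "x (Suc k) \<omega> - x k \<omega> - lam *\<^sub>R (x k \<omega> - x (k - 1) \<omega>) = \<alpha> k *\<^sub>R (e k \<omega> - w k \<omega>)"
        using step[OF k, of \<omega>] that by (simp add: spF scaleR_diff_right)
      then show ?thesis using W.\<alpha>_pos[OF k] by simp
    qed
    moreover have "(\<lambda>\<omega>. (1 / \<alpha> k) *\<^sub>R (x (Suc k) \<omega> - x k \<omega> - lam *\<^sub>R (x k \<omega> - x (k - 1) \<omega>)) + w k \<omega>)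
        \<in> borel_measurable (F (Suc k))"
      unfolding w_def by measurable
    ultimately show ?thesis by (subst measurable_cong)
  qed
  interpret N: martingale_noise M F e \<sigma>
    by unfold_locales (use sub mono eF noise in \<open>auto simp: F_def stochastic_errors_def\<close>)
  define \<kappa> where "\<kappa> = K + 1"
  define \<rho> where "\<rho> k = 1 - \<kappa> * \<beta> k" for k
  have \<kappa>: "1 \<le> \<kappa>" using W.K_nn by (simp add: \<kappa>_def)
  have "\<forall>\<^sub>F k in sequentially. 0 < \<alpha> k \<and> \<alpha> k < min 1 ((1 - lam) / (2 * \<kappa>))"
    by (rule W.\<alpha>_small) (use \<kappa> lam in simp)
  then have "\<forall>\<^sub>F k in sequentially. 1 \<le> k \<and> 0 < \<beta> k \<and> \<alpha> k \<le> \<beta> k \<and> \<alpha> k \<le> 1 \<and> \<kappa> * \<beta> k \<le> 1/2 \<and>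
      0 < G k \<and> G k \<le> G (Suc k) \<and> G (Suc k) \<le> exp (K * \<alpha> k) * G k \<and> 1 \<le> G k"
    using W.G_growth W.G_ge_1 eventually_ge_at_top[of 1]
  proof eventually_elim
    case (elim k)
    have "\<kappa> * \<beta> k \<le> 1/2" using elim \<kappa> lam by (simp add: \<beta>_def field_simps)
    moreover have "\<alpha> k \<le> \<beta> k" using elim lam by (simp add: \<beta>_def field_simps)
    ultimately show ?case using elim lam by (simp add: \<beta>_def)
  qed
  then obtain N where N: "\<And>k. N \<le> k \<Longrightarrow> 1 \<le> k \<and> 0 < \<beta> k \<and> \<alpha> k \<le> \<beta> k \<and> \<alpha> k \<le> 1 \<and> \<kappa> * \<beta> k \<le> 1/2 \<and>
      0 < G k \<and> G k \<le> G (Suc k) \<and> G (Suc k) \<le> exp (K * \<alpha> k) * G k \<and> 1 \<le> G k"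
    unfolding eventually_sequentially by blast
  have N1: "1 \<le> N" using N[of N] by simp
  have wts: "0 < (G k)\<^sup>2 \<and> (G (Suc k))\<^sup>2 * (\<rho> k)\<^sup>2 \<le> (1 - \<beta> k) * (G k)\<^sup>2 \<and> 0 \<le> \<beta> k" if k: "N \<le> k" for k
  proof -
    note Nk = N[OF k]
    have "1 * \<beta> k \<le> \<kappa> * \<beta> k" using \<kappa> Nk by (intro mult_right_mono) auto
    then have \<beta>: "\<beta> k \<le> 1/2" using Nk by linarith
    have "G (Suc k) * \<rho> k \<le> (exp (K * \<alpha> k) * G k) * exp (- (\<kappa> * \<beta> k))"
      using Nk exp_ge_add_one_self[of "- (\<kappa> * \<beta> k)"] by (intro mult_mono) (auto simp: \<rho>_def)
    also have "\<dots> = exp (K * \<alpha> k - \<kappa> * \<beta> k) * G k" by (simp add: exp_diff exp_minus field_simps)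
    also have "\<dots> \<le> exp (- \<beta> k) * G k"
    proof -
      have "K * \<alpha> k \<le> K * \<beta> k" using Nk W.K_nn by (intro mult_left_mono) auto
      then show ?thesis using Nk by (simp add: \<kappa>_def algebra_simps)
    qed
    finally have "(G (Suc k) * \<rho> k)\<^sup>2 \<le> (exp (- \<beta> k) * G k)\<^sup>2"
    proof (rule power_mono)
      have "0 < G (Suc k)" using Nk by linarith
      then show "0 \<le> G (Suc k) * \<rho> k" using Nk by (simp add: \<rho>_def)
    qed
    also have "\<dots> = exp (- (2 * \<beta> k)) * (G k)\<^sup>2"
      by (simp add: power_mult_distrib power2_eq_square flip: exp_add)
    also have "\<dots> \<le> (1 - \<beta> k) * (G k)\<^sup>2"
      using Nk \<beta> by (intro mult_right_mono discount_le) auto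
    finally show ?thesis using Nk by (simp add: power_mult_distrib)
  qed
  have \<beta>G: "summable (\<lambda>k. (\<beta> k)\<^sup>2 * (G k)\<^sup>2)"
    using summable_mult[OF W.\<alpha>G_sum, of "1 / (1 - lam)\<^sup>2"] by (simp add: \<beta>_def power_divide)
  have \<beta>G': "summable (\<lambda>k. (G (Suc k))\<^sup>2 * (\<beta> k)\<^sup>2)"
  proof (rule summable_comparison_test_ev[OF _ summable_mult[OF \<beta>G, of "(exp K)\<^sup>2"]])
    have "norm ((G (Suc k))\<^sup>2 * (\<beta> k)\<^sup>2) \<le> (exp K)\<^sup>2 * ((\<beta> k)\<^sup>2 * (G k)\<^sup>2)" if k: "N \<le> k" for k
    proof -
      have "K * \<alpha> k \<le> K" using N[OF k] W.K_nn mult_left_mono[of "\<alpha> k" 1 K] by simp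
      then have "exp (K * \<alpha> k) * G k \<le> exp K * G k" using N[OF k] by (intro mult_right_mono) auto
      then have "(G (Suc k))\<^sup>2 \<le> (exp K * G k)\<^sup>2" using N[OF k] by (intro power_mono) linarith+
      then have "(G (Suc k))\<^sup>2 * (\<beta> k)\<^sup>2 \<le> (exp K * G k)\<^sup>2 * (\<beta> k)\<^sup>2" by (rule mult_right_mono) simp
      then show ?thesis by (simp add: power_mult_distrib mult_ac)
    qed
    then show "\<forall>\<^sub>F k in sequentially. norm ((G (Suc k))\<^sup>2 * (\<beta> k)\<^sup>2) \<le> (exp K)\<^sup>2 * ((\<beta> k)\<^sup>2 * (G k)\<^sup>2)"
      unfolding eventually_sequentially by blast
  qed
  define u where "u = N.u N \<rho> \<beta>"
  have u_Suc: "u (Suc k) \<omega> = \<rho> k *\<^sub>R u k \<omega> - \<beta> k *\<^sub>R e k \<omega>" if "N \<le> k" for k \<omega>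
    using that unfolding u_def by (simp add: N.u_Suc[OF N1])
  have A1: "AE \<omega> in M. summable (\<lambda>k. \<beta> k * ((G k)\<^sup>2 * (norm (u k \<omega>))\<^sup>2))"
    unfolding u_def by (rule N.weighted_filtered_noise(1)[OF N1 wts \<beta>G'])
  have A2: "AE \<omega> in M. \<exists>B. \<forall>k\<ge>N. (G k)\<^sup>2 * (norm (u k \<omega>))\<^sup>2 \<le> B"
    unfolding u_def by (rule N.weighted_filtered_noise(2)[OF N1 wts \<beta>G'])
  have A3: "AE \<omega> in M. summable (\<lambda>k. (\<beta> k)\<^sup>2 * (G k)\<^sup>2 * (norm (e k \<omega>))\<^sup>2)"
    by (rule N.AE_summable_weighted_noise[OF \<beta>G]) simp
  define d where "d k \<omega> = x k \<omega> - x (k - 1) \<omega>" for k \<omega>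
  define z where "z k \<omega> = x k \<omega> + (lam / (1 - lam)) *\<^sub>R d k \<omega> + u k \<omega>" for k \<omega>
  from A1 A2 A3 AE_space have "AE \<omega> in M. sgdm_path \<alpha> G K q f L (\<lambda>k. z k \<omega>) (\<lambda>k. d k \<omega>) (\<lambda>k. u k \<omega>) (\<lambda>k. e k \<omega>)
      lam (\<nu> - lam / (1 - lam)) \<kappa> (\<lambda>k. x k \<omega>) (lam / (1 - lam))"
  proof eventually_elim
    case (elim \<omega>)
    have xt: "z k \<omega> - u k \<omega> + (\<nu> - lam / (1 - lam)) *\<^sub>R d k \<omega> = x k \<omega> + \<nu> *\<^sub>R d k \<omega>" for k
      by (simp add: z_def algebra_simps)
    have wk: "grad f (z k \<omega> - u k \<omega> + (\<nu> - lam / (1 - lam)) *\<^sub>R d k \<omega>) = w k \<omega>" for k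
      unfolding xt by (simp add: w_def d_def)
    have \<alpha>\<beta>: "\<alpha> k = (1 - lam) * \<beta> k" for k using lam by (simp add: \<beta>_def)
    have dS: "d (Suc k) \<omega> = lam *\<^sub>R d k \<omega> + (1 - lam) *\<^sub>R (\<beta> k *\<^sub>R (e k \<omega> - w k \<omega>))" if "N \<le> k" for k
    proof -
      have "d (Suc k) \<omega> = lam *\<^sub>R d k \<omega> - \<alpha> k *\<^sub>R (w k \<omega> - e k \<omega>)"
        using step[of k \<omega>] N[OF that] elim by (simp add: d_def)
      also have "\<dots> = lam *\<^sub>R d k \<omega> + (1 - lam) *\<^sub>R (\<beta> k *\<^sub>R (e k \<omega> - w k \<omega>))"
        by (simp add: \<alpha>\<beta> scaleR_diff_right)
      finally show ?thesis .
    qed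
    have zS: "z (Suc k) \<omega> = z k \<omega> - \<beta> k *\<^sub>R (w k \<omega> + \<kappa> *\<^sub>R u k \<omega>)" if "N \<le> k" for k
    proof -
      define D where "D = \<beta> k *\<^sub>R (e k \<omega> - w k \<omega>)"
      have dk: "d (Suc k) \<omega> = lam *\<^sub>R d k \<omega> + (1 - lam) *\<^sub>R D" using dS[OF that] by (simp add: D_def)
      have "z (Suc k) \<omega> = x k \<omega> + d (Suc k) \<omega> + (lam / (1 - lam)) *\<^sub>R d (Suc k) \<omega> + u (Suc k) \<omega>"
        by (simp add: z_def d_def)
      also have "\<dots> = x k \<omega> + (1 / (1 - lam)) *\<^sub>R d (Suc k) \<omega> + u (Suc k) \<omega>"
      proof -
        have "1 + lam / (1 - lam) = 1 / (1 - lam)" using lam by (simp add: field_simps)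
        then have "d (Suc k) \<omega> + (lam / (1 - lam)) *\<^sub>R d (Suc k) \<omega> = (1 / (1 - lam)) *\<^sub>R d (Suc k) \<omega>"
          by (metis scaleR_left_distrib scaleR_one)
        then show ?thesis by (simp add: add.assoc)
      qed
      also have "(1 / (1 - lam)) *\<^sub>R d (Suc k) \<omega> = (lam / (1 - lam)) *\<^sub>R d k \<omega> + D"
        using lam by (simp add: dk scaleR_right_distrib)
      finally have eq: "z (Suc k) \<omega> = x k \<omega> + ((lam / (1 - lam)) *\<^sub>R d k \<omega> + D) + u (Suc k) \<omega>" .
      show ?thesis
        unfolding eq u_Suc[OF that] z_def[of k \<omega>] D_def \<rho>_def by (simp add: algebra_simps)
    qed
    have Gd: "\<forall>\<^sub>F k in sequentially. 1 \<le> (G k)\<^sup>2 \<and> 0 < \<beta> k"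
      unfolding eventually_sequentially using N by (intro exI[of _ N]) (auto simp: one_le_power)
    show ?case
    proof (intro_locales; (intro corrected_momentum_axioms.intro sgdm_path_axioms.intro)?)
      show "bdd_below (range f)" "0 \<le> lam" "lam < 1" "0 \<le> \<kappa>" using bdd lam \<kappa> by auto
      show "\<forall>\<^sub>F k in sequentially. 0 < \<alpha> k / (1 - lam)" using Gd by eventually_elim (simp add: \<beta>_def)
      show "(\<lambda>k. \<alpha> k / (1 - lam)) \<longlonglongrightarrow> 0" using tendsto_divide[OF W.\<alpha>_null tendsto_const, of "1 - lam"] lam by simp
      show "\<not> summable (\<lambda>k. \<alpha> k / (1 - lam))" using W.not_summable_\<alpha> lam by simp
      show "\<forall>\<^sub>F k in sequentially. z (Suc k) \<omega> = z k \<omega> - (\<alpha> k / (1 - lam)) *\<^sub>R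
          (grad f (z k \<omega> - u k \<omega> + (\<nu> - lam / (1 - lam)) *\<^sub>R d k \<omega>) + \<kappa> *\<^sub>R u k \<omega>)"
        unfolding wk eventually_sequentially using zS unfolding \<beta>_def by blast
      show "\<forall>\<^sub>F k in sequentially. d (Suc k) \<omega> = lam *\<^sub>R d k \<omega> + (1 - lam) *\<^sub>R ((\<alpha> k / (1 - lam)) *\<^sub>R
          (e k \<omega> - grad f (z k \<omega> - u k \<omega> + (\<nu> - lam / (1 - lam)) *\<^sub>R d k \<omega>)))"
        unfolding wk eventually_sequentially using dS unfolding \<beta>_def by blast
      show "summable (\<lambda>k. \<alpha> k / (1 - lam) * (norm (u k \<omega>))\<^sup>2)"
      proof (rule summable_comparison_test_ev[OF _ elim(1)])
        show "\<forall>\<^sub>F k in sequentially. norm (\<alpha> k / (1 - lam) * (norm (u k \<omega>))\<^sup>2) \<le> \<beta> k * ((G k)\<^sup>2 * (norm (u k \<omega>))\<^sup>2)"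
          using Gd
        proof eventually_elim
          case (elim k)
          have "1 * (norm (u k \<omega>))\<^sup>2 \<le> (G k)\<^sup>2 * (norm (u k \<omega>))\<^sup>2" using elim by (intro mult_right_mono) auto
          then have "\<beta> k * (norm (u k \<omega>))\<^sup>2 \<le> \<beta> k * ((G k)\<^sup>2 * (norm (u k \<omega>))\<^sup>2)" using elim by (intro mult_left_mono) auto
          moreover have "0 \<le> \<beta> k * (norm (u k \<omega>))\<^sup>2" using elim by simp
          ultimately show ?case by (simp only: \<beta>_def[symmetric] real_norm_def abs_of_nonneg)
        qed
      qed
      show "summable (\<lambda>k. (\<alpha> k / (1 - lam))\<^sup>2 * (norm (e k \<omega>))\<^sup>2)"
      proof (rule summable_comparison_test_ev[OF _ elim(3)])
        show "\<forall>\<^sub>F k in sequentially. norm ((\<alpha> k / (1 - lam))\<^sup>2 * (norm (e k \<omega>))\<^sup>2) \<le> (\<beta> k)\<^sup>2 * (G k)\<^sup>2 * (norm (e k \<omega>))\<^sup>2"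
          using Gd
        proof eventually_elim
          case (elim k)
          have "(\<beta> k)\<^sup>2 * 1 * (norm (e k \<omega>))\<^sup>2 \<le> (\<beta> k)\<^sup>2 * (G k)\<^sup>2 * (norm (e k \<omega>))\<^sup>2"
            using elim by (intro mult_right_mono mult_left_mono) auto
          then show ?case by (simp add: \<beta>_def)
        qed
      qed
      show "\<forall>\<^sub>F k in sequentially. x k \<omega> = z k \<omega> - (lam / (1 - lam)) *\<^sub>R d k \<omega> - u k \<omega>" by (simp add: z_def)
      show "summable (\<lambda>k. \<alpha> k / (1 - lam) * ((G k)\<^sup>2 * (norm (u k \<omega>))\<^sup>2))" using elim(1) by (simp add: \<beta>_def)
      show "summable (\<lambda>k. (\<alpha> k / (1 - lam))\<^sup>2 * (G k)\<^sup>2 * (norm (e k \<omega>))\<^sup>2)" using elim(3) by (simp add: \<beta>_def)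
      show "\<exists>B. \<forall>\<^sub>F k in sequentially. (G k)\<^sup>2 * (norm (u k \<omega>))\<^sup>2 \<le> B"
        using elim(2) unfolding eventually_sequentially by blast
    qed
  qed
  then show ?thesis by eventually_elim blast
qed

section \<open>Concrete weights and the main result\<close>

text \<open>The exponent \<open>(2 * r + 1) / (4 * r)\<close> is the one at which the noise exponent \<open>2 * r\<close> and the descent exponent
  \<open>1 / (2 * \<theta> - 1)\<close> coincide. Below it the noise decides, above it the descent does.\<close>
lemma rate_exponents:
  assumes r: "1/2 < r" and th: "1/2 \<le> \<theta>" "\<theta> < 1" and \<theta>': "\<theta>' = max \<theta> ((2 * r + 1) / (4 * r))"
  shows "1/2 < \<theta>'" "\<theta>' < 1" "1 / (2 * \<theta>' - 1) \<le> 2 * r"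
    and "rate_psi r \<theta> = 1 / (2 * \<theta>' - 1)" and "rate_phi r \<theta> = (1 / (2 * \<theta>' - 1) - 1) / 2"
proof -
  have t0: "1/2 < (2 * r + 1) / (4 * r)" "(2 * r + 1) / (4 * r) < 1" using r by (auto simp: field_simps)
  show "1/2 < \<theta>'" using t0(1) unfolding \<theta>' less_max_iff_disj by blast
  show "\<theta>' < 1" using t0(2) th unfolding \<theta>' by simp
  have t1: "2 * ((2 * r + 1) / (4 * r)) - 1 = 1 / (2 * r)" using r by (simp add: field_simps)
  have p: "0 < 2 * \<theta>' - 1" using \<open>1/2 < \<theta>'\<close> by simp
  have "1 / (2 * r) \<le> 2 * \<theta>' - 1" unfolding \<theta>' using t1 by linarith
  then have "1 / (2 * \<theta>' - 1) \<le> 1 / (1 / (2 * r))" using r p by (intro divide_left_mono) auto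
  then show "1 / (2 * \<theta>' - 1) \<le> 2 * r" by simp
  have half: "(1 - \<theta>) / (2 * \<theta> - 1) = (1 / (2 * \<theta> - 1) - 1) / 2" if "\<theta> \<noteq> 1/2"
    using that by (simp add: field_simps)
  have "rate_psi r \<theta> = 1 / (2 * \<theta>' - 1) \<and> rate_phi r \<theta> = (1 / (2 * \<theta>' - 1) - 1) / 2"
  proof (cases "\<theta> \<le> (2 * r + 1) / (4 * r)")
    case True
    then have e: "1 / (2 * \<theta>' - 1) = 2 * r" using t1 r by (simp add: \<theta>' max_def)
    show ?thesis
    proof (cases "\<theta> = 1/2")
      case False
      then have p: "0 < 2 * \<theta> - 1" using th by simp
      have "2 * \<theta> - 1 \<le> 1 / (2 * r)" using True t1 by linarith
      then have "1 / (1 / (2 * r)) \<le> 1 / (2 * \<theta> - 1)" using p r by (intro divide_left_mono) auto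
      then have a: "2 * r \<le> 1 / (2 * \<theta> - 1)" by simp
      have b: "r - 1/2 \<le> (1 - \<theta>) / (2 * \<theta> - 1)" 
      proof -
        have "r - 1/2 \<le> (X - 1) / 2" if "2 * r \<le> X" for X using that by simp
        then show ?thesis unfolding half[OF False] using a by blast
      qed
      show ?thesis
        unfolding e rate_psi_def rate_phi_def min_absorb1[OF a] min_absorb1[OF b] using False by auto
    qed (simp add: e rate_psi_def rate_phi_def)
  next
    case False
    then have e: "\<theta>' = \<theta>" by (simp add: \<theta>')
    have n: "\<theta> \<noteq> 1/2" using False t0(1) less_imp_le by metis
    have a: "1 / (2 * \<theta> - 1) \<le> 2 * r" using \<open>1 / (2 * \<theta>' - 1) \<le> 2 * r\<close> e by simp
    have b: "(1 - \<theta>) / (2 * \<theta> - 1) \<le> r - 1/2"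
    proof -
      have "(X - 1) / 2 \<le> r - 1/2" if "X \<le> 2 * r" for X using that by simp
      then show ?thesis unfolding half[OF n] using a by blast
    qed
    show ?thesis
      unfolding e rate_psi_def rate_phi_def min_absorb2[OF a] min_absorb2[OF b] using n half[OF n] by auto
  qed
  then show "rate_psi r \<theta> = 1 / (2 * \<theta>' - 1)" "rate_phi r \<theta> = (1 / (2 * \<theta>' - 1) - 1) / 2" by auto
qed

lemma (in step_sizes) \<Delta>_growth: "\<forall>\<^sub>F k in sequentially. \<Delta> (Suc k) \<le> exp (\<alpha> k) * \<Delta> k"
  using \<Delta>_ge[of 1] eventually_ge_at_top[of 1]
proof eventually_elim
  case (elim k)
  have "\<Delta> (Suc k) \<le> \<Delta> k + \<alpha> k * 1" using \<alpha>_dec[of k] elim by (simp add: \<Delta>_Suc)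
  also have "\<dots> \<le> \<Delta> k + \<alpha> k * \<Delta> k" using elim \<alpha>_pos[of k] by (intro add_left_mono mult_left_mono) auto
  also have "\<dots> = (1 + \<alpha> k) * \<Delta> k" by (simp add: algebra_simps)
  also have "\<dots> \<le> exp (\<alpha> k) * \<Delta> k" using elim by (intro mult_right_mono) auto
  finally show ?case .
qed

lemma (in step_sizes) polynomial_weights:
  assumes r: "1/2 < r" and sm: "summable (\<lambda>k. (\<alpha> k)\<^sup>2 * (G k)\<^sup>2)"
    and G: "\<And>k. 1 \<le> k \<Longrightarrow> G k = \<Delta> k powr r"
  shows "weighted_steps \<alpha> G r r"
proof unfold_locales
  show "0 \<le> r" "1/2 < r" "summable (\<lambda>k. (\<alpha> k)\<^sup>2 * (G k)\<^sup>2)" using r sm by auto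
  show "\<forall>\<^sub>F k in sequentially. \<Delta> k powr r \<le> G k"
    using eventually_ge_at_top[of 1] by eventually_elim (simp add: G)
  show "\<forall>\<^sub>F k in sequentially. 0 < G k \<and> G k \<le> G (Suc k) \<and> G (Suc k) \<le> exp (r * \<alpha> k) * G k"
    using \<Delta>_growth eventually_ge_at_top[of 1]
  proof eventually_elim
    case (elim k)
    have p: "0 < \<Delta> k" "\<Delta> k \<le> \<Delta> (Suc k)" using \<Delta>_pos[of k] \<Delta>_mono[of k "Suc k"] elim by auto
    have "\<Delta> (Suc k) powr r \<le> (exp (\<alpha> k) * \<Delta> k) powr r" using elim p r by (intro powr_mono2) auto
    also have "\<dots> = exp (r * \<alpha> k) * \<Delta> k powr r" using p by (simp add: powr_mult exp_powr_real mult.commute)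
    finally show ?case using p elim r by (simp add: G powr_mono2)
  qed
qed

text \<open>The factor \<open>\<Delta> powr (- p)\<close> changes relatively by at most \<open>p * \<alpha> / \<Delta>\<close> in one step, which is eventually
  at most half of the relative growth \<open>r * \<alpha>\<close> of the exponential.\<close>
lemma (in step_sizes) exponential_weights:
  assumes r: "0 < r" and p: "0 \<le> p" and sm: "summable (\<lambda>k. (\<alpha> k)\<^sup>2 * (G k)\<^sup>2)"
    and G: "\<And>k. 1 \<le> k \<Longrightarrow> G k = \<Delta> k powr (- p) * exp (r * \<Delta> k)"
  shows "weighted_steps \<alpha> G r 1"
    and "\<forall>\<^sub>F k in sequentially. (1 + r / 2 * \<alpha> (Suc k)) * G k \<le> G (Suc k)"
proof -
  show exp: "\<forall>\<^sub>F k in sequentially. (1 + r / 2 * \<alpha> (Suc k)) * G k \<le> G (Suc k)"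
    using \<Delta>_ge[of "2 * p / r"] eventually_ge_at_top[of 1]
  proof eventually_elim
    case (elim k)
    define a where "a = \<alpha> (Suc k)"
    define D where "D = \<Delta> k"
    have a: "0 < a" using \<alpha>_pos[of "Suc k"] by (simp add: a_def)
    have D: "0 < D" "2 * p \<le> r * D" using \<Delta>_pos[of k] elim r by (auto simp: D_def field_simps)
    have S: "\<Delta> (Suc k) = D + a" by (simp add: \<Delta>_Suc D_def a_def)
    have "D + a \<le> D * exp (a / D)"
    proof -
      have "D * (1 + a / D) \<le> D * exp (a / D)" using D by (intro mult_left_mono) auto
      moreover have "D * (1 + a / D) = D + a" using D by (simp add: field_simps)
      ultimately show ?thesis by simp
    qed
    then have "(D * exp (a / D)) powr (- p) \<le> (D + a) powr (- p)" using D a p by (intro powr_mono2') auto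
    then have 1: "D powr (- p) * exp (- (p * (a / D))) \<le> (D + a) powr (- p)"
      using D by (simp add: powr_mult exp_powr_real mult.commute)
    have "p * (a / D) \<le> r / 2 * a"
    proof -
      have "p * a \<le> r / 2 * D * a" using D a by (intro mult_right_mono) auto
      then show ?thesis using D by (simp add: field_simps)
    qed
    then have "1 + r / 2 * a \<le> 1 + (r * a - p * (a / D))" by (simp add: field_simps)
    also have "\<dots> \<le> exp (r * a - p * (a / D))" by (rule exp_ge_add_one_self)
    finally have "(1 + r / 2 * a) * (D powr (- p) * exp (r * D)) \<le> exp (r * a - p * (a / D)) * (D powr (- p) * exp (r * D))"
      by (intro mult_right_mono) auto
    also have "\<dots> = (D powr (- p) * exp (- (p * (a / D)))) * exp (r * (D + a))"
      by (simp add: exp_diff exp_minus distrib_left exp_add field_simps)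
    also have "\<dots> \<le> (D + a) powr (- p) * exp (r * (D + a))" using 1 by (intro mult_right_mono) auto
    finally show ?case using elim S by (simp add: G a_def D_def)
  qed
  show "weighted_steps \<alpha> G r 1"
  proof unfold_locales
    show "0 \<le> r" "1/2 < (1::real)" "summable (\<lambda>k. (\<alpha> k)\<^sup>2 * (G k)\<^sup>2)" using r sm by auto
    have "\<forall>\<^sub>F t::real in at_top. t powr 1 \<le> t powr (- p) * exp (r * t)"
      using r p by real_asymp
    then have "\<forall>\<^sub>F k in sequentially. \<Delta> k powr 1 \<le> \<Delta> k powr (- p) * exp (r * \<Delta> k)"
      using \<Delta>_top by (rule eventually_compose_filterlim)
    then show "\<forall>\<^sub>F k in sequentially. \<Delta> k powr 1 \<le> G k"
      using eventually_ge_at_top[of 1] by eventually_elim (simp add: G)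
    show "\<forall>\<^sub>F k in sequentially. 0 < G k \<and> G k \<le> G (Suc k) \<and> G (Suc k) \<le> exp (r * \<alpha> k) * G k"
      using exp eventually_ge_at_top[of 1]
    proof eventually_elim
      case (elim k)
      have D: "0 < \<Delta> k" "\<Delta> k \<le> \<Delta> (Suc k)" using \<Delta>_pos[of k] \<Delta>_mono[of k "Suc k"] elim by auto
      then have Gp: "0 < G k" using elim by (simp add: G)
      have "1 * G k \<le> (1 + r / 2 * \<alpha> (Suc k)) * G k"
        using Gp r \<alpha>_pos[of "Suc k"] by (intro mult_right_mono) auto
      then have mono: "G k \<le> G (Suc k)" using elim by linarith
      have "\<Delta> (Suc k) powr (- p) * exp (r * \<Delta> (Suc k)) \<le> \<Delta> k powr (- p) * exp (r * \<alpha> k + r * \<Delta> k)"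
      proof (rule mult_mono)
        show "\<Delta> (Suc k) powr (- p) \<le> \<Delta> k powr (- p)" using D p by (intro powr_mono2') auto
        have "r * \<Delta> (Suc k) \<le> r * (\<alpha> k + \<Delta> k)"
          using \<alpha>_dec[of k] elim r by (intro mult_left_mono) (auto simp: \<Delta>_Suc)
        then show "exp (r * \<Delta> (Suc k)) \<le> exp (r * \<alpha> k + r * \<Delta> k)" by (simp add: distrib_left)
      qed auto
      then show ?case using Gp mono elim by (simp add: G exp_add mult_ac)
    qed
  qed
qed

theorem theorem5p1:
  fixes M :: "'w measure"
    and f :: "'a::euclidean_space \<Rightarrow> real"
    and x e :: "nat \<Rightarrow> 'w \<Rightarrow> 'a"
    and x0 :: 'a
    and \<alpha> :: "nat \<Rightarrow> real"
    and g :: "real \<Rightarrow> real"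
    and L lam \<nu> \<sigma> :: real
  assumes "prob_space M"
    and "\<And>y. f differentiable (at y)"
    and "bdd_below (range f)"
    and "0 < L" and "L-lipschitz_on UNIV (grad f)"
    and "lojasiewicz_on_crit f"
    and "0 \<le> lam" and "lam < 1" and "0 \<le> \<nu>"
    and "sgdm M f \<alpha> lam \<nu> x0 e x"
    and "0 \<le> \<sigma>" and "stochastic_errors M x e \<sigma>"
    and "\<And>t. 0 < t \<Longrightarrow> 0 < g t"
    and "\<And>k. 1 \<le> k \<Longrightarrow> 0 < \<alpha> k"
    and "\<And>k. 1 \<le> k \<Longrightarrow> \<alpha> (Suc k) \<le> \<alpha> k"
    and "filterlim (step_sum \<alpha>) at_top sequentially"
    and "summable (\<lambda>k. (\<alpha> (Suc k))\<^sup>2 * (g (step_sum \<alpha> (Suc k)))\<^sup>2)"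
  shows
    "(\<forall>r>1/2. (\<forall>t>0. g t = t powr r) \<longrightarrow>
        (\<exists>xs \<in> borel_measurable M.
           (AE \<omega> in M. \<omega> \<in> liminf_bounded M x \<longrightarrow>
              xs \<omega> \<in> crit f \<and> (\<lambda>k. x k \<omega>) \<longlonglongrightarrow> xs \<omega>) \<and>
           (\<exists>R \<in> sets M. measure M R = measure M (liminf_bounded M x) \<and>
              (\<forall>\<omega>\<in>R. xs \<omega> \<in> crit f \<and> (\<lambda>k. x k \<omega>) \<longlonglongrightarrow> xs \<omega> \<and>
                 (\<forall>\<theta>. lojasiewicz_exponent f (xs \<omega>) \<theta> \<longrightarrow>
                    (\<lambda>k. norm (x k \<omega> - xs \<omega>))
                      \<in> O(\<lambda>k. step_sum \<alpha> k powr (- rate_phi r \<theta>)) \<and>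
                    (\<lambda>k. max \<bar>f (x k \<omega>) - f (xs \<omega>)\<bar> ((norm (grad f (x k \<omega>)))\<^sup>2))
                      \<in> O(\<lambda>k. step_sum \<alpha> k powr (- rate_psi r \<theta>)))))))
     \<and>
     (\<forall>r>0. \<forall>p\<ge>0. (\<forall>t>0. g t = t powr (- p) * exp (r * t)) \<longrightarrow>
        (\<exists>xs \<in> borel_measurable M.
           (AE \<omega> in M. \<omega> \<in> liminf_bounded M x \<longrightarrow>
              xs \<omega> \<in> crit f \<and> (\<lambda>k. x k \<omega>) \<longlonglongrightarrow> xs \<omega>) \<and>
           (\<exists>R \<in> sets M. measure M R = measure M (liminf_bounded M x) \<and>
              (\<forall>\<omega>\<in>R. xs \<omega> \<in> crit f \<and> (\<lambda>k. x k \<omega>) \<longlonglongrightarrow> xs \<omega> \<and>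
                 (\<forall>C. lojasiewicz_exponent f (xs \<omega>) (1/2) \<and>
                      merit_lojasiewicz_constant f L lam (xs \<omega>) (1/2) C \<and>
                      r < C\<^sup>2 / 400 \<longrightarrow>
                    (\<lambda>k. norm (x k \<omega> - xs \<omega>))
                      \<in> O(\<lambda>k. inverse (g (step_sum \<alpha> k))) \<and>
                    (\<lambda>k. max \<bar>f (x k \<omega>) - f (xs \<omega>)\<bar> ((norm (grad f (x k \<omega>)))\<^sup>2))
                      \<in> O(\<lambda>k. inverse ((g (step_sum \<alpha> k))\<^sup>2)))))))"
proof -
  note M = assms(1)
  have f: "smooth_function f L" by unfold_locales (use assms(2,4,5) in auto)
  interpret f: smooth_function f L by (rule f)
  interpret step_sizes \<alpha> by unfold_locales (use assms(14-16) in auto)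
  define G where "G k = g (step_sum \<alpha> k)" for k
  have sm: "summable (\<lambda>k. (\<alpha> k)\<^sup>2 * (G k)\<^sup>2)"
    using assms(17) summable_Suc_iff[of "\<lambda>k. (\<alpha> k)\<^sup>2 * (G k)\<^sup>2"] by (simp add: G_def)
  have xM: "x k \<in> borel_measurable M" for k
    by (rule sgdm_process_measurable[OF assms(10) f]) (use assms(12) in \<open>auto simp: stochastic_errors_def\<close>)
  note realizations = sgdm_realizations[OF M f assms(3,7,8,10,12)]
  show ?thesis
  proof (intro conjI allI impI)
    fix r :: real assume r: "1/2 < r" and g: "\<forall>t>0. g t = t powr r"
    have W: "weighted_steps \<alpha> G r r"
      by (rule polynomial_weights[OF r sm]) (use g \<Delta>_pos in \<open>simp add: G_def\<close>)
    define Q where "Q \<omega> y \<longleftrightarrow> (\<forall>\<theta>. lojasiewicz_exponent f y \<theta> \<longrightarrow>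
        (\<lambda>k. norm (x k \<omega> - y)) \<in> O(\<lambda>k. step_sum \<alpha> k powr (- rate_phi r \<theta>)) \<and>
        (\<lambda>k. max \<bar>f (x k \<omega>) - f y\<bar> ((norm (grad f (x k \<omega>)))\<^sup>2))
          \<in> O(\<lambda>k. step_sum \<alpha> k powr (- rate_psi r \<theta>)))" for \<omega> y
    have "AE \<omega> in M. \<omega> \<in> liminf_bounded M x \<longrightarrow> (\<exists>y\<in>crit f. (\<lambda>k. x k \<omega>) \<longlonglongrightarrow> y \<and> Q \<omega> y)"
      using realizations[OF W]
    proof (eventually_elim, intro impI)
      case (elim \<omega>)
      then obtain z d u e' \<gamma> \<kappa> c0 where "sgdm_path \<alpha> G r r f L z d u e' lam \<gamma> \<kappa> (\<lambda>k. x k \<omega>) c0" by blast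
      then interpret p: sgdm_path \<alpha> G r r f L z d u e' lam \<gamma> \<kappa> "\<lambda>k. x k \<omega>" c0 .
      assume "\<omega> \<in> liminf_bounded M x"
      then obtain y where y: "y \<in> crit f" "(\<lambda>k. x k \<omega>) \<longlonglongrightarrow> y"
        using p.convergence[OF assms(6) frequently_bounded_of_liminf] by (auto simp: liminf_bounded_def)
      have "Q \<omega> y" unfolding Q_def
      proof (intro allI impI)
        fix \<theta> assume th: "lojasiewicz_exponent f y \<theta>"
        define \<theta>' where "\<theta>' = max \<theta> ((2 * r + 1) / (4 * r))"
        have th2: "1/2 \<le> \<theta>" "\<theta> < 1" "\<theta> \<le> \<theta>'" using th by (auto simp: lojasiewicz_exponent_def \<theta>'_def)
        note R = rate_exponents[OF r th2(1,2) \<theta>'_def]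
        show "(\<lambda>k. norm (x k \<omega> - y)) \<in> O(\<lambda>k. step_sum \<alpha> k powr (- rate_phi r \<theta>)) \<and>
          (\<lambda>k. max \<bar>f (x k \<omega>) - f y\<bar> ((norm (grad f (x k \<omega>)))\<^sup>2))
          \<in> O(\<lambda>k. step_sum \<alpha> k powr (- rate_psi r \<theta>))"
          unfolding R(4,5) using p.polynomial_rate[OF y(2) th th2(3) R(1,2) refl R(3)] by blast
      qed
      then show "\<exists>y\<in>crit f. (\<lambda>k. x k \<omega>) \<longlonglongrightarrow> y \<and> Q \<omega> y" using y by blast
    qed
    from limit_selection[OF M xM this]
    show "\<exists>xs \<in> borel_measurable M.
           (AE \<omega> in M. \<omega> \<in> liminf_bounded M x \<longrightarrow>
              xs \<omega> \<in> crit f \<and> (\<lambda>k. x k \<omega>) \<longlonglongrightarrow> xs \<omega>) \<and>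
           (\<exists>R \<in> sets M. measure M R = measure M (liminf_bounded M x) \<and>
              (\<forall>\<omega>\<in>R. xs \<omega> \<in> crit f \<and> (\<lambda>k. x k \<omega>) \<longlonglongrightarrow> xs \<omega> \<and>
                 (\<forall>\<theta>. lojasiewicz_exponent f (xs \<omega>) \<theta> \<longrightarrow>
                    (\<lambda>k. norm (x k \<omega> - xs \<omega>))
                      \<in> O(\<lambda>k. step_sum \<alpha> k powr (- rate_phi r \<theta>)) \<and>
                    (\<lambda>k. max \<bar>f (x k \<omega>) - f (xs \<omega>)\<bar> ((norm (grad f (x k \<omega>)))\<^sup>2))
                      \<in> O(\<lambda>k. step_sum \<alpha> k powr (- rate_psi r \<theta>)))))"
      unfolding Q_def .
  next
    fix r p :: real assume r: "0 < r" and p: "0 \<le> p" and g: "\<forall>t>0. g t = t powr (- p) * exp (r * t)"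
    have G: "G k = \<Delta> k powr (- p) * exp (r * \<Delta> k)" if "1 \<le> k" for k
      using g \<Delta>_pos[OF that] by (simp add: G_def)
    have W: "weighted_steps \<alpha> G r 1" by (rule exponential_weights(1)[OF r p sm G])
    have expand: "\<forall>\<^sub>F k in sequentially. (1 + r / 2 * \<alpha> (Suc k)) * G k \<le> G (Suc k)"
      by (rule exponential_weights(2)[OF r p sm G])
    define Q where "Q \<omega> y \<longleftrightarrow> (\<forall>C. lojasiewicz_exponent f y (1/2) \<and>
          merit_lojasiewicz_constant f L lam y (1/2) C \<and> r < C\<^sup>2 / 400 \<longrightarrow>
        (\<lambda>k. norm (x k \<omega> - y)) \<in> O(\<lambda>k. inverse (g (step_sum \<alpha> k))) \<and>
        (\<lambda>k. max \<bar>f (x k \<omega>) - f y\<bar> ((norm (grad f (x k \<omega>)))\<^sup>2))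
          \<in> O(\<lambda>k. inverse ((g (step_sum \<alpha> k))\<^sup>2)))" for \<omega> y
    have "AE \<omega> in M. \<omega> \<in> liminf_bounded M x \<longrightarrow> (\<exists>y\<in>crit f. (\<lambda>k. x k \<omega>) \<longlonglongrightarrow> y \<and> Q \<omega> y)"
      using realizations[OF W]
    proof (eventually_elim, intro impI)
      case (elim \<omega>)
      then obtain z d u e' \<gamma> \<kappa> c0 where "sgdm_path \<alpha> G r 1 f L z d u e' lam \<gamma> \<kappa> (\<lambda>k. x k \<omega>) c0" by blast
      then interpret p: sgdm_path \<alpha> G r 1 f L z d u e' lam \<gamma> \<kappa> "\<lambda>k. x k \<omega>" c0 .
      assume "\<omega> \<in> liminf_bounded M x"
      then obtain y where y: "y \<in> crit f" "(\<lambda>k. x k \<omega>) \<longlonglongrightarrow> y"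
        using p.convergence[OF assms(6) frequently_bounded_of_liminf] by (auto simp: liminf_bounded_def)
      have "Q \<omega> y" unfolding Q_def
      proof (intro allI impI, elim conjE)
        fix C assume C: "merit_lojasiewicz_constant f L lam y (1/2) C" and rC: "r < C\<^sup>2 / 400"
        have C0: "0 < C" using C by (simp add: merit_lojasiewicz_constant_def)
        obtain \<rho> where \<rho>: "0 < \<rho>" "\<forall>w\<in>ball y \<rho>. C * \<bar>f w - f y\<bar> powr (1/2) \<le> norm (grad f w)"
          using f.merit_constant_ball[OF C] by blast
        have "0 < r / 2" using r by simp
        from p.exponential_rate[OF y(2) C0 \<rho> rC this expand]
        show "(\<lambda>k. norm (x k \<omega> - y)) \<in> O(\<lambda>k. inverse (g (step_sum \<alpha> k))) \<and>
          (\<lambda>k. max \<bar>f (x k \<omega>) - f y\<bar> ((norm (grad f (x k \<omega>)))\<^sup>2))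
          \<in> O(\<lambda>k. inverse ((g (step_sum \<alpha> k))\<^sup>2))"
          unfolding G_def by blast
      qed
      then show "\<exists>y\<in>crit f. (\<lambda>k. x k \<omega>) \<longlonglongrightarrow> y \<and> Q \<omega> y" using y by blast
    qed
    from limit_selection[OF M xM this]
    show "\<exists>xs \<in> borel_measurable M.
           (AE \<omega> in M. \<omega> \<in> liminf_bounded M x \<longrightarrow>
              xs \<omega> \<in> crit f \<and> (\<lambda>k. x k \<omega>) \<longlonglongrightarrow> xs \<omega>) \<and>
           (\<exists>R \<in> sets M. measure M R = measure M (liminf_bounded M x) \<and>
              (\<forall>\<omega>\<in>R. xs \<omega> \<in> crit f \<and> (\<lambda>k. x k \<omega>) \<longlonglongrightarrow> xs \<omega> \<and>
                 (\<forall>C. lojasiewicz_exponent f (xs \<omega>) (1/2) \<and>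
                      merit_lojasiewicz_constant f L lam (xs \<omega>) (1/2) C \<and>
                      r < C\<^sup>2 / 400 \<longrightarrow>
                    (\<lambda>k. norm (x k \<omega> - xs \<omega>))
                      \<in> O(\<lambda>k. inverse (g (step_sum \<alpha> k))) \<and>
                    (\<lambda>k. max \<bar>f (x k \<omega>) - f (xs \<omega>)\<bar> ((norm (grad f (x k \<omega>)))\<^sup>2))
                      \<in> O(\<lambda>k. inverse ((g (step_sum \<alpha> k))\<^sup>2)))))"
      unfolding Q_def .
  qed
qed

end
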